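(* Let $n\ge 1$ and $e,f\ge 0$ be integers, and let $G=GL(n,\mathbb C)$ act on $S=S_{e,f,n}$ and on $M_n(S)$ as described in the context. The evaluation map $ev:\mathcal F_T\langle X,Y\rangle\to M_n(S)$, $y_i\mapsto\eta_i$, $x_j\mapsto \xi_j$, surjects onto the algebra of $G$-invariants $M_n(S)^G$. That is: (1) the algebra $\mathcal T_n:=S^G$ of invariants of $e$ bosonic and $f$ fermionic matrices is generated by the elements $tr(M)$, for all monomials $M$ in the generic matrices $\xi_j,\eta_i$; (2) the algebra $\mathcal E_n:=M_n(S)^G$ of equivariant maps is generated by the elements $tr(M)\in\mathcal T_n$ (identified with the scalar matrices $tr(M)\cdot 1$) and by the generic matrices $\xi_j,\eta_i$.
   Context: All algebras are associative, unital, over $\mathbb C$. A superalgebra is a $\mathbb Z/2$-graded algebra $A=A_0\oplus A_1$; $d(a)\in\{0,1\}$ denotes the degree of a homogeneous element; $A$ is supercommutative if $ab=(-1)^{d(a)d(b)}ba$ for homogeneous $a,b$. $S=S_{e,f,n}=\mathbb C[\eta^{(i)}_{h,k}]\otimes\bigwedge[\xi^{(j)}_{h,k}]$ is the free supercommutative superalgebra on the degree $0$ (bosonic, commuting) variables $\eta^{(i)}_{h,k}$, $1\le i\le e$, and the degree $1$ (fermionic, Grassmann) variables $\xi^{(j)}_{h,k}$, $1\le j\le f$, with $1\le h,k\le n$. The generic matrices are $\eta_i=(\eta^{(i)}_{h,k})$ and $\xi_j=(\xi^{(j)}_{h,k})$ in $M_n(S)=M_n(\mathbb C)\otimes S$,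 where $M_n(\mathbb C)$ is placed in degree $0$. $tr:M_n(S)\to S$ is the usual trace. $G$ acts on $S$ by algebra automorphisms, via the action on coordinate functions dual to simultaneous conjugation of matrices: the matrix with entries $g\cdot\eta^{(i)}_{h,k}$ is $g^{-1}\eta_i g$, and the matrix with entries $g\cdot\xi^{(j)}_{h,k}$ is $g^{-1}\xi_j g$. $G$ acts on $M_n(S)=M_n(\mathbb C)\otimes S$ diagonally: $g\cdot(A\otimes s)=gAg^{-1}\otimes g\cdot s$. A superalgebra with trace is a superalgebra $R$ with a linear degree-preserving map $t:R\to R$ such that for homogeneous $a,b$: $t(a)b=(-1)^{d(a)d(b)}b\,t(a)$, $t(ab)=(-1)^{d(a)d(b)}t(ba)$, $t(t(a)b)=t(a)t(b)$. $\mathcal F_T\langle X,Y\rangle$ is the free superalgebra with trace on the degree $1$ variables $X=\{x_1,\dots,x_f\}$ and degree $0$ variables $Y=\{y_1,\dots,y_e\}$. $M_n(S)$ is a superalgebra with trace via $tr$ (with $S$ identified with scalar matrices), and $ev$ is the unique trace-preserving superalgebra homomorphism with $y_i\mapsto\eta_i$, $x_j\mapsto\xi_j$. *)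

theory Defs
  imports "Jordan_Normal_Form.Matrix" "HOL-Algebra.Module" "HOL-Library.Poly_Mapping"
    "HOL-Library.FSet" "HOL-Library.Z2"
begin

text \<open>The exterior algebra over a commutative ring on generators indexed by a linearly ordered type:
  the element \<open>f\<close> stands for \<open>\<Sum>A. f A \<cdot> \<xi>\<^sub>A\<close>, where \<open>\<xi>\<^sub>A\<close> is the product of the generators in
  the finite set \<open>A\<close>, taken in increasing order. Hence \<open>\<xi>\<^sub>A \<xi>\<^sub>B = 0\<close> if \<open>A\<close> and \<open>B\<close> meet;
  otherwise it is \<open>ext_sign A B \<cdot> \<xi>\<^sub>C\<close> for the union \<open>C\<close> of \<open>A\<close> and \<open>B\<close>.\<close>

typedef (overloaded) ('v, 'r) ext = "UNIV :: ('v fset \<Rightarrow>\<^sub>0 'r::zero) set"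
  morphisms ext_coeffs Ext ..

setup_lifting type_definition_ext

definition ext_sign :: "'v::linorder fset \<Rightarrow> 'v fset \<Rightarrow> 'r::comm_ring_1" where
  "ext_sign A B = (-1) ^ card {(a, b). a |\<in>| A \<and> b |\<in>| B \<and> b < a}"

lift_definition ext_mult ::
  "('v::linorder fset \<Rightarrow>\<^sub>0 'r) \<Rightarrow> ('v fset \<Rightarrow>\<^sub>0 'r) \<Rightarrow> ('v fset \<Rightarrow>\<^sub>0 'r::comm_ring_1)"
  is "\<lambda>f g C. \<Sum>A\<in>{A. A |\<subseteq>| C}. ext_sign A (C |-| A) * f A * g (C |-| A)"
proof -
  fix f g :: "'v fset \<Rightarrow> 'r"
  assume fin: "finite {x. f x \<noteq> 0}" "finite {x. g x \<noteq> 0}"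
  show "finite {C. (\<Sum>A\<in>{A. A |\<subseteq>| C}. ext_sign A (C |-| A) * f A * g (C |-| A)) \<noteq> 0}"
  proof (rule finite_subset)
    show "finite ((\<lambda>(A, B). A |\<union>| B) ` ({x. f x \<noteq> 0} \<times> {x. g x \<noteq> 0}))"
      using fin by blast
    show "{C. (\<Sum>A\<in>{A. A |\<subseteq>| C}. ext_sign A (C |-| A) * f A * g (C |-| A)) \<noteq> 0}
      \<subseteq> (\<lambda>(A, B). A |\<union>| B) ` ({x. f x \<noteq> 0} \<times> {x. g x \<noteq> 0})"
    proof
      fix C assume "C \<in> {C. (\<Sum>A\<in>{A. A |\<subseteq>| C}. ext_sign A (C |-| A) * f A * g (C |-| A)) \<noteq> 0}"
      then obtain A where A: "A |\<subseteq>| C" "ext_sign A (C |-| A) * f A * g (C |-| A) \<noteq> 0"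
        by (auto elim: sum.not_neutral_contains_not_neutral)
      then have "f A \<noteq> 0" "g (C |-| A) \<noteq> 0" by auto
      moreover have "C = A |\<union>| (C |-| A)" using A by blast
      ultimately show "C \<in> (\<lambda>(A, B). A |\<union>| B) ` ({x. f x \<noteq> 0} \<times> {x. g x \<noteq> 0})"
        by (intro image_eqI[where x = "(A, C |-| A)"]) auto
    qed
  qed
qed

lemma finite_fsubsets [simp]: "finite {A. A |\<subseteq>| (C :: 'v fset)}"
proof -
  have "{A. A |\<subseteq>| C} = fset (fPow C)" by auto
  then show ?thesis by simp
qed

lemma finite_inversions:
  "finite {(a, b). a |\<in>| A \<and> b |\<in>| B \<and> b < (a :: 'v::linorder)}"
  by (rule finite_subset[of _ "fset A \<times> fset B"]) auto

lemma ext_sign_union_left: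
  assumes "A |\<inter>| B = {||}"
  shows "(ext_sign (A |\<union>| B) C :: 'r::comm_ring_1) = ext_sign A C * ext_sign B C"
proof -
  have "{(a, b). a |\<in>| A |\<union>| B \<and> b |\<in>| C \<and> b < a} =
    {(a, b). a |\<in>| A \<and> b |\<in>| C \<and> b < a} \<union> {(a, b). a |\<in>| B \<and> b |\<in>| C \<and> b < a}" by auto
  moreover have "{(a, b). a |\<in>| A \<and> b |\<in>| C \<and> b < a} \<inter> {(a, b). a |\<in>| B \<and> b |\<in>| C \<and> b < a} = {}"
    using assms by auto
  ultimately show ?thesis
    unfolding ext_sign_def by (simp add: card_Un_disjoint finite_inversions power_add)
qed

lemma ext_sign_union_right:
  assumes "B |\<inter>| C = {||}"
  shows "(ext_sign A (B |\<union>| C) :: 'r::comm_ring_1) = ext_sign A B * ext_sign A C"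
proof -
  have "{(a, b). a |\<in>| A \<and> b |\<in>| B |\<union>| C \<and> b < a} =
    {(a, b). a |\<in>| A \<and> b |\<in>| B \<and> b < a} \<union> {(a, b). a |\<in>| A \<and> b |\<in>| C \<and> b < a}" by auto
  moreover have "{(a, b). a |\<in>| A \<and> b |\<in>| B \<and> b < a} \<inter> {(a, b). a |\<in>| A \<and> b |\<in>| C \<and> b < a} = {}"
    using assms by auto
  ultimately show ?thesis
    unfolding ext_sign_def by (simp add: card_Un_disjoint finite_inversions power_add)
qed

lemma ext_sign_empty [simp]: "ext_sign {||} A = 1" "ext_sign A {||} = 1"
  by (simp_all add: ext_sign_def)

lemma ext_mult_assoc: "ext_mult (ext_mult f g) h = ext_mult f (ext_mult g h)"
proof (rule poly_mapping_eqI)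
  fix D :: "'a fset"
  let ?s = "ext_sign :: 'a fset \<Rightarrow> 'a fset \<Rightarrow> 'b"
  have "Poly_Mapping.lookup (ext_mult (ext_mult f g) h) D =
    (\<Sum>C\<in>{C. C |\<subseteq>| D}. \<Sum>A\<in>{A. A |\<subseteq>| C}. ?s C (D |-| C) * (?s A (C |-| A) * Poly_Mapping.lookup f A
       * Poly_Mapping.lookup g (C |-| A)) * Poly_Mapping.lookup h (D |-| C))"
    by (simp add: ext_mult.rep_eq sum_distrib_left sum_distrib_right)
  also have "\<dots> = (\<Sum>(C, A)\<in>(SIGMA C:{C. C |\<subseteq>| D}. {A. A |\<subseteq>| C}). ?s C (D |-| C) * (?s A (C |-| A) * Poly_Mapping.lookup f A
       * Poly_Mapping.lookup g (C |-| A)) * Poly_Mapping.lookup h (D |-| C))"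
    by (rule sum.Sigma) auto
  also have "\<dots> = (\<Sum>(A, B)\<in>(SIGMA A:{A. A |\<subseteq>| D}. {B. B |\<subseteq>| D |-| A}). ?s A (D |-| A) * Poly_Mapping.lookup f A *
       (?s B (D |-| A |-| B) * Poly_Mapping.lookup g B * Poly_Mapping.lookup h (D |-| A |-| B)))"
  proof (rule sum.reindex_bij_witness[of _ "\<lambda>(A, B). (A |\<union>| B, A)" "\<lambda>(C, A). (A, C |-| A)"])
    fix x assume "x \<in> (SIGMA C:{C. C |\<subseteq>| D}. {A. A |\<subseteq>| C})"
    then obtain C A where x: "x = (C, A)" "C |\<subseteq>| D" "A |\<subseteq>| C" by auto
    define B where "B = C |-| A"
    define E where "E = D |-| C"
    have 1: "C = A |\<union>| B" "D |-| A = B |\<union>| E" "D |-| A |-| B = E"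
       "A |\<inter>| B = {||}" "B |\<inter>| E = {||}"
      using x by (auto simp: B_def E_def)
    have "?s C E * ?s A B = ?s A (D |-| A) * ?s B E"
      unfolding 1(1,2) by (simp add: ext_sign_union_left ext_sign_union_right 1 mult_ac)
    then have "?s C E * (?s A B * Poly_Mapping.lookup f A * Poly_Mapping.lookup g B) * Poly_Mapping.lookup h E
      = ?s A (D |-| A) * Poly_Mapping.lookup f A * (?s B E * Poly_Mapping.lookup g B * Poly_Mapping.lookup h E)"
      by (metis (no_types, opaque_lifting) mult.assoc mult.left_commute)
    then show "(case (case x of (C, A) \<Rightarrow> (A, C |-| A)) of (A, B) \<Rightarrow> ?s A (D |-| A) * Poly_Mapping.lookup f A *
       (?s B (D |-| A |-| B) * Poly_Mapping.lookup g B * Poly_Mapping.lookup h (D |-| A |-| B))) = 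
      (case x of (C, A) \<Rightarrow> ?s C (D |-| C) * (?s A (C |-| A) * Poly_Mapping.lookup f A
       * Poly_Mapping.lookup g (C |-| A)) * Poly_Mapping.lookup h (D |-| C))"
      using 1(3) by (simp add: x flip: B_def E_def)
  qed auto
  also have "\<dots> = (\<Sum>A\<in>{A. A |\<subseteq>| D}. \<Sum>B\<in>{B. B |\<subseteq>| D |-| A}. ?s A (D |-| A) * Poly_Mapping.lookup f A *
       (?s B (D |-| A |-| B) * Poly_Mapping.lookup g B * Poly_Mapping.lookup h (D |-| A |-| B)))"
    by (rule sum.Sigma[symmetric]) auto
  also have "\<dots> = Poly_Mapping.lookup (ext_mult f (ext_mult g h)) D"
    by (simp add: ext_mult.rep_eq sum_distrib_left)
  finally show "Poly_Mapping.lookup (ext_mult (ext_mult f g) h) D = Poly_Mapping.lookup (ext_mult f (ext_mult g h)) D" .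
qed

lemma ext_mult_one_left: "ext_mult (Poly_Mapping.single {||} 1) f = f"
proof (rule poly_mapping_eqI)
  fix C
  have "Poly_Mapping.lookup (ext_mult (Poly_Mapping.single {||} 1) f) C =
    (\<Sum>A\<in>{A. A |\<subseteq>| C}. if A = {||} then Poly_Mapping.lookup f C else 0)"
    unfolding ext_mult.rep_eq by (rule sum.cong) (auto simp: lookup_single when_def)
  then show "Poly_Mapping.lookup (ext_mult (Poly_Mapping.single {||} 1) f) C = Poly_Mapping.lookup f C" by simp
qed

lemma ext_mult_one_right: "ext_mult f (Poly_Mapping.single {||} 1) = f"
proof (rule poly_mapping_eqI)
  fix C
  have "Poly_Mapping.lookup (ext_mult f (Poly_Mapping.single {||} 1)) C =
    (\<Sum>A\<in>{A. A |\<subseteq>| C}. if A = C then Poly_Mapping.lookup f C else 0)"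
    unfolding ext_mult.rep_eq by (rule sum.cong) (auto simp: lookup_single when_def)
  then show "Poly_Mapping.lookup (ext_mult f (Poly_Mapping.single {||} 1)) C = Poly_Mapping.lookup f C" by simp
qed

lemma ext_mult_distrib:
  "ext_mult (f + g) h = ext_mult f h + ext_mult g h"
  "ext_mult h (f + g) = ext_mult h f + ext_mult h g"
  by (rule poly_mapping_eqI; simp add: ext_mult.rep_eq lookup_add algebra_simps sum.distrib)+

instantiation ext :: (linorder, comm_ring_1) ring_1
begin

lift_definition zero_ext :: "('a, 'b) ext" is 0 .
lift_definition one_ext :: "('a, 'b) ext" is "Poly_Mapping.single {||} 1" .
lift_definition plus_ext :: "('a, 'b) ext \<Rightarrow> ('a, 'b) ext \<Rightarrow> ('a, 'b) ext" is "(+)" .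
lift_definition minus_ext :: "('a, 'b) ext \<Rightarrow> ('a, 'b) ext \<Rightarrow> ('a, 'b) ext" is "(-)" .
lift_definition uminus_ext :: "('a, 'b) ext \<Rightarrow> ('a, 'b) ext" is uminus .
lift_definition times_ext :: "('a, 'b) ext \<Rightarrow> ('a, 'b) ext \<Rightarrow> ('a, 'b) ext" is ext_mult .

instance
proof
  show "(0 :: ('a, 'b) ext) \<noteq> 1"
    by transfer (metis lookup_single_eq lookup_zero zero_neq_one)
qed (transfer; simp add: ext_mult_assoc ext_mult_one_left ext_mult_one_right ext_mult_distrib add_ac)+

end

lift_definition ext_scal :: "'r \<Rightarrow> ('v::linorder, 'r::comm_ring_1) ext" is "Poly_Mapping.single {||}" .
lift_definition ext_gen :: "'v \<Rightarrow> ('v::linorder, 'r::comm_ring_1) ext"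
  is "\<lambda>v. Poly_Mapping.single {|v|} 1" .

text \<open>The sign \<open>(-1)\<close> to the power \<open>d d'\<close>.\<close>

definition koszul :: "bit \<Rightarrow> bit \<Rightarrow> complex" where
  "koszul d d' = (if d = 1 \<and> d' = 1 then -1 else 1)"

text \<open>\<open>part A d\<close> is the set of elements of \<open>A\<close> that are homogeneous of degree \<open>d\<close> (\<open>0\<close> belongs to both).\<close>

record 'a superalgebra = "(complex, 'a) module" +
  part :: "bit \<Rightarrow> 'a set"

record 'a trace_superalgebra = "'a superalgebra" +
  trc :: "'a \<Rightarrow> 'a"

locale superalgebra = ring A for A :: "('a, 'm) superalgebra_scheme" (structure) +
  assumes smult_closed: "x \<in> carrier A \<Longrightarrow> c \<odot> x \<in> carrier A"
    and smult_l_distr: "x \<in> carrier A \<Longrightarrow> (c + c') \<odot> x = c \<odot> x \<oplus> c' \<odot> x"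
    and smult_r_distr: "x \<in> carrier A \<Longrightarrow> y \<in> carrier A \<Longrightarrow> c \<odot> (x \<oplus> y) = c \<odot> x \<oplus> c \<odot> y"
    and smult_assoc: "x \<in> carrier A \<Longrightarrow> (c * c') \<odot> x = c \<odot> (c' \<odot> x)"
    and smult_one: "x \<in> carrier A \<Longrightarrow> 1 \<odot> x = x"
    and smult_mult_left: "x \<in> carrier A \<Longrightarrow> y \<in> carrier A \<Longrightarrow> (c \<odot> x) \<otimes> y = c \<odot> (x \<otimes> y)"
    and smult_mult_right: "x \<in> carrier A \<Longrightarrow> y \<in> carrier A \<Longrightarrow> x \<otimes> (c \<odot> y) = c \<odot> (x \<otimes> y)"
    and part_subset: "part A d \<subseteq> carrier A"
    and part_zero: "\<zero> \<in> part A d"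
    and part_add: "x \<in> part A d \<Longrightarrow> y \<in> part A d \<Longrightarrow> x \<oplus> y \<in> part A d"
    and part_smult: "x \<in> part A d \<Longrightarrow> c \<odot> x \<in> part A d"
    and part_one: "\<one> \<in> part A 0"
    and part_mult: "x \<in> part A d \<Longrightarrow> y \<in> part A d' \<Longrightarrow> x \<otimes> y \<in> part A (d + d')"
    and part_sum: "x \<in> carrier A \<Longrightarrow> \<exists>x0\<in>part A 0. \<exists>x1\<in>part A 1. x = x0 \<oplus> x1"
    and part_Int: "part A 0 \<inter> part A 1 = {\<zero>}"

locale trace_superalgebra = superalgebra A
  for A :: "('a, 'm) trace_superalgebra_scheme" (structure) +
  assumes trc_add: "x \<in> carrier A \<Longrightarrow> y \<in> carrier A \<Longrightarrow> trc A (x \<oplus> y) = trc A x \<oplus> trc A y"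
    and trc_smult: "x \<in> carrier A \<Longrightarrow> trc A (c \<odot> x) = c \<odot> trc A x"
    and trc_part: "x \<in> part A d \<Longrightarrow> trc A x \<in> part A d"
    and trc_comm: "x \<in> part A d \<Longrightarrow> y \<in> part A d' \<Longrightarrow> trc A x \<otimes> y = koszul d d' \<odot> (y \<otimes> trc A x)"
    and trc_mult: "x \<in> part A d \<Longrightarrow> y \<in> part A d' \<Longrightarrow> trc A (x \<otimes> y) = koszul d d' \<odot> trc A (y \<otimes> x)"
    and trc_trc: "x \<in> part A d \<Longrightarrow> y \<in> part A d' \<Longrightarrow> trc A (trc A x \<otimes> y) = trc A x \<otimes> trc A y"

definition trace_superalgebra_hom ::
  "('a, 'm) trace_superalgebra_scheme \<Rightarrow> ('b, 'k) trace_superalgebra_scheme \<Rightarrow> ('a \<Rightarrow> 'b) set" where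
  "trace_superalgebra_hom A B = {\<phi> \<in> ring_hom A B.
     (\<forall>c. \<forall>x\<in>carrier A. \<phi> (c \<odot>\<^bsub>A\<^esub> x) = c \<odot>\<^bsub>B\<^esub> \<phi> x) \<and>
     (\<forall>d. \<phi> ` part A d \<subseteq> part B d) \<and>
     (\<forall>x\<in>carrier A. \<phi> (trc A x) = trc B (\<phi> x))}"

text \<open>The unital subalgebra over the complex numbers generated by \<open>V\<close>; zero and negatives are
  obtained as scalar multiples.\<close>

inductive_set subalgebra_generated :: "('a, 'm) superalgebra_scheme \<Rightarrow> 'a set \<Rightarrow> 'a set"
  for A and V where
  "\<one>\<^bsub>A\<^esub> \<in> subalgebra_generated A V"
| "x \<in> V \<Longrightarrow> x \<in> subalgebra_generated A V"
| "\<lbrakk>x \<in> subalgebra_generated A V; y \<in> subalgebra_generated A V\<rbrakk>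
    \<Longrightarrow> x \<oplus>\<^bsub>A\<^esub> y \<in> subalgebra_generated A V"
| "\<lbrakk>x \<in> subalgebra_generated A V; y \<in> subalgebra_generated A V\<rbrakk>
    \<Longrightarrow> x \<otimes>\<^bsub>A\<^esub> y \<in> subalgebra_generated A V"
| "x \<in> subalgebra_generated A V \<Longrightarrow> c \<odot>\<^bsub>A\<^esub> x \<in> subalgebra_generated A V"

text \<open>The letters: \<open>Bos i\<close> is the variable \<open>y\<close> number \<open>i\<close> (degree 0), \<open>Fer j\<close> the variable \<open>x\<close> number \<open>j\<close>
  (degree 1). Indices start at 0 everywhere.\<close>

datatype gvar = Bos nat | Fer nat

definition gvars :: "nat \<Rightarrow> nat \<Rightarrow> gvar set" where
  "gvars e f = Bos ` {..<e} \<union> Fer ` {..<f}"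

fun gdeg :: "gvar \<Rightarrow> bit" where
  "gdeg (Bos i) = 0"
| "gdeg (Fer j) = 1"

text \<open>The free superalgebra with trace is the set of formal expressions in the variables modulo the
  least congruence forcing the axioms of a superalgebra with trace. The sign rules are imposed on
  expressions that are syntactically homogeneous; every homogeneous element of the quotient has
  such a representative. The theorems \<open>trace_superalgebra_FT\<close> and \<open>free_hom_universal\<close> below are
  the universal property.\<close>

datatype tterm = TVar gvar | TOne | TZero | TAdd tterm tterm | TScal complex tterm | TMul tterm tterm | TTr tterm

fun tvars :: "tterm \<Rightarrow> gvar set" where
  "tvars (TVar v) = {v}"
| "tvars TOne = {}"
| "tvars TZero = {}"
| "tvars (TAdd s t) = tvars s \<union> tvars t"
| "tvars (TScal c t) = tvars t"
| "tvars (TMul s t) = tvars s \<union> tvars t"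
| "tvars (TTr t) = tvars t"

inductive homog :: "bit \<Rightarrow> tterm \<Rightarrow> bool" where
  "homog (gdeg v) (TVar v)"
| "homog 0 TOne"
| "homog d TZero"
| "homog d s \<Longrightarrow> homog d t \<Longrightarrow> homog d (TAdd s t)"
| "homog d t \<Longrightarrow> homog d (TScal c t)"
| "homog d s \<Longrightarrow> homog d' t \<Longrightarrow> homog (d + d') (TMul s t)"
| "homog d t \<Longrightarrow> homog d (TTr t)"

inductive teq :: "tterm \<Rightarrow> tterm \<Rightarrow> bool" (infix "\<approx>\<^sub>t" 50) where
  refl: "t \<approx>\<^sub>t t"
| sym: "s \<approx>\<^sub>t t \<Longrightarrow> t \<approx>\<^sub>t s"
| trans: "r \<approx>\<^sub>t s \<Longrightarrow> s \<approx>\<^sub>t t \<Longrightarrow> r \<approx>\<^sub>t t"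
| cong_Add: "s \<approx>\<^sub>t s' \<Longrightarrow> t \<approx>\<^sub>t t' \<Longrightarrow> TAdd s t \<approx>\<^sub>t TAdd s' t'"
| cong_Scal: "t \<approx>\<^sub>t t' \<Longrightarrow> TScal c t \<approx>\<^sub>t TScal c t'"
| cong_Mul: "s \<approx>\<^sub>t s' \<Longrightarrow> t \<approx>\<^sub>t t' \<Longrightarrow> TMul s t \<approx>\<^sub>t TMul s' t'"
| cong_Tr: "t \<approx>\<^sub>t t' \<Longrightarrow> TTr t \<approx>\<^sub>t TTr t'"
| Add_assoc: "TAdd (TAdd r s) t \<approx>\<^sub>t TAdd r (TAdd s t)"
| Add_comm: "TAdd s t \<approx>\<^sub>t TAdd t s"
| Add_Zero: "TAdd TZero t \<approx>\<^sub>t t"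
| Add_neg: "TAdd (TScal (-1) t) t \<approx>\<^sub>t TZero"
| Scal_Add: "TScal c (TAdd s t) \<approx>\<^sub>t TAdd (TScal c s) (TScal c t)"
| Scal_plus: "TScal (c + c') t \<approx>\<^sub>t TAdd (TScal c t) (TScal c' t)"
| Scal_times: "TScal (c * c') t \<approx>\<^sub>t TScal c (TScal c' t)"
| Scal_one: "TScal 1 t \<approx>\<^sub>t t"
| Mul_assoc: "TMul (TMul r s) t \<approx>\<^sub>t TMul r (TMul s t)"
| Mul_One_left: "TMul TOne t \<approx>\<^sub>t t"
| Mul_One_right: "TMul t TOne \<approx>\<^sub>t t"
| Mul_Add_left: "TMul (TAdd r s) t \<approx>\<^sub>t TAdd (TMul r t) (TMul s t)"
| Mul_Add_right: "TMul r (TAdd s t) \<approx>\<^sub>t TAdd (TMul r s) (TMul r t)"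
| Mul_Scal_left: "TMul (TScal c s) t \<approx>\<^sub>t TScal c (TMul s t)"
| Mul_Scal_right: "TMul s (TScal c t) \<approx>\<^sub>t TScal c (TMul s t)"
| Tr_Add: "TTr (TAdd s t) \<approx>\<^sub>t TAdd (TTr s) (TTr t)"
| Tr_Scal: "TTr (TScal c t) \<approx>\<^sub>t TScal c (TTr t)"
| Tr_central: "homog d s \<Longrightarrow> homog d' t \<Longrightarrow> TMul (TTr s) t \<approx>\<^sub>t TScal (koszul d d') (TMul t (TTr s))"
| Tr_cyclic: "homog d s \<Longrightarrow> homog d' t \<Longrightarrow> TTr (TMul s t) \<approx>\<^sub>t TScal (koszul d d') (TTr (TMul t s))"
| Tr_Tr: "homog d s \<Longrightarrow> homog d' t \<Longrightarrow> TTr (TMul (TTr s) t) \<approx>\<^sub>t TMul (TTr s) (TTr t)"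

quotient_type ftr = tterm / teq morphisms rep_ftr abs_ftr
  by (intro equivpI reflpI sympI transpI) (blast intro: teq.intros)+

lemma teq_One_neq_Zero: "\<not> TOne \<approx>\<^sub>t TZero"
proof -
  define \<epsilon> where "\<epsilon> = rec_tterm (\<lambda>_. 0) 1 0 (\<lambda>_ _ a b. a + b) (\<lambda>c _ a. c * a) (\<lambda>_ _ a b. a * b) (\<lambda>_ _. 0 :: complex)"
  have "s \<approx>\<^sub>t t \<Longrightarrow> \<epsilon> s = \<epsilon> t" for s t
  proof (induction rule: teq.induct)
    case (Tr_central d s d' t)
    then show ?case by (simp add: \<epsilon>_def)
  next
    case (Tr_cyclic d s d' t)
    then show ?case by (simp add: \<epsilon>_def)
  qed (auto simp: \<epsilon>_def algebra_simps)
  moreover have "\<epsilon> TOne \<noteq> \<epsilon> TZero" by (simp add: \<epsilon>_def)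
  ultimately show ?thesis by blast
qed

instantiation ftr :: ring_1
begin

lift_definition zero_ftr :: ftr is TZero .
lift_definition one_ftr :: ftr is TOne .
lift_definition plus_ftr :: "ftr \<Rightarrow> ftr \<Rightarrow> ftr" is TAdd by (rule teq.cong_Add)
lift_definition uminus_ftr :: "ftr \<Rightarrow> ftr" is "TScal (-1)" by (rule teq.cong_Scal)
lift_definition minus_ftr :: "ftr \<Rightarrow> ftr \<Rightarrow> ftr" is "\<lambda>s t. TAdd s (TScal (-1) t)"
  by (intro teq.cong_Add teq.cong_Scal)
lift_definition times_ftr :: "ftr \<Rightarrow> ftr \<Rightarrow> ftr" is TMul by (rule teq.cong_Mul)

instance
proof
  fix a b c :: ftr
  show "a + b + c = a + (b + c)" by transfer (rule teq.Add_assoc)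
  show "a + b = b + a" by transfer (rule teq.Add_comm)
  show "0 + a = a" by transfer (rule teq.Add_Zero)
  show "- a + a = 0" by transfer (rule teq.Add_neg)
  show "a - b = a + - b" by transfer (rule teq.refl)
  show "a * b * c = a * (b * c)" by transfer (rule teq.Mul_assoc)
  show "1 * a = a" by transfer (rule teq.Mul_One_left)
  show "a * 1 = a" by transfer (rule teq.Mul_One_right)
  show "(a + b) * c = a * c + b * c" by transfer (rule teq.Mul_Add_left)
  show "a * (b + c) = a * b + a * c" by transfer (rule teq.Mul_Add_right)
  show "(0 :: ftr) \<noteq> 1" by transfer (metis teq_One_neq_Zero teq.sym)
qed

end

lift_definition ftr_smult :: "complex \<Rightarrow> ftr \<Rightarrow> ftr" is TScal by (rule teq.cong_Scal)
lift_definition ftr_trc :: "ftr \<Rightarrow> ftr" is TTr by (rule teq.cong_Tr)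

text \<open>The type \<open>ftr\<close> has infinitely many variables of each degree; \<open>FT e f\<close> is the part generated by
  \<open>e\<close> even and \<open>f\<close> odd ones. It is free on these, because evaluating the remaining variables at
  \<open>0\<close> respects the congruence.\<close>

definition FT :: "nat \<Rightarrow> nat \<Rightarrow> ftr trace_superalgebra" where
  "FT e f = \<lparr>carrier = abs_ftr ` {t. tvars t \<subseteq> gvars e f},
     monoid.mult = (*), one = 1, ring.zero = 0, add = (+), smult = ftr_smult,
     part = (\<lambda>d. abs_ftr ` {t. tvars t \<subseteq> gvars e f \<and> homog d t}), trc = ftr_trc\<rparr>"

fun teval :: "('a, 'm) trace_superalgebra_scheme \<Rightarrow> (gvar \<Rightarrow> 'a) \<Rightarrow> tterm \<Rightarrow> 'a" where
  "teval B g (TVar v) = g v"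
| "teval B g TOne = \<one>\<^bsub>B\<^esub>"
| "teval B g TZero = \<zero>\<^bsub>B\<^esub>"
| "teval B g (TAdd s t) = teval B g s \<oplus>\<^bsub>B\<^esub> teval B g t"
| "teval B g (TScal c t) = c \<odot>\<^bsub>B\<^esub> teval B g t"
| "teval B g (TMul s t) = teval B g s \<otimes>\<^bsub>B\<^esub> teval B g t"
| "teval B g (TTr t) = trc B (teval B g t)"

text \<open>The homomorphism out of \<open>FT e f\<close> given by values on the generators. The choice of the
  representative is immaterial, and so are the values on the variables outside \<open>gvars e f\<close> (set to zero).\<close>

definition free_hom ::
  "nat \<Rightarrow> nat \<Rightarrow> ('a, 'm) trace_superalgebra_scheme \<Rightarrow> (gvar \<Rightarrow> 'a) \<Rightarrow> ftr \<Rightarrow> 'a" where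
  "free_hom e f B g x = teval B (\<lambda>v. if v \<in> gvars e f then g v else \<zero>\<^bsub>B\<^esub>) (rep_ftr x)"

text \<open>An index \<open>(i; h, k)\<close>. The same index type serves for the bosonic variables and, ordered
  lexicographically, for the fermionic ones.\<close>

datatype svar = SVar (vidx: nat) (vrow: nat) (vcol: nat)

instantiation svar :: linorder
begin
definition "less_eq_svar v w \<longleftrightarrow> vidx v < vidx w \<or> vidx v = vidx w \<and> (vrow v < vrow w \<or> vrow v = vrow w \<and> vcol v \<le> vcol w)"
definition "less_svar v w \<longleftrightarrow> vidx v < vidx w \<or> vidx v = vidx w \<and> (vrow v < vrow w \<or> vrow v = vrow w \<and> vcol v < vcol w)"
instance by standard (auto simp: less_eq_svar_def less_svar_def svar.expand)
end

text \<open>\<open>spoly\<close> is the exterior algebra over the polynomial ring \<open>bpoly\<close>, on infinitely many variables;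
  \<open>spolys e f n\<close> is the subalgebra \<open>S\<close> of the elements involving only the variables with
  indices in range.\<close>

type_synonym bpoly = "(svar \<Rightarrow>\<^sub>0 nat) \<Rightarrow>\<^sub>0 complex"
type_synonym spoly = "(svar, bpoly) ext"

definition sconst :: "complex \<Rightarrow> spoly" where
  "sconst c = ext_scal (Poly_Mapping.single 0 c)"

definition bos :: "svar \<Rightarrow> spoly" where
  "bos v = ext_scal (Poly_Mapping.single (Poly_Mapping.single v 1) 1)"

definition fer :: "svar \<Rightarrow> spoly" where
  "fer v = ext_gen v"

abbreviation scoeff :: "spoly \<Rightarrow> svar fset \<Rightarrow> bpoly" where
  "scoeff s A \<equiv> Poly_Mapping.lookup (ext_coeffs s) A"

definition spolys :: "nat \<Rightarrow> nat \<Rightarrow> nat \<Rightarrow> spoly set" where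
  "spolys e f n = {s. \<forall>A. \<forall>m. Poly_Mapping.lookup (scoeff s A) m \<noteq> 0 \<longrightarrow>
     (\<forall>v. v |\<in>| A \<longrightarrow> vidx v < f \<and> vrow v < n \<and> vcol v < n) \<and>
     (\<forall>v\<in>Poly_Mapping.keys m. vidx v < e \<and> vrow v < n \<and> vcol v < n)}"

definition S_alg :: "nat \<Rightarrow> nat \<Rightarrow> nat \<Rightarrow> spoly superalgebra" where
  "S_alg e f n = \<lparr>carrier = spolys e f n, monoid.mult = (*), one = 1, ring.zero = 0, add = (+),
     smult = (\<lambda>c s. sconst c * s),
     part = (\<lambda>d. {s \<in> spolys e f n. \<forall>A. scoeff s A \<noteq> 0 \<longrightarrow> of_nat (fcard A) = d})\<rparr>"

definition mtrace :: "'a::comm_monoid_add mat \<Rightarrow> 'a" where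
  "mtrace M = (\<Sum>i<dim_row M. M $$ (i, i))"

definition M_alg :: "nat \<Rightarrow> nat \<Rightarrow> nat \<Rightarrow> spoly mat trace_superalgebra" where
  "M_alg e f n = \<lparr>carrier = {M \<in> carrier_mat n n. \<forall>i<n. \<forall>j<n. M $$ (i, j) \<in> carrier (S_alg e f n)},
     monoid.mult = (*), one = 1\<^sub>m n, ring.zero = 0\<^sub>m n n, add = (+),
     smult = (\<lambda>c M. sconst c \<cdot>\<^sub>m M),
     part = (\<lambda>d. {M \<in> carrier_mat n n. \<forall>i<n. \<forall>j<n. M $$ (i, j) \<in> part (S_alg e f n) d}),
     trc = (\<lambda>M. mtrace M \<cdot>\<^sub>m 1\<^sub>m n)\<rparr>"

fun gen_mat :: "nat \<Rightarrow> gvar \<Rightarrow> spoly mat" where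
  "gen_mat n (Bos i) = mat n n (\<lambda>(h, k). bos (SVar i h k))"
| "gen_mat n (Fer j) = mat n n (\<lambda>(h, k). fer (SVar j h k))"

definition word_mat :: "nat \<Rightarrow> gvar list \<Rightarrow> spoly mat" where
  "word_mat n w = foldr (\<lambda>v M. gen_mat n v * M) w (1\<^sub>m n)"

definition GL :: "nat \<Rightarrow> complex mat monoid" where
  "GL n = units_of (ring_mat TYPE(complex) n ())"

abbreviation cmat :: "complex mat \<Rightarrow> spoly mat" where
  "cmat \<equiv> map_mat sconst"

text \<open>Substitution for the bosonic and fermionic variables. As in the representation of \<open>spoly\<close>, the
  fermionic factors of a monomial are multiplied in increasing order; the order of the bosonic ones
  does not matter for the substitution in \<open>act\<close>, which maps them to even elements.\<close>

definition ssubst :: "(svar \<Rightarrow> spoly) \<Rightarrow> (svar \<Rightarrow> spoly) \<Rightarrow> spoly \<Rightarrow> spoly" where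
  "ssubst \<beta> \<phi> s = (\<Sum>A\<in>Poly_Mapping.keys (ext_coeffs s). \<Sum>m\<in>Poly_Mapping.keys (scoeff s A).
     sconst (Poly_Mapping.lookup (scoeff s A) m) *
     prod_list (map (\<lambda>v. \<beta> v ^ Poly_Mapping.lookup m v) (sorted_list_of_set (Poly_Mapping.keys m))) *
     prod_list (map \<phi> (sorted_list_of_fset A)))"

text \<open>The matrix with entries \<open>g \<cdot> \<eta>\<^sub>h\<^sub>k\<close> is \<open>g\<close>-inverse times \<open>\<eta>\<close> times \<open>g\<close>; see \<open>act_gen_mat\<close>.\<close>

definition act :: "nat \<Rightarrow> complex mat \<Rightarrow> spoly \<Rightarrow> spoly" where
  "act n g = ssubst
     (\<lambda>v. (cmat (inv\<^bsub>GL n\<^esub> g) * gen_mat n (Bos (vidx v)) * cmat g) $$ (vrow v, vcol v))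
     (\<lambda>v. (cmat (inv\<^bsub>GL n\<^esub> g) * gen_mat n (Fer (vidx v)) * cmat g) $$ (vrow v, vcol v))"

text \<open>On \<open>A \<otimes> s\<close> this is conjugation of \<open>A\<close> by \<open>g\<close> together with the action of \<open>g\<close> on \<open>s\<close>.\<close>

definition mat_act :: "nat \<Rightarrow> complex mat \<Rightarrow> spoly mat \<Rightarrow> spoly mat" where
  "mat_act n g M = cmat g * map_mat (act n g) M * cmat (inv\<^bsub>GL n\<^esub> g)"

definition S_inv :: "nat \<Rightarrow> nat \<Rightarrow> nat \<Rightarrow> spoly set" where
  "S_inv e f n = {s \<in> carrier (S_alg e f n). \<forall>g\<in>carrier (GL n). act n g s = s}"

definition M_inv :: "nat \<Rightarrow> nat \<Rightarrow> nat \<Rightarrow> spoly mat set" where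
  "M_inv e f n = {M \<in> carrier (M_alg e f n). \<forall>g\<in>carrier (GL n). mat_act n g M = M}"

definition ev :: "nat \<Rightarrow> nat \<Rightarrow> nat \<Rightarrow> ftr \<Rightarrow> spoly mat" where
  "ev e f n = free_hom e f (M_alg e f n) (gen_mat n)"

lemma koszul_simps [simp]: "koszul 0 d = 1" "koszul d 0 = 1" "koszul 1 1 = -1"
  by (simp_all add: koszul_def)

lemma ftr_smult_add: "ftr_smult c (x + y) = ftr_smult c x + ftr_smult c y"
  by transfer (rule teq.Scal_Add)
lemma ftr_smult_plus: "ftr_smult (c + c') x = ftr_smult c x + ftr_smult c' x"
  by transfer (rule teq.Scal_plus)
lemma ftr_smult_times: "ftr_smult (c * c') x = ftr_smult c (ftr_smult c' x)"
  by transfer (rule teq.Scal_times)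
lemma ftr_smult_one [simp]: "ftr_smult 1 x = x"
  by transfer (rule teq.Scal_one)
lemma ftr_smult_mult_left: "ftr_smult c x * y = ftr_smult c (x * y)"
  by transfer (rule teq.Mul_Scal_left)
lemma ftr_smult_mult_right: "x * ftr_smult c y = ftr_smult c (x * y)"
  by transfer (rule teq.Mul_Scal_right)
lemma ftr_trc_add: "ftr_trc (x + y) = ftr_trc x + ftr_trc y"
  by transfer (rule teq.Tr_Add)
lemma ftr_trc_smult: "ftr_trc (ftr_smult c x) = ftr_smult c (ftr_trc x)"
  by transfer (rule teq.Tr_Scal)

lemma ftr_smult_zero [simp]: "ftr_smult c 0 = 0" "ftr_smult 0 x = 0"
proof -
  show "ftr_smult c 0 = 0" using ftr_smult_add[of c 0 0] by simp
  show "ftr_smult 0 x = 0" using ftr_smult_plus[of 0 0 x] by simp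
qed

lemma ftr_smult_minus_one: "ftr_smult (-1) x = - x"
  by transfer (rule teq.refl)

lemma ftr_smult_minus [simp]: "ftr_smult c (- x) = - ftr_smult c x"
  by (metis ftr_smult_minus_one ftr_smult_times mult.commute)

lemma ftr_trc_zero [simp]: "ftr_trc 0 = 0"
  using ftr_trc_add[of 0 0] by simp

lemma ftr_trc_minus [simp]: "ftr_trc (- x) = - ftr_trc x"
  by (metis ftr_smult_minus_one ftr_trc_smult)

lemma abs_ftr_simps:
  "abs_ftr TOne = 1" "abs_ftr TZero = 0"
  "abs_ftr (TAdd s t) = abs_ftr s + abs_ftr t"
  "abs_ftr (TMul s t) = abs_ftr s * abs_ftr t"
  "abs_ftr (TScal c t) = ftr_smult c (abs_ftr t)"
  "abs_ftr (TTr t) = ftr_trc (abs_ftr t)"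
  by (simp_all add: one_ftr.abs_eq zero_ftr.abs_eq plus_ftr.abs_eq times_ftr.abs_eq
      ftr_smult.abs_eq ftr_trc.abs_eq)

fun tpart :: "bit \<Rightarrow> tterm \<Rightarrow> tterm" where
  "tpart d (TVar v) = (if gdeg v = d then TVar v else TZero)"
| "tpart d TOne = (if d = 0 then TOne else TZero)"
| "tpart d TZero = TZero"
| "tpart d (TAdd s t) = TAdd (tpart d s) (tpart d t)"
| "tpart d (TScal c t) = TScal c (tpart d t)"
| "tpart d (TMul s t) = TAdd (TMul (tpart 0 s) (tpart d t)) (TMul (tpart 1 s) (tpart (d + 1) t))"
| "tpart d (TTr t) = TTr (tpart d t)"

lemma tvars_tpart: "tvars (tpart d t) \<subseteq> tvars t"
  by (induction t arbitrary: d) (fastforce split: if_splits)+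

lemma homog_tpart: "homog d (tpart d t)"
proof (induction t arbitrary: d)
  case (TMul s t)
  have "homog (0 + d) (TMul (tpart 0 s) (tpart d t))"
    by (intro homog.intros TMul)
  moreover have "homog (1 + (d + 1)) (TMul (tpart 1 s) (tpart (d + 1) t))"
    by (intro homog.intros TMul)
  moreover have "1 + (d + 1) = d" by (cases d) auto
  ultimately show ?case by (simp add: homog.intros)
qed (auto intro: homog.intros)

lemma tpart_sum: "abs_ftr t = abs_ftr (tpart 0 t) + abs_ftr (tpart 1 t)"
proof (induction t)
  case (TVar v)
  then show ?case by (cases "gdeg v") (auto simp: abs_ftr_simps)
qed (auto simp: abs_ftr_simps algebra_simps ftr_smult_add ftr_trc_add)

lemma tpart_homog:
  assumes "homog d t"
  shows "abs_ftr (tpart d' t) = (if d' = d then abs_ftr t else 0)"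
  using assms
proof (induction arbitrary: d' rule: homog.induct)
  case (6 d s e t)
  show ?case unfolding tpart.simps abs_ftr_simps "6.IH"
    by (cases d; cases e; cases d') simp_all
qed (auto simp: abs_ftr_simps)

lemma tpart_cong: "s \<approx>\<^sub>t t \<Longrightarrow> abs_ftr (tpart d s) = abs_ftr (tpart d t)"
proof (induction arbitrary: d rule: teq.induct)
  case (Mul_assoc r s t)
  then show ?case by (cases d) (simp_all add: abs_ftr_simps algebra_simps)
next
  case (Mul_One_left t)
  then show ?case by (cases d) (simp_all add: abs_ftr_simps)
next
  case (Mul_One_right t)
  then show ?case by (cases d) (simp_all add: abs_ftr_simps)
next
  case (Tr_central d1 s d2 t)
  have "TMul (TTr s) t \<approx>\<^sub>t TScal (koszul d1 d2) (TMul t (TTr s))"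
    using Tr_central by (rule teq.Tr_central)
  then have "abs_ftr (TMul (TTr s) t) = abs_ftr (TScal (koszul d1 d2) (TMul t (TTr s)))"
    by (simp add: ftr.abs_eq_iff)
  with Tr_central show ?case
    by (cases d1; cases d2; cases d) (simp_all add: abs_ftr_simps tpart_homog)
next
  case (Tr_cyclic d1 s d2 t)
  have "TTr (TMul s t) \<approx>\<^sub>t TScal (koszul d1 d2) (TTr (TMul t s))"
    using Tr_cyclic by (rule teq.Tr_cyclic)
  then have "abs_ftr (TTr (TMul s t)) = abs_ftr (TScal (koszul d1 d2) (TTr (TMul t s)))"
    by (simp add: ftr.abs_eq_iff)
  with Tr_cyclic show ?case
    by (cases d1; cases d2; cases d) (simp_all add: abs_ftr_simps tpart_homog)
next
  case (Tr_Tr d1 s d2 t)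
  have "TTr (TMul (TTr s) t) \<approx>\<^sub>t TMul (TTr s) (TTr t)"
    using Tr_Tr by (rule teq.Tr_Tr)
  then have "abs_ftr (TTr (TMul (TTr s) t)) = abs_ftr (TMul (TTr s) (TTr t))"
    by (simp add: ftr.abs_eq_iff)
  with Tr_Tr show ?case
    by (cases d1; cases d2; cases d) (simp_all add: abs_ftr_simps tpart_homog)
qed (simp_all add: abs_ftr_simps algebra_simps ftr_smult_add ftr_smult_plus ftr_smult_times
  ftr_smult_minus_one ftr_smult_mult_left ftr_smult_mult_right ftr_trc_add ftr_trc_smult)

lemma carrier_FT: "x \<in> carrier (FT e f) \<longleftrightarrow> (\<exists>t. x = abs_ftr t \<and> tvars t \<subseteq> gvars e f)"
  and part_FT: "x \<in> part (FT e f) d \<longleftrightarrow> (\<exists>t. x = abs_ftr t \<and> tvars t \<subseteq> gvars e f \<and> homog d t)"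
  by (auto simp: FT_def)

lemma FT_simps [simp]:
  "monoid.mult (FT e f) = (*)" "one (FT e f) = 1" "ring.zero (FT e f) = 0"
  "add (FT e f) = (+)" "smult (FT e f) = ftr_smult" "trc (FT e f) = ftr_trc"
  by (simp_all add: FT_def)

lemma carrier_FT_closed:
  "1 \<in> carrier (FT e f)" "0 \<in> carrier (FT e f)"
  "x \<in> carrier (FT e f) \<Longrightarrow> y \<in> carrier (FT e f) \<Longrightarrow> x + y \<in> carrier (FT e f)"
  "x \<in> carrier (FT e f) \<Longrightarrow> y \<in> carrier (FT e f) \<Longrightarrow> x * y \<in> carrier (FT e f)"
  "x \<in> carrier (FT e f) \<Longrightarrow> ftr_smult c x \<in> carrier (FT e f)"
  "x \<in> carrier (FT e f) \<Longrightarrow> ftr_trc x \<in> carrier (FT e f)"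
  unfolding carrier_FT
  by (metis abs_ftr_simps tvars.simps empty_subsetI Un_least)+

theorem trace_superalgebra_FT: "trace_superalgebra (FT e f)"
proof -
  have "ring (FT e f)"
  proof (rule ringI)
    show "abelian_group (FT e f)"
    proof (rule abelian_groupI)
      fix x assume x: "x \<in> carrier (FT e f)"
      show "\<exists>y\<in>carrier (FT e f). y \<oplus>\<^bsub>FT e f\<^esub> x = \<zero>\<^bsub>FT e f\<^esub>"
        using carrier_FT_closed(5)[OF x, of "-1"] by (auto simp: ftr_smult_minus_one intro!: bexI[of _ "- x"])
    qed (auto simp: carrier_FT_closed add_ac)
    show "monoid (FT e f)"
      by (rule monoidI) (auto simp: carrier_FT_closed mult.assoc)
  qed (auto simp: algebra_simps)
  then interpret ring "FT e f" .
  have pc: "x \<in> part (FT e f) d \<Longrightarrow> x \<in> carrier (FT e f)" for x d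
    by (auto simp: carrier_FT part_FT)
  show ?thesis
  proof
    fix x y :: ftr and d d' c
    { assume xy: "x \<in> part (FT e f) d" "y \<in> part (FT e f) d"
      then show "x \<oplus>\<^bsub>FT e f\<^esub> y \<in> part (FT e f) d"
        unfolding part_FT FT_simps by (metis abs_ftr_simps(3) homog.intros(4) tvars.simps(4) Un_least) }
    { assume x: "x \<in> part (FT e f) d"
      then show "c \<odot>\<^bsub>FT e f\<^esub> x \<in> part (FT e f) d"
        unfolding part_FT FT_simps by (metis abs_ftr_simps(5) homog.intros(5) tvars.simps(5))
      show "trc (FT e f) x \<in> part (FT e f) d"
        using x unfolding part_FT FT_simps by (metis abs_ftr_simps(6) homog.intros(7) tvars.simps(7)) }
    { assume xy: "x \<in> part (FT e f) d" "y \<in> part (FT e f) d'"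
      then show "x \<otimes>\<^bsub>FT e f\<^esub> y \<in> part (FT e f) (d + d')"
        unfolding part_FT FT_simps by (metis abs_ftr_simps(4) homog.intros(6) tvars.simps(6) Un_least)
      from xy obtain s t where "homog d s" "homog d' t" "x = abs_ftr s" "y = abs_ftr t"
        by (auto simp: part_FT)
      then show "trc (FT e f) x \<otimes>\<^bsub>FT e f\<^esub> y = koszul d d' \<odot>\<^bsub>FT e f\<^esub> (y \<otimes>\<^bsub>FT e f\<^esub> trc (FT e f) x)"
        and "trc (FT e f) (x \<otimes>\<^bsub>FT e f\<^esub> y) = koszul d d' \<odot>\<^bsub>FT e f\<^esub> trc (FT e f) (y \<otimes>\<^bsub>FT e f\<^esub> x)"
        and "trc (FT e f) (trc (FT e f) x \<otimes>\<^bsub>FT e f\<^esub> y) = trc (FT e f) x \<otimes>\<^bsub>FT e f\<^esub> trc (FT e f) y"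
        by (simp_all add: ftr.abs_eq_iff teq.Tr_central teq.Tr_cyclic teq.Tr_Tr flip: abs_ftr_simps) }
    { assume "x \<in> carrier (FT e f)"
      then obtain t where t: "x = abs_ftr t" "tvars t \<subseteq> gvars e f" by (auto simp: carrier_FT)
      have "abs_ftr (tpart d t) \<in> part (FT e f) d" for d
        unfolding part_FT using t tvars_tpart homog_tpart by blast
      then show "\<exists>x0\<in>part (FT e f) 0. \<exists>x1\<in>part (FT e f) 1. x = x0 \<oplus>\<^bsub>FT e f\<^esub> x1"
        using tpart_sum[of t] t by auto }
    show "\<zero>\<^bsub>FT e f\<^esub> \<in> part (FT e f) d" "\<one>\<^bsub>FT e f\<^esub> \<in> part (FT e f) 0"
      unfolding part_FT FT_simps
      by (metis abs_ftr_simps(1,2) homog.intros tvars.simps empty_subsetI)+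
  next
    show "part (FT e f) 0 \<inter> part (FT e f) 1 = {\<zero>\<^bsub>FT e f\<^esub>}"
    proof
      show "part (FT e f) 0 \<inter> part (FT e f) 1 \<subseteq> {\<zero>\<^bsub>FT e f\<^esub>}"
      proof
        fix x assume "x \<in> part (FT e f) 0 \<inter> part (FT e f) 1"
        then obtain s t where st: "homog 0 s" "homog 1 t" "x = abs_ftr s" "x = abs_ftr t"
          by (auto simp: part_FT)
        then have "s \<approx>\<^sub>t t" by (simp flip: ftr.abs_eq_iff)
        from tpart_cong[OF this, of 0] show "x \<in> {\<zero>\<^bsub>FT e f\<^esub>}"
          using st by (simp add: tpart_homog)
      qed
      show "{\<zero>\<^bsub>FT e f\<^esub>} \<subseteq> part (FT e f) 0 \<inter> part (FT e f) 1"
        unfolding part_FT FT_simps Int_iff subset_iff singleton_iff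
        by (metis abs_ftr_simps(2) homog.intros(3) tvars.simps(3) empty_iff)
    qed
  qed (auto simp: carrier_FT_closed pc ftr_smult_add ftr_smult_plus ftr_smult_times
     ftr_smult_mult_left ftr_smult_mult_right ftr_trc_add ftr_trc_smult)
qed

context trace_superalgebra
begin

lemma part_carrier: "x \<in> part A d \<Longrightarrow> x \<in> carrier A"
  using part_subset by blast

lemma trc_closed: "x \<in> carrier A \<Longrightarrow> trc A x \<in> carrier A"
  by (metis part_carrier part_sum trc_add trc_part a_closed)

lemma smult_minus_one: "x \<in> carrier A \<Longrightarrow> (-1) \<odot> x \<oplus> x = \<zero>"
proof -
  assume x: "x \<in> carrier A"
  have "0 \<odot> x \<oplus> 0 \<odot> x = 0 \<odot> x" using smult_l_distr[OF x, of 0 0] by simp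
  then have 0: "0 \<odot> x = \<zero>" using smult_closed[OF x]
    by (simp add: a_comm local.add.l_cancel_one')
  have "(-1) \<odot> x \<oplus> 1 \<odot> x = 0 \<odot> x" using smult_l_distr[OF x, of "-1" 1] by simp
  then show ?thesis using x by (simp add: 0 smult_one)
qed

context
  fixes g assumes g: "\<And>v. g v \<in> part A (gdeg v)"
begin

lemma teval_closed: "teval A g t \<in> carrier A"
  using g by (induction t) (auto intro: part_carrier smult_closed trc_closed)

lemma teval_part: "homog d t \<Longrightarrow> teval A g t \<in> part A d"
proof (induction rule: homog.induct)
  case (6 d s d' t)
  from "6.IH" show ?case unfolding teval.simps by (rule part_mult)
qed (auto intro: g part_zero part_one part_add part_smult trc_part)

lemma teval_cong: "s \<approx>\<^sub>t t \<Longrightarrow> teval A g s = teval A g t"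
proof (induction rule: teq.induct)
  case (Add_comm s t)
  then show ?case by (simp add: a_comm teval_closed)
next
  case (Tr_central d s d' t)
  then show ?case by (simp add: trc_comm teval_part)
next
  case (Tr_cyclic d s d' t)
  then show ?case by (simp add: trc_mult[of _ d _ d'] teval_part)
next
  case (Tr_Tr d s d' t)
  then show ?case by (simp add: trc_trc[of _ d _ d'] teval_part)
qed (simp_all add: teval_closed smult_closed smult_l_distr smult_r_distr smult_assoc smult_one
  smult_minus_one smult_mult_left smult_mult_right trc_add trc_smult a_assoc m_assoc
  l_distr r_distr)

end

end

theorem free_hom_universal:
  assumes B: "trace_superalgebra B"
    and g: "\<And>v. v \<in> gvars e f \<Longrightarrow> g v \<in> part B (gdeg v)"
  shows "free_hom e f B g \<in> trace_superalgebra_hom (FT e f) B"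
    and "\<And>v. v \<in> gvars e f \<Longrightarrow> free_hom e f B g (abs_ftr (TVar v)) = g v"
    and "\<And>\<phi> x. \<lbrakk>\<phi> \<in> trace_superalgebra_hom (FT e f) B;
           \<And>v. v \<in> gvars e f \<Longrightarrow> \<phi> (abs_ftr (TVar v)) = g v; x \<in> carrier (FT e f)\<rbrakk>
           \<Longrightarrow> \<phi> x = free_hom e f B g x"
proof -
  interpret trace_superalgebra B by (rule B)
  define g' where "g' v = (if v \<in> gvars e f then g v else \<zero>\<^bsub>B\<^esub>)" for v
  have g': "g' v \<in> part B (gdeg v)" for v
    by (simp add: g'_def g part_zero)
  have eval: "free_hom e f B g (abs_ftr t) = teval B g' t" for t
  proof -
    have "rep_ftr (abs_ftr t) \<approx>\<^sub>t t"
      by (simp flip: ftr.abs_eq_iff add: Quotient3_abs_rep[OF Quotient3_ftr])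
    then show ?thesis
      unfolding free_hom_def using teval_cong[of g'] g' by (simp flip: g'_def)
  qed
  show "free_hom e f B g \<in> trace_superalgebra_hom (FT e f) B"
    unfolding trace_superalgebra_hom_def
  proof (intro CollectI conjI allI ballI subsetI)
    show "free_hom e f B g \<in> ring_hom (FT e f) B"
      by (rule ring_hom_memI)
        (auto simp: carrier_FT eval teval_closed g' simp flip: abs_ftr_simps)
  qed (auto simp: carrier_FT part_FT eval teval_part g' simp flip: abs_ftr_simps)
  show "\<And>v. v \<in> gvars e f \<Longrightarrow> free_hom e f B g (abs_ftr (TVar v)) = g v"
    by (simp add: eval g'_def)
  fix \<phi> x
  assume \<phi>: "\<phi> \<in> trace_superalgebra_hom (FT e f) B"
    and v: "\<And>v. v \<in> gvars e f \<Longrightarrow> \<phi> (abs_ftr (TVar v)) = g v"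
    and "x \<in> carrier (FT e f)"
  then obtain t where t: "x = abs_ftr t" "tvars t \<subseteq> gvars e f" by (auto simp: carrier_FT)
  have h: "\<phi> \<in> ring_hom (FT e f) B"
     "\<And>c x. x \<in> carrier (FT e f) \<Longrightarrow> \<phi> (ftr_smult c x) = c \<odot>\<^bsub>B\<^esub> \<phi> x"
     "\<And>x. x \<in> carrier (FT e f) \<Longrightarrow> \<phi> (ftr_trc x) = trc B (\<phi> x)"
    using \<phi> by (auto simp: trace_superalgebra_hom_def)
  note h' = ring_hom_add[OF h(1), simplified] ring_hom_mult[OF h(1), simplified]
    ring_hom_one[OF h(1), simplified]
  interpret F: trace_superalgebra "FT e f" by (rule trace_superalgebra_FT)
  have z: "\<phi> 0 = \<zero>\<^bsub>B\<^esub>"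
    using h(1) ring_hom_zero[OF h(1)] F.ring_axioms ring_axioms by simp
  have "\<phi> (abs_ftr t) = teval B g' t" using t(2)
  proof (induction t)
    case (TAdd s t)
    then have "abs_ftr s \<in> carrier (FT e f)" "abs_ftr t \<in> carrier (FT e f)"
      by (auto simp: carrier_FT)
    with TAdd show ?case by (simp add: abs_ftr_simps h')
  next
    case (TMul s t)
    then have "abs_ftr s \<in> carrier (FT e f)" "abs_ftr t \<in> carrier (FT e f)"
      by (auto simp: carrier_FT)
    with TMul show ?case by (simp add: abs_ftr_simps h')
  next
    case (TScal c t)
    then have "abs_ftr t \<in> carrier (FT e f)"
      by (auto simp: carrier_FT)
    with TScal show ?case by (simp add: abs_ftr_simps h)
  next
    case (TTr t)
    then have "abs_ftr t \<in> carrier (FT e f)"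
      by (auto simp: carrier_FT)
    with TTr show ?case by (simp add: abs_ftr_simps h)
  qed (simp_all add: v g'_def abs_ftr_simps h' z)
  then show "\<phi> x = free_hom e f B g x"
    by (simp add: t eval)
qed

lemma scoeff_simps [simp]:
  "scoeff 0 A = 0" "scoeff (s + t) A = scoeff s A + scoeff t A" "scoeff (- s) A = - scoeff s A"
  "scoeff (s - t) A = scoeff s A - scoeff t A"
  by (simp_all add: zero_ext.rep_eq plus_ext.rep_eq uminus_ext.rep_eq minus_ext.rep_eq
      lookup_add lookup_minus)

lemma scoeff_mult: "scoeff (s * t) C = (\<Sum>A\<in>{A. A |\<subseteq>| C}. ext_sign A (C |-| A) * scoeff s A * scoeff t (C |-| A))"
  by (simp add: times_ext.rep_eq ext_mult.rep_eq)

lemma scoeff_one: "scoeff 1 A = (if A = {||} then 1 else 0)"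
  by (simp add: one_ext.rep_eq lookup_single when_def)

lemma scoeff_ext_scal: "scoeff (ext_scal r) A = (if A = {||} then r else 0)"
  by (simp add: ext_scal.rep_eq lookup_single when_def)

lemma scoeff_fer: "scoeff (fer v) A = (if A = {|v|} then 1 else 0)"
  by (simp add: fer_def ext_gen.rep_eq lookup_single when_def)

lemma ext_eqI: "(\<And>A. scoeff s A = scoeff t A) \<Longrightarrow> s = t"
  by (metis ext_coeffs_inject poly_mapping_eqI)

lemma scoeff_scal_left [simp]: "scoeff (ext_scal r * s) C = r * scoeff s C"
proof -
  have "scoeff (ext_scal r * s) C = (\<Sum>A\<in>{A. A |\<subseteq>| C}. if A = {||} then r * scoeff s C else 0)"
    unfolding scoeff_mult by (rule sum.cong) (auto simp: scoeff_ext_scal)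
  then show ?thesis by simp
qed

lemma scoeff_scal_right [simp]: "scoeff (s * ext_scal r) C = r * scoeff s C"
proof -
  have "scoeff (s * ext_scal r) C = (\<Sum>A\<in>{A. A |\<subseteq>| C}. if A = C then r * scoeff s C else 0)"
    unfolding scoeff_mult by (rule sum.cong) (auto simp: scoeff_ext_scal mult_ac)
  then show ?thesis by simp
qed

lemma ext_scal_central: "ext_scal r * s = s * (ext_scal r :: spoly)"
  by (rule ext_eqI) simp

lemma ext_scal_hom:
  "ext_scal 0 = (0 :: spoly)" "ext_scal 1 = (1 :: spoly)"
  "ext_scal (p + q) = ext_scal p + (ext_scal q :: spoly)"
  "ext_scal (p * q) = ext_scal p * (ext_scal q :: spoly)"
  "ext_scal (- p) = - (ext_scal p :: spoly)"
  by (rule ext_eqI; simp add: scoeff_ext_scal scoeff_one)+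

lemma sconst_hom:
  "sconst 0 = 0" "sconst 1 = 1" "sconst (c + c') = sconst c + sconst c'"
  "sconst (c * c') = sconst c * sconst c'" "sconst (- c) = - sconst c"
  by (simp_all add: sconst_def ext_scal_hom single_add single_uminus mult_single
      flip: ext_scal_hom)

lemma sconst_central: "sconst c * s = s * sconst c"
  by (simp add: sconst_def ext_scal_central)

lemma sconst_left_commute: "s * (sconst c * t) = sconst c * (s * t)"
proof -
  have "s * (sconst c * t) = (s * sconst c) * t" by (simp only: mult.assoc)
  also have "s * sconst c = sconst c * s" by (rule sconst_central[symmetric])
  finally show ?thesis by (simp only: mult.assoc)
qed

lemma of_nat_bit_eq_1_iff: "(of_nat k :: bit) = 1 \<longleftrightarrow> odd k"
  by (induction k) auto

lemma ext_sign_swap: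
  assumes "A |\<inter>| B = {||}"
  shows "ext_sign A B = (-1) ^ (fcard A * fcard B) * (ext_sign B A :: 'r::comm_ring_1)"
proof -
  let ?I = "{(a, b). a |\<in>| A \<and> b |\<in>| B \<and> b < a}"
  let ?J = "{(b, a). b |\<in>| B \<and> a |\<in>| A \<and> a < b}"
  have eq: "fset A \<times> fset B = ?I \<union> prod.swap ` ?J"
    using assms by (force simp: image_iff)
  have "card (fset A \<times> fset B) = card ?I + card (prod.swap ` ?J)"
    unfolding eq by (rule card_Un_disjoint) (auto simp: finite_inversions)
  also have "card (prod.swap ` ?J) = card ?J"
    by (rule card_image) (simp add: inj_on_def)
  finally have "fcard A * fcard B = card ?I + card ?J"
    by (simp add: fcard.rep_eq card_cartesian_product)
  then have "((-1) ^ (fcard A * fcard B) :: 'r) * ext_sign B A = (-1) ^ (card ?I + card ?J + card ?J)"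
    by (simp add: ext_sign_def power_add)
  also have "\<dots> = (-1) ^ card ?I * ((-1) * (-1)) ^ card ?J"
    by (simp only: power_add power_mult_distrib mult.assoc)
  finally show ?thesis by (simp add: ext_sign_def)
qed

definition bpolys :: "nat \<Rightarrow> nat \<Rightarrow> bpoly set" where
  "bpolys e n = {p. \<forall>m\<in>Poly_Mapping.keys p. \<forall>v\<in>Poly_Mapping.keys m. vidx v < e \<and> vrow v < n \<and> vcol v < n}"

lemma bpolys_closed:
  "0 \<in> bpolys e n" "1 \<in> bpolys e n" "Poly_Mapping.single 0 c \<in> bpolys e n"
  "p \<in> bpolys e n \<Longrightarrow> q \<in> bpolys e n \<Longrightarrow> p + q \<in> bpolys e n"
  "p \<in> bpolys e n \<Longrightarrow> - p \<in> bpolys e n"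
  "p \<in> bpolys e n \<Longrightarrow> q \<in> bpolys e n \<Longrightarrow> p * q \<in> bpolys e n"
proof -
  show "p \<in> bpolys e n \<Longrightarrow> q \<in> bpolys e n \<Longrightarrow> p + q \<in> bpolys e n"
    using keys_add[of p q] unfolding bpolys_def by blast
  show "p \<in> bpolys e n \<Longrightarrow> - p \<in> bpolys e n"
    by (auto simp: bpolys_def in_keys_iff)
  assume pq: "p \<in> bpolys e n" "q \<in> bpolys e n"
  show "p * q \<in> bpolys e n"
    unfolding bpolys_def
  proof (intro CollectI ballI)
    fix m v assume "m \<in> Poly_Mapping.keys (p * q)" "v \<in> Poly_Mapping.keys m"
    then obtain a b where "a \<in> Poly_Mapping.keys p" "b \<in> Poly_Mapping.keys q" "m = a + b"
      using keys_mult[of p q] by blast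
    then show "vidx v < e \<and> vrow v < n \<and> vcol v < n"
      using pq keys_add[of a b] \<open>v \<in> Poly_Mapping.keys m\<close> unfolding bpolys_def by blast
  qed
qed (auto simp: bpolys_def)

definition fsets :: "nat \<Rightarrow> nat \<Rightarrow> svar fset set" where
  "fsets f n = {A. \<forall>v. v |\<in>| A \<longrightarrow> vidx v < f \<and> vrow v < n \<and> vcol v < n}"

lemma spolys_alt: "s \<in> spolys e f n \<longleftrightarrow>
    (\<forall>A. scoeff s A \<in> bpolys e n \<and> (scoeff s A \<noteq> 0 \<longrightarrow> A \<in> fsets f n))"
proof -
  have "scoeff s A \<noteq> 0 \<longleftrightarrow> (\<exists>m. Poly_Mapping.lookup (scoeff s A) m \<noteq> 0)" for A
    by (metis lookup_zero poly_mapping_eqI)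
  moreover have "(\<forall>A m. c A m \<longrightarrow> P A \<and> Q m) \<longleftrightarrow> (\<forall>A. (\<forall>m. c A m \<longrightarrow> Q m) \<and> ((\<exists>m. c A m) \<longrightarrow> P A))"
    for c :: "svar fset \<Rightarrow> (svar \<Rightarrow>\<^sub>0 nat) \<Rightarrow> bool" and P Q
    by blast
  ultimately show ?thesis
    unfolding spolys_def bpolys_def fsets_def mem_Collect_eq Ball_def[of "Poly_Mapping.keys (scoeff s _)"]
      in_keys_iff[of _ "scoeff s _"] by presburger
qed

lemma sum_bpolys: "(\<And>x. x \<in> I \<Longrightarrow> h x \<in> bpolys e n) \<Longrightarrow> sum h I \<in> bpolys e n"
  by (induction I rule: infinite_finite_induct) (auto intro: bpolys_closed(1,4))

lemma ext_sign_cases: "ext_sign A B = (1 :: 'r::comm_ring_1) \<or> ext_sign A B = (-1 :: 'r)"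
  by (simp add: ext_sign_def minus_one_power_iff)

lemma ext_sign_bpolys: "ext_sign A B \<in> bpolys e n"
proof -
  have "ext_sign A B = (1 :: bpoly) \<or> ext_sign A B = (-1 :: bpoly)"
    by (rule ext_sign_cases)
  then show ?thesis
    by (elim disjE ssubst) (intro bpolys_closed)+
qed

lemma spolys_closed:
  "0 \<in> spolys e f n" "1 \<in> spolys e f n"
  "s \<in> spolys e f n \<Longrightarrow> t \<in> spolys e f n \<Longrightarrow> s + t \<in> spolys e f n"
  "s \<in> spolys e f n \<Longrightarrow> - s \<in> spolys e f n"
  "s \<in> spolys e f n \<Longrightarrow> t \<in> spolys e f n \<Longrightarrow> s * t \<in> spolys e f n"
  "s \<in> spolys e f n \<Longrightarrow> sconst c * s \<in> spolys e f n"
proof -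
  show "s \<in> spolys e f n \<Longrightarrow> t \<in> spolys e f n \<Longrightarrow> s + t \<in> spolys e f n"
    unfolding spolys_alt by (metis scoeff_simps(2) bpolys_closed(4) add_0)
  show "s \<in> spolys e f n \<Longrightarrow> t \<in> spolys e f n \<Longrightarrow> s * t \<in> spolys e f n"
    unfolding spolys_alt
  proof (intro allI conjI impI)
    assume st: "\<forall>A. scoeff s A \<in> bpolys e n \<and> (scoeff s A \<noteq> 0 \<longrightarrow> A \<in> fsets f n)"
       "\<forall>A. scoeff t A \<in> bpolys e n \<and> (scoeff t A \<noteq> 0 \<longrightarrow> A \<in> fsets f n)"
    fix C
    show "scoeff (s * t) C \<in> bpolys e n"
      unfolding scoeff_mult using st by (intro sum_bpolys bpolys_closed ext_sign_bpolys) auto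
    assume "scoeff (s * t) C \<noteq> 0"
    then obtain A where A: "A |\<subseteq>| C" "scoeff s A \<noteq> 0" "scoeff t (C |-| A) \<noteq> 0"
      unfolding scoeff_mult by (auto elim: sum.not_neutral_contains_not_neutral)
    then have "A \<in> fsets f n" "C |-| A \<in> fsets f n" using st by auto
    then show "C \<in> fsets f n" unfolding fsets_def by auto
  qed
qed (auto simp: spolys_alt bpolys_closed scoeff_one fsets_def sconst_def)

lemma S_alg_simps [simp]:
  "carrier (S_alg e f n) = spolys e f n"
  "monoid.mult (S_alg e f n) = (*)" "one (S_alg e f n) = 1" "ring.zero (S_alg e f n) = 0"
  "add (S_alg e f n) = (+)" "smult (S_alg e f n) = (\<lambda>c s. sconst c * s)"
  by (simp_all add: S_alg_def)

lemma part_S_alg: "s \<in> part (S_alg e f n) d \<longleftrightarrow>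
    s \<in> spolys e f n \<and> (\<forall>A. scoeff s A \<noteq> 0 \<longrightarrow> of_nat (fcard A) = d)"
  by (simp add: S_alg_def)

lemma part_S_alg_mult:
  assumes "s \<in> part (S_alg e f n) d" "t \<in> part (S_alg e f n) d'"
  shows "s * t \<in> part (S_alg e f n) (d + d')"
  unfolding part_S_alg
proof (intro conjI allI impI)
  show "s * t \<in> spolys e f n" using assms by (simp add: part_S_alg spolys_closed)
  fix C assume "scoeff (s * t) C \<noteq> 0"
  then obtain A where A: "A |\<subseteq>| C" "scoeff s A \<noteq> 0" "scoeff t (C |-| A) \<noteq> 0"
    unfolding scoeff_mult by (auto elim: sum.not_neutral_contains_not_neutral)
  have "fcard A + fcard (C |-| A) = fcard C"
    using A(1) by (simp add: fcard.rep_eq minus_fset.rep_eq card_Diff_subset card_mono less_eq_fset.rep_eq)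
  then have "(of_nat (fcard C) :: bit) = of_nat (fcard A) + of_nat (fcard (C |-| A))"
    by (metis of_nat_add)
  also have "\<dots> = d + d'" using assms A unfolding part_S_alg by metis
  finally show "of_nat (fcard C) = d + d'" .
qed

theorem S_alg_supercomm:
  assumes "s \<in> part (S_alg e f n) d" "t \<in> part (S_alg e f n) d'"
  shows "s * t = sconst (koszul d d') * (t * s)"
proof (rule ext_eqI)
  fix C
  have "scoeff (sconst (koszul d d') * (t * s)) C =
    (\<Sum>B\<in>{B. B |\<subseteq>| C}. Poly_Mapping.single 0 (koszul d d') * (ext_sign B (C |-| B) * scoeff t B * scoeff s (C |-| B)))"
    by (simp add: sconst_def scoeff_mult[of t s] sum_distrib_left)
  also have "\<dots> = (\<Sum>A\<in>{A. A |\<subseteq>| C}. ext_sign A (C |-| A) * scoeff s A * scoeff t (C |-| A))"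
  proof (rule sum.reindex_bij_witness[of _ "\<lambda>A. C |-| A" "\<lambda>A. C |-| A"])
    fix B assume B: "B \<in> {B. B |\<subseteq>| C}"
    define A where "A = C |-| B"
    have CA: "C |-| A = B" using B by (auto simp: A_def)
    have AB: "A |\<inter>| B = {||}" by (auto simp: A_def)
    have "scoeff s A \<noteq> 0 \<Longrightarrow> scoeff t B \<noteq> 0 \<Longrightarrow>
      (-1) ^ (fcard A * fcard B) = (Poly_Mapping.single 0 (koszul d d') :: bpoly)"
    proof -
      assume "scoeff s A \<noteq> 0" "scoeff t B \<noteq> 0"
      then have "of_nat (fcard A) = d" "of_nat (fcard B) = d'" using assms by (auto simp: part_S_alg)
      then have "d = 1 \<longleftrightarrow> odd (fcard A)" "d' = 1 \<longleftrightarrow> odd (fcard B)"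
        by (auto simp: of_nat_bit_eq_1_iff)
      then show ?thesis by (auto simp: koszul_def single_uminus)
    qed
    then show "ext_sign (C |-| B) (C |-| (C |-| B)) * scoeff s (C |-| B) * scoeff t (C |-| (C |-| B)) =
      Poly_Mapping.single 0 (koszul d d') * (ext_sign B (C |-| B) * scoeff t B * scoeff s (C |-| B))"
      unfolding A_def[symmetric] CA ext_sign_swap[OF AB]
      by (cases "scoeff s A = 0"; cases "scoeff t B = 0") (simp_all add: mult_ac)
  qed auto
  also have "\<dots> = scoeff (s * t) C" by (simp add: scoeff_mult)
  finally show "scoeff (s * t) C = scoeff (sconst (koszul d d') * (t * s)) C" ..
qed

lemma part_S_alg_closed:
  "0 \<in> part (S_alg e f n) d" "1 \<in> part (S_alg e f n) 0"
  "s \<in> part (S_alg e f n) d \<Longrightarrow> t \<in> part (S_alg e f n) d \<Longrightarrow> s + t \<in> part (S_alg e f n) d"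
  "s \<in> part (S_alg e f n) d \<Longrightarrow> sconst c * s \<in> part (S_alg e f n) d"
proof -
  show "s \<in> part (S_alg e f n) d \<Longrightarrow> t \<in> part (S_alg e f n) d \<Longrightarrow> s + t \<in> part (S_alg e f n) d"
    unfolding part_S_alg by (metis spolys_closed(3) scoeff_simps(2) add_0)
  show "s \<in> part (S_alg e f n) d \<Longrightarrow> sconst c * s \<in> part (S_alg e f n) d"
    unfolding part_S_alg by (metis spolys_closed(6) scoeff_scal_left sconst_def mult_zero_right)
qed (auto simp: part_S_alg spolys_closed scoeff_one fcard_fempty)

definition ext_part :: "bit \<Rightarrow> spoly \<Rightarrow> spoly" where
  "ext_part d s = Ext (Poly_Mapping.mapp (\<lambda>A p. p when of_nat (fcard A) = d) (ext_coeffs s))"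

lemma scoeff_ext_part: "scoeff (ext_part d s) A = (scoeff s A when of_nat (fcard A) = d)"
  by (simp add: ext_part_def Ext_inverse lookup_mapp when_def in_keys_iff)

lemma ext_part_part: "s \<in> spolys e f n \<Longrightarrow> ext_part d s \<in> part (S_alg e f n) d"
  by (auto simp: part_S_alg spolys_alt scoeff_ext_part when_def bpolys_closed)

lemma ext_part_sum: "s = ext_part 0 s + ext_part 1 s"
  by (rule ext_eqI) (auto simp: scoeff_ext_part when_def)

lemma part_S_alg_Int: "s \<in> part (S_alg e f n) 0 \<Longrightarrow> s \<in> part (S_alg e f n) 1 \<Longrightarrow> s = 0"
  by (rule ext_eqI) (auto simp: part_S_alg)

theorem superalgebra_S_alg: "superalgebra (S_alg e f n)"
proof -
  have "ring (S_alg e f n)"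
  proof (rule ringI)
    show "abelian_group (S_alg e f n)"
    proof (rule abelian_groupI)
      fix x assume x: "x \<in> carrier (S_alg e f n)"
      show "\<exists>y\<in>carrier (S_alg e f n). y \<oplus>\<^bsub>S_alg e f n\<^esub> x = \<zero>\<^bsub>S_alg e f n\<^esub>"
        using x by (auto intro!: bexI[of _ "- x"] spolys_closed)
    qed (auto simp: spolys_closed add_ac)
    show "monoid (S_alg e f n)"
      by (rule monoidI) (auto simp: spolys_closed mult.assoc)
  qed (auto simp: algebra_simps)
  then interpret ring "S_alg e f n" .
  show ?thesis
  proof
    fix s t d d' c
    { assume s: "s \<in> carrier (S_alg e f n)"
      then show "\<exists>s0\<in>part (S_alg e f n) 0. \<exists>s1\<in>part (S_alg e f n) 1. s = s0 \<oplus>\<^bsub>S_alg e f n\<^esub> s1"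
        using ext_part_part ext_part_sum[of s] by fastforce
      show "s \<otimes>\<^bsub>S_alg e f n\<^esub> (c \<odot>\<^bsub>S_alg e f n\<^esub> t) = c \<odot>\<^bsub>S_alg e f n\<^esub> (s \<otimes>\<^bsub>S_alg e f n\<^esub> t)"
        by (simp add: sconst_left_commute) }
    show "s \<in> part (S_alg e f n) d \<Longrightarrow> t \<in> part (S_alg e f n) d'
       \<Longrightarrow> s \<otimes>\<^bsub>S_alg e f n\<^esub> t \<in> part (S_alg e f n) (d + d')"
      using part_S_alg_mult by simp
    show "part (S_alg e f n) d \<subseteq> carrier (S_alg e f n)"
      by (auto simp: part_S_alg)
  qed (auto simp: spolys_closed part_S_alg_closed part_S_alg_Int sconst_hom algebra_simps)
qed

lemma mat_mult_entry:
  "A \<in> carrier_mat n n \<Longrightarrow> B \<in> carrier_mat n n \<Longrightarrow> i < n \<Longrightarrow> j < n \<Longrightarrow>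
    (A * B) $$ (i, j) = (\<Sum>k<n. A $$ (i, k) * B $$ (k, j))"
  by (simp add: scalar_prod_def atLeast0LessThan)

lemma mtrace_carrier: "M \<in> carrier_mat n n \<Longrightarrow> mtrace M = (\<Sum>i<n. M $$ (i, i))"
  by (simp add: mtrace_def)

lemma M_alg_simps [simp]:
  "monoid.mult (M_alg e f n) = (*)" "one (M_alg e f n) = 1\<^sub>m n" "ring.zero (M_alg e f n) = 0\<^sub>m n n"
  "add (M_alg e f n) = (+)" "smult (M_alg e f n) = (\<lambda>c M. sconst c \<cdot>\<^sub>m M)"
  "trc (M_alg e f n) = (\<lambda>M. mtrace M \<cdot>\<^sub>m 1\<^sub>m n)"
  by (simp_all add: M_alg_def)

lemma carrier_M_alg: "M \<in> carrier (M_alg e f n) \<longleftrightarrow>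
     M \<in> carrier_mat n n \<and> (\<forall>i<n. \<forall>j<n. M $$ (i, j) \<in> spolys e f n)"
  and part_M_alg: "M \<in> part (M_alg e f n) d \<longleftrightarrow>
     M \<in> carrier_mat n n \<and> (\<forall>i<n. \<forall>j<n. M $$ (i, j) \<in> part (S_alg e f n) d)"
  by (simp_all add: M_alg_def)

lemma part_S_alg_sum: "(\<And>x. x \<in> I \<Longrightarrow> h x \<in> part (S_alg e f n) d) \<Longrightarrow> sum h I \<in> part (S_alg e f n) d"
  by (induction I rule: infinite_finite_induct) (auto intro: part_S_alg_closed(1,3))

lemma spolys_sum: "(\<And>x. x \<in> I \<Longrightarrow> h x \<in> spolys e f n) \<Longrightarrow> sum h I \<in> spolys e f n"
  by (induction I rule: infinite_finite_induct) (auto intro: spolys_closed(1,3))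

lemma part_M_alg_mult:
  assumes "A \<in> part (M_alg e f n) d" "B \<in> part (M_alg e f n) d'"
  shows "A * B \<in> part (M_alg e f n) (d + d')"
proof -
  have "A * B \<in> carrier_mat n n" using assms by (auto simp: part_M_alg)
  moreover have "(A * B) $$ (i, j) \<in> part (S_alg e f n) (d + d')" if "i < n" "j < n" for i j
    using assms that unfolding part_M_alg
    by (subst mat_mult_entry[of _ n], simp, simp, simp, simp)
      (rule part_S_alg_sum, rule part_S_alg_mult, simp_all)
  ultimately show ?thesis by (simp only: part_M_alg) blast
qed

lemma mtrace_part: "A \<in> part (M_alg e f n) d \<Longrightarrow> mtrace A \<in> part (S_alg e f n) d"
  by (auto simp: part_M_alg mtrace_carrier intro!: part_S_alg_sum)

lemma scalar_mat_mult:
  assumes "M \<in> carrier_mat n n"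
  shows "(s \<cdot>\<^sub>m 1\<^sub>m n) * M = s \<cdot>\<^sub>m (M :: spoly mat)"
    and "M * (s \<cdot>\<^sub>m 1\<^sub>m n) = map_mat (\<lambda>x. x * s) (M :: spoly mat)"
proof -
  show "(s \<cdot>\<^sub>m 1\<^sub>m n) * M = s \<cdot>\<^sub>m M"
  proof (rule eq_matI)
    fix i j assume "i < dim_row (s \<cdot>\<^sub>m M)" "j < dim_col (s \<cdot>\<^sub>m M)"
    then have ij: "i < n" "j < n" using assms by auto
    have "((s \<cdot>\<^sub>m 1\<^sub>m n) * M) $$ (i, j) = (\<Sum>k<n. if k = i then s * M $$ (i, j) else 0)"
      using assms ij by (subst mat_mult_entry[of _ n], simp, simp, simp, simp)
        (rule sum.cong, simp_all)
    then show "((s \<cdot>\<^sub>m 1\<^sub>m n) * M) $$ (i, j) = (s \<cdot>\<^sub>m M) $$ (i, j)"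
      using assms ij by simp
  qed (use assms in auto)
  show "M * (s \<cdot>\<^sub>m 1\<^sub>m n) = map_mat (\<lambda>x. x * s) M"
  proof (rule eq_matI)
    fix i j assume "i < dim_row (map_mat (\<lambda>x. x * s) M)" "j < dim_col (map_mat (\<lambda>x. x * s) M)"
    then have ij: "i < n" "j < n" using assms by auto
    have "(M * (s \<cdot>\<^sub>m 1\<^sub>m n)) $$ (i, j) = (\<Sum>k<n. if k = j then M $$ (i, j) * s else 0)"
      using assms ij by (subst mat_mult_entry[of _ n], simp, simp, simp, simp)
        (rule sum.cong, simp_all)
    then show "(M * (s \<cdot>\<^sub>m 1\<^sub>m n)) $$ (i, j) = map_mat (\<lambda>x. x * s) M $$ (i, j)"
      using assms ij by simp
  qed (use assms in auto)
qed

lemma mtrace_scalar: "A \<in> carrier_mat n n \<Longrightarrow> mtrace (s \<cdot>\<^sub>m A) = s * mtrace (A :: spoly mat)"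
  by (simp add: mtrace_def sum_distrib_left)

lemma mtrace_cyclic:
  assumes "A \<in> part (M_alg e f n) d" "B \<in> part (M_alg e f n) d'"
  shows "mtrace (A * B) = sconst (koszul d d') * mtrace (B * A)"
proof -
  have c: "A \<in> carrier_mat n n" "B \<in> carrier_mat n n" using assms by (auto simp: part_M_alg)
  have "mtrace (A * B) = (\<Sum>i<n. \<Sum>k<n. A $$ (i, k) * B $$ (k, i))"
    using c by (simp add: mtrace_carrier[of _ n] mat_mult_entry del: index_mult_mat)
  also have "\<dots> = (\<Sum>i<n. \<Sum>k<n. sconst (koszul d d') * (B $$ (k, i) * A $$ (i, k)))"
    using assms by (intro sum.cong refl S_alg_supercomm) (auto simp: part_M_alg)
  also have "\<dots> = sconst (koszul d d') * (\<Sum>k<n. \<Sum>i<n. B $$ (k, i) * A $$ (i, k))"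
    by (subst sum.swap) (simp add: sum_distrib_left)
  also have "(\<Sum>k<n. \<Sum>i<n. B $$ (k, i) * A $$ (i, k)) = mtrace (B * A)"
    using c by (simp add: mtrace_carrier[of _ n] mat_mult_entry del: index_mult_mat)
  finally show ?thesis .
qed

theorem trace_superalgebra_M_alg: "trace_superalgebra (M_alg e f n)"
proof -
  have cl: "A * B \<in> carrier (M_alg e f n)"
    if "A \<in> carrier (M_alg e f n)" "B \<in> carrier (M_alg e f n)" for A B
  proof -
    have "A * B \<in> carrier_mat n n" using that by (auto simp: carrier_M_alg)
    moreover have "(A * B) $$ (i, j) \<in> spolys e f n" if "i < n" "j < n" for i j
      using \<open>A \<in> _\<close> \<open>B \<in> _\<close> that
      unfolding carrier_M_alg
      by (subst mat_mult_entry[of _ n], simp, simp, simp, simp)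
        (rule spolys_sum, rule spolys_closed, simp_all)
    ultimately show ?thesis by (simp only: carrier_M_alg) blast
  qed
  have "ring (M_alg e f n)"
  proof (rule ringI)
    show "abelian_group (M_alg e f n)"
    proof (rule abelian_groupI)
      fix x assume x: "x \<in> carrier (M_alg e f n)"
      show "\<exists>y\<in>carrier (M_alg e f n). y \<oplus>\<^bsub>M_alg e f n\<^esub> x = \<zero>\<^bsub>M_alg e f n\<^esub>"
        using x by (auto intro!: bexI[of _ "- x"] spolys_closed simp: carrier_M_alg)
    qed (auto simp: spolys_closed carrier_M_alg intro: comm_add_mat)
    show "monoid (M_alg e f n)"
      by (rule monoidI) (use cl in \<open>auto simp: spolys_closed carrier_M_alg\<close>)
  qed (auto simp: carrier_M_alg add_mult_distrib_mat mult_add_distrib_mat)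
  then interpret ring "M_alg e f n" .
  show ?thesis
  proof
    fix A B d d' c c'
    { assume A: "A \<in> carrier (M_alg e f n)"
      then show "(c + c') \<odot>\<^bsub>M_alg e f n\<^esub> A = c \<odot>\<^bsub>M_alg e f n\<^esub> A \<oplus>\<^bsub>M_alg e f n\<^esub> c' \<odot>\<^bsub>M_alg e f n\<^esub> A"
        "(c * c') \<odot>\<^bsub>M_alg e f n\<^esub> A = c \<odot>\<^bsub>M_alg e f n\<^esub> (c' \<odot>\<^bsub>M_alg e f n\<^esub> A)"
        "1 \<odot>\<^bsub>M_alg e f n\<^esub> A = A"
        by (auto simp: carrier_M_alg sconst_hom distrib_right mult.assoc intro!: eq_matI)
      show "\<exists>A0\<in>part (M_alg e f n) 0. \<exists>A1\<in>part (M_alg e f n) 1. A = A0 \<oplus>\<^bsub>M_alg e f n\<^esub> A1"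
        using A by (intro bexI[of _ "map_mat (ext_part 0) A"] bexI[of _ "map_mat (ext_part 1) A"])
          (auto simp: carrier_M_alg part_M_alg ext_part_part intro!: eq_matI ext_part_sum)
      show "trc (M_alg e f n) (c \<odot>\<^bsub>M_alg e f n\<^esub> A) = c \<odot>\<^bsub>M_alg e f n\<^esub> trc (M_alg e f n) A"
        using A by (auto simp: carrier_M_alg mtrace_scalar mult.assoc intro!: eq_matI)
      assume B: "B \<in> carrier (M_alg e f n)"
      show "c \<odot>\<^bsub>M_alg e f n\<^esub> (A \<oplus>\<^bsub>M_alg e f n\<^esub> B) = c \<odot>\<^bsub>M_alg e f n\<^esub> A \<oplus>\<^bsub>M_alg e f n\<^esub> c \<odot>\<^bsub>M_alg e f n\<^esub> B"
        using A B by (auto simp: carrier_M_alg algebra_simps intro!: eq_matI)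
      show "(c \<odot>\<^bsub>M_alg e f n\<^esub> A) \<otimes>\<^bsub>M_alg e f n\<^esub> B = c \<odot>\<^bsub>M_alg e f n\<^esub> (A \<otimes>\<^bsub>M_alg e f n\<^esub> B)"
        using A B by (auto simp: carrier_M_alg scalar_prod_def sum_distrib_left mult.assoc intro!: eq_matI)
      show "A \<otimes>\<^bsub>M_alg e f n\<^esub> (c \<odot>\<^bsub>M_alg e f n\<^esub> B) = c \<odot>\<^bsub>M_alg e f n\<^esub> (A \<otimes>\<^bsub>M_alg e f n\<^esub> B)"
        using A B by (auto simp: carrier_M_alg scalar_prod_def sum_distrib_left sconst_left_commute intro!: eq_matI)
      show "trc (M_alg e f n) (A \<oplus>\<^bsub>M_alg e f n\<^esub> B) = trc (M_alg e f n) A \<oplus>\<^bsub>M_alg e f n\<^esub> trc (M_alg e f n) B"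
        using A B by (auto simp: carrier_M_alg mtrace_carrier[of _ n] sum.distrib algebra_simps intro!: eq_matI)
    }
    { assume A: "A \<in> part (M_alg e f n) d" and B: "B \<in> part (M_alg e f n) d'"
      have t: "mtrace A \<in> part (S_alg e f n) d" using A by (rule mtrace_part)
      show "A \<otimes>\<^bsub>M_alg e f n\<^esub> B \<in> part (M_alg e f n) (d + d')"
        using part_M_alg_mult[OF A B] by simp
      have c: "A \<in> carrier_mat n n" "B \<in> carrier_mat n n" using A B by (auto simp: part_M_alg)
      have "mtrace A * B $$ (i, j) = sconst (koszul d d') * (B $$ (i, j) * mtrace A)"
        if "i < n" "j < n" for i j
        using t B that by (intro S_alg_supercomm) (auto simp: part_M_alg)
      then show "trc (M_alg e f n) A \<otimes>\<^bsub>M_alg e f n\<^esub> B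
          = koszul d d' \<odot>\<^bsub>M_alg e f n\<^esub> (B \<otimes>\<^bsub>M_alg e f n\<^esub> trc (M_alg e f n) A)"
        using c by (auto simp: scalar_mat_mult intro!: eq_matI)
      show "trc (M_alg e f n) (A \<otimes>\<^bsub>M_alg e f n\<^esub> B)
          = koszul d d' \<odot>\<^bsub>M_alg e f n\<^esub> trc (M_alg e f n) (B \<otimes>\<^bsub>M_alg e f n\<^esub> A)"
        using mtrace_cyclic[OF A B] by (auto simp: mult.assoc intro!: eq_matI)
      show "trc (M_alg e f n) (trc (M_alg e f n) A \<otimes>\<^bsub>M_alg e f n\<^esub> B)
          = trc (M_alg e f n) A \<otimes>\<^bsub>M_alg e f n\<^esub> trc (M_alg e f n) B"
        using c by (auto simp: scalar_mat_mult mtrace_scalar intro!: eq_matI)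
    }
    show "part (M_alg e f n) d \<subseteq> carrier (M_alg e f n)"
      by (auto simp: part_M_alg carrier_M_alg part_S_alg)
    show "A \<in> part (M_alg e f n) d \<Longrightarrow> trc (M_alg e f n) A \<in> part (M_alg e f n) d"
      using mtrace_part[of A e f n d] by (auto simp: part_M_alg part_S_alg_closed)
  next
    show "part (M_alg e f n) 0 \<inter> part (M_alg e f n) 1 = {\<zero>\<^bsub>M_alg e f n\<^esub>}"
      by (auto simp: part_M_alg part_S_alg_closed intro!: eq_matI) (rule part_S_alg_Int[of _ e f n]; simp)
  qed (auto simp: carrier_M_alg part_M_alg spolys_closed part_S_alg_closed)
qed

lemma gen_mat_part:
  assumes "v \<in> gvars e f"
  shows "gen_mat n v \<in> part (M_alg e f n) (gdeg v)"
proof (cases v)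
  case (Bos i)
  then have "bos (SVar i h k) \<in> part (S_alg e f n) 0" if "h < n" "k < n" for h k
    using assms that
    by (auto simp: gvars_def part_S_alg spolys_alt bos_def scoeff_ext_scal fsets_def bpolys_def fcard_fempty)
  then show ?thesis by (simp add: Bos part_M_alg)
next
  case (Fer j)
  then have "fer (SVar j h k) \<in> part (S_alg e f n) 1" if "h < n" "k < n" for h k
    using assms that
    by (auto simp: gvars_def part_S_alg spolys_alt scoeff_fer fsets_def bpolys_closed fcard.rep_eq)
  then show ?thesis by (simp add: Fer part_M_alg)
qed

theorem ev_hom:
  "ev e f n \<in> trace_superalgebra_hom (FT e f) (M_alg e f n)"
  "v \<in> gvars e f \<Longrightarrow> ev e f n (abs_ftr (TVar v)) = gen_mat n v"
  unfolding ev_def using free_hom_universal[OF trace_superalgebra_M_alg gen_mat_part] by auto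

lemma group_GL: "group (GL n)"
proof -
  interpret ring "ring_mat TYPE(complex) n ()" by (rule ring_mat)
  show ?thesis unfolding GL_def by (rule units_group)
qed

lemma GL_carrier_mat: "g \<in> carrier (GL n) \<Longrightarrow> g \<in> carrier_mat n n"
  by (simp add: GL_def units_of_def Units_def ring_mat_def)

lemma ssubst_gen: "ssubst \<beta> \<phi> (bos v) = \<beta> v" "ssubst \<beta> \<phi> (fer v) = \<phi> v"
proof -
  have single_ne: "Poly_Mapping.single m (1 :: complex) \<noteq> 0" for m :: "svar \<Rightarrow>\<^sub>0 nat"
    by (metis lookup_single_eq lookup_zero zero_neq_one)
  have "ext_coeffs (bos v) = Poly_Mapping.single {||} (Poly_Mapping.single (Poly_Mapping.single v 1) 1)"
    by (simp add: bos_def ext_scal.rep_eq)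
  then show "ssubst \<beta> \<phi> (bos v) = \<beta> v"
    using single_ne by (simp add: ssubst_def sconst_hom sorted_list_of_fset.rep_eq)
  have "ext_coeffs (fer v) = Poly_Mapping.single {|v|} 1"
    by (simp add: fer_def ext_gen.rep_eq)
  then show "ssubst \<beta> \<phi> (fer v) = \<phi> v"
    by (simp add: ssubst_def sconst_hom sorted_list_of_fset.rep_eq)
qed

lemma act_gen_mat:
  assumes "g \<in> carrier (GL n)"
  shows "map_mat (act n g) (gen_mat n v) = cmat (inv\<^bsub>GL n\<^esub> g) * gen_mat n v * cmat g"
proof -
  have "g \<in> carrier_mat n n" "inv\<^bsub>GL n\<^esub> g \<in> carrier_mat n n"
    using assms group_GL GL_carrier_mat by (blast intro: group.inv_closed)+
  then show ?thesis
    by (cases v) (auto simp: act_def ssubst_gen simp del: index_mult_mat(1) intro!: eq_matI)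
qed

end

theory Submission
  imports Defs "HOL-Combinatorics.Permutations" "Jordan_Normal_Form.Char_Poly"
begin

text \<open>The proof lifts an invariant to a tensor, makes the tensor itself invariant, and then determines all
invariant tensors.

Every matrix over \<open>S\<close> is a contraction: for finitely many words \<open>w\<close> in the generic matrices and complex
coefficients \<open>c w p q\<close>, its entry \<open>(i, j)\<close> is the sum of the terms
\<open>c w p q \<cdot> x\<^sub>1(p 1, q 1) \<dots> x\<^sub>d(p d, q d)\<close> with \<open>q 0 = i\<close> and \<open>p 0 = j\<close>, where \<open>x\<^sub>t\<close> is the generic matrix
at the letter number \<open>t\<close> of \<open>w\<close>. For each word, \<open>c w\<close> is an operator on the \<open>(d + 1)\<close>-fold tensor power
of \<open>\<complex>\<^sup>n\<close>; the extra position \<open>0\<close> carries the two matrix indices. The coefficients are far from unique,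
because the variables commute or anticommute: let \<open>N\<close> be the space of coefficient families with
contraction \<open>0\<close>. Multiplying \<open>c\<close> on one side by the tensor power of the transpose of \<open>g\<close> amounts, on
contractions, to applying the algebra endomorphism of \<open>S\<close> that multiplies all generic matrices by \<open>g\<close> on one
side, followed by a multiplication by \<open>g\<close> (\<open>contract_left_mult\<close>, \<open>contract_right_mult\<close>). Hence \<open>N\<close> is stable under both multiplications, by all matrices
\<open>g\<close>, and so is its orthogonal complement. If the contraction of \<open>r\<close> is equivariant, then
\<open>g\<^sup>\<otimes> r - r g\<^sup>\<otimes>\<close> lies in \<open>N\<close> (\<open>invariant_contraction_relation\<close>); if in addition \<open>r\<close> is orthogonal to \<open>N\<close>, the
difference is orthogonal to \<open>N\<close> as well, so it vanishes. Passing to the orthogonal complement replaces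
an appeal to complete reducibility and avoids all sign bookkeeping for the fermionic variables.

An operator \<open>r\<close> that commutes with all tensor powers \<open>g\<^sup>\<otimes>\<close> and is orthogonal to all place
permutations is \<open>0\<close> (\<open>commutant_orthogonal_permutations\<close>); this is the part of Schur-Weyl duality that is needed.
By polarization \<open>r\<close> commutes with every sum \<open>\<Sum>\<^sub>\<pi> \<pi> X \<pi>\<^sup>-\<^sup>1\<close>. Read as an identity of linear maps in \<open>X\<close>, this says
\<open>\<Sum>\<^sub>\<pi> r\<pi> \<otimes> \<pi>\<^sup>-\<^sup>1 = \<Sum>\<^sub>\<pi> \<pi> \<otimes> \<pi>\<^sup>-\<^sup>1r\<close>, and pairing it with \<open>r\<close> itself forces \<open>r = 0\<close>.

So one projects the coefficients of an equivariant matrix onto the sum of \<open>N\<close> and the span of the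
permutations (\<open>M_inv_subset_trace_module\<close>): the remainder is \<open>0\<close>, the part in \<open>N\<close> contributes nothing, and the contraction
of a permutation is, up to sign, a product of traces of words (one for each cycle avoiding the position
\<open>0\<close>) times a word (the cycle through \<open>0\<close>); see \<open>perm_contract_trace_module\<close>. Conversely, traces and words are
equivariant, because the substitutions are algebra homomorphisms. The invariants of \<open>S\<close> follow by applying
the trace to the scalar matrix of \<open>s\<close>, which gives \<open>n \<cdot> s\<close>.\<close>

section \<open>Orthogonal projection\<close>

text \<open>Gram-Schmidt along the index set instead of along a basis of \<open>U\<close>: passing from \<open>\<Omega>\<close> to \<open>insert y \<Omega>\<close>, the
subspace of the \<open>u \<in> U\<close> with \<open>u y = 0\<close> is covered by the induction hypothesis, and it has codimension at most
one in \<open>U\<close>. Functions serve as vectors, so no dimension has to be a type.\<close>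

lemma orthogonal_projection_exists:
  fixes U :: "('a \<Rightarrow> complex) set"
  assumes "finite \<Omega>"
    and "(\<lambda>_. 0) \<in> U"
    and "\<And>u v. u \<in> U \<Longrightarrow> v \<in> U \<Longrightarrow> (\<lambda>x. u x + v x) \<in> U"
    and "\<And>u a. u \<in> U \<Longrightarrow> (\<lambda>x. a * u x) \<in> U"
  shows "\<exists>u\<in>U. \<forall>v\<in>U. (\<Sum>x\<in>\<Omega>. (c x - u x) * cnj (v x)) = 0"
  using assms
proof (induction \<Omega> arbitrary: U c rule: finite_induct)
  case empty
  then show ?case by auto
next
  case (insert y \<Omega>)
  let ?ip = "\<lambda>u v. \<Sum>x\<in>insert y \<Omega>. u x * cnj (v x)"
  let ?U' = "{u \<in> U. u y = 0}"
  have IH: "\<exists>u\<in>?U'. \<forall>v\<in>?U'. (\<Sum>x\<in>\<Omega>. (c x - u x) * cnj (v x)) = 0" for c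
    by (rule insert.IH) (use insert.prems in auto)
  have IH': "\<exists>u\<in>?U'. \<forall>v\<in>?U'. ?ip (\<lambda>x. c x - u x) v = 0" for c
    using IH[of c] insert.hyps by (auto simp: sum.insert)
  show ?case
  proof (cases "\<forall>u\<in>U. u y = 0")
    case True
    then have "?U' = U" by auto
    with IH'[of c] show ?thesis by simp
  next
    case False
    then obtain u0 where u0: "u0 \<in> U" "u0 y \<noteq> 0" by auto
    from IH'[of u0] obtain p where p: "p \<in> ?U'" "\<And>v. v \<in> ?U' \<Longrightarrow> ?ip (\<lambda>x. u0 x - p x) v = 0" by auto
    \<comment> \<open>\<open>w\<close> spans a complement of the smaller subspace in \<open>U\<close> and is orthogonal to it.\<close>
    define w where "w = (\<lambda>x. u0 x - p x)"
    have wU: "w \<in> U"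
      using insert.prems(2)[OF u0(1) insert.prems(3)[of p "-1"]] p by (simp add: w_def)
    have wy: "w y \<noteq> 0" using u0 p by (simp add: w_def)
    have w_orth: "?ip w v = 0" if "v \<in> ?U'" for v using p(2)[OF that] by (simp add: w_def)
    have ww: "?ip w w \<noteq> 0"
    proof -
      have "?ip w w = complex_of_real (\<Sum>x\<in>insert y \<Omega>. (cmod (w x))\<^sup>2)"
        by (simp add: complex_norm_square del: of_real_power)
      moreover have "(\<Sum>x\<in>insert y \<Omega>. (cmod (w x))\<^sup>2) > 0"
        by (rule sum_pos2[of _ y]) (use insert.hyps wy in auto)
      ultimately show ?thesis by (metis of_real_eq_0_iff less_irrefl)
    qed
    from IH'[of c] obtain u1 where u1: "u1 \<in> ?U'" "\<And>v. v \<in> ?U' \<Longrightarrow> ?ip (\<lambda>x. c x - u1 x) v = 0" by auto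
    define a where "a = ?ip (\<lambda>x. c x - u1 x) w / ?ip w w"
    define u where "u = (\<lambda>x. u1 x + a * w x)"
    have uU: "u \<in> U" unfolding u_def using insert.prems u1 wU by auto
    have split: "?ip (\<lambda>x. c x - u x) v = ?ip (\<lambda>x. c x - u1 x) v - a * ?ip w v" for v
      by (simp add: u_def algebra_simps sum_subtractf sum.distrib sum_distrib_left)
    have "?ip (\<lambda>x. c x - u x) v = 0" if v: "v \<in> U" for v
    proof -
      define b where "b = v y / w y"
      define v' where "v' = (\<lambda>x. v x - b * w x)"
      have v': "v' \<in> ?U'"
        using insert.prems(2)[OF v insert.prems(3)[OF wU, of "-b"]] wy by (simp add: v'_def b_def)
      have eq: "?ip h v = ?ip h v' + cnj b * ?ip h w" for h
        by (simp add: v'_def algebra_simps sum_subtractf sum.distrib sum_distrib_left)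
      have "?ip (\<lambda>x. c x - u x) v' = 0" using split[of v'] u1(2)[OF v'] w_orth[OF v'] by simp
      moreover have "?ip (\<lambda>x. c x - u x) w = 0" using split[of w] ww by (simp add: a_def)
      ultimately show ?thesis using eq[of "\<lambda>x. c x - u x"] by simp
    qed
    with uU show ?thesis by blast
  qed
qed

section \<open>Polarization of the permanent\<close>

text \<open>Toggling an element of \<open>M - F\<close> pairs off the supersets of \<open>F\<close> with opposite signs.\<close>

lemma alternating_sum_supersets:
  assumes "finite M" "F \<subseteq> M"
  shows "(\<Sum>T | F \<subseteq> T \<and> T \<subseteq> M. (-1) ^ card (M - T)) = (if F = M then 1 else (0::'a::comm_ring_1))"
proof (cases "F = M")
  case True
  then have "{T. F \<subseteq> T \<and> T \<subseteq> M} = {M}" by auto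
  then show ?thesis using True by simp
next
  case False
  then obtain x where x: "x \<in> M" "x \<notin> F" using assms by auto
  let ?A = "{T. F \<subseteq> T \<and> T \<subseteq> M - {x}}"
  have fin: "finite ?A" using assms by (auto intro: finite_subset[of _ "Pow M"])
  have "{T. F \<subseteq> T \<and> T \<subseteq> M} = ?A \<union> insert x ` ?A"
  proof (intro equalityI subsetI)
    fix T assume T: "T \<in> {T. F \<subseteq> T \<and> T \<subseteq> M}"
    show "T \<in> ?A \<union> insert x ` ?A"
    proof (cases "x \<in> T")
      case True
      then have "T = insert x (T - {x})" "T - {x} \<in> ?A" using T x by auto
      then show ?thesis by blast
    qed (use T in auto)
  qed (use x in auto)
  moreover have "?A \<inter> insert x ` ?A = {}" by auto
  moreover have "inj_on (insert x) ?A" by (rule inj_onI) (metis (no_types, lifting) Diff_insert_absorb insert_Diff_if mem_Collect_eq subset_Diff_insert)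
  ultimately have "(\<Sum>T | F \<subseteq> T \<and> T \<subseteq> M. (-1) ^ card (M - T)) =
     (\<Sum>T\<in>?A. (-1) ^ card (M - T)) + (\<Sum>T\<in>?A. (-1) ^ card (M - insert x T) :: 'a)"
    using fin by (simp add: sum.union_disjoint sum.reindex)
  also have "(\<Sum>T\<in>?A. (-1) ^ card (M - T)) = (\<Sum>T\<in>?A. - ((-1) ^ card (M - insert x T)) :: 'a)"
  proof (rule sum.cong[OF HOL.refl])
    fix T assume T: "T \<in> ?A"
    then have "M - T = insert x (M - insert x T)" using x by auto
    then have "card (M - T) = Suc (card (M - insert x T))"
      using assms(1) by (metis Diff_iff card_insert_disjoint finite_Diff insertCI)
    then show "(-1) ^ card (M - T) = - ((-1) ^ card (M - insert x T) :: 'a)" by simp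
  qed
  finally show ?thesis using False by (simp add: sum_negf)
qed

text \<open>Ryser's formula. Expanding the product gives a sum over all maps \<open>f\<close> from \<open>M\<close> to \<open>T\<close>, and the alternating sum over
the sets \<open>T\<close> that contain the image of \<open>f\<close> keeps just the surjective ones.\<close>

lemma permanent_inclusion_exclusion:
  fixes a :: "'b \<Rightarrow> 'b \<Rightarrow> 'a::comm_ring_1"
  assumes M: "finite M"
  shows "(\<Sum>T\<in>Pow M. (-1) ^ card (M - T) * (\<Prod>s\<in>M. \<Sum>t\<in>T. a s t)) =
    (\<Sum>\<pi> | \<pi> permutes M. \<Prod>s\<in>M. a s (\<pi> s))"
proof -
  let ?F = "M \<rightarrow>\<^sub>E M"
  have finF: "finite ?F" using M by (simp add: finite_PiE)
  have "(\<Sum>T\<in>Pow M. (-1) ^ card (M - T) * (\<Prod>s\<in>M. \<Sum>t\<in>T. a s t)) =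
     (\<Sum>T\<in>Pow M. \<Sum>f\<in>?F. if f ` M \<subseteq> T then (-1) ^ card (M - T) * (\<Prod>s\<in>M. a s (f s)) else 0)"
  proof (rule sum.cong[OF HOL.refl])
    fix T assume T: "T \<in> Pow M"
    then have "finite T" using M finite_subset by auto
    then have "(\<Prod>s\<in>M. \<Sum>t\<in>T. a s t) = (\<Sum>f\<in>M \<rightarrow>\<^sub>E T. \<Prod>s\<in>M. a s (f s))"
      using M by (subst prod_sum_PiE) auto
    also have "(-1) ^ card (M - T) * \<dots> = (\<Sum>f\<in>M \<rightarrow>\<^sub>E T. (-1) ^ card (M - T) * (\<Prod>s\<in>M. a s (f s)))"
      by (simp add: sum_distrib_left)
    also have "\<dots> = (\<Sum>f\<in>{f \<in> ?F. f ` M \<subseteq> T}. (-1) ^ card (M - T) * (\<Prod>s\<in>M. a s (f s)))"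
      by (rule sum.cong) (use T in \<open>auto simp: PiE_def Pi_def\<close>)
    finally show "(-1) ^ card (M - T) * (\<Prod>s\<in>M. \<Sum>t\<in>T. a s t) =
       (\<Sum>f\<in>?F. if f ` M \<subseteq> T then (-1) ^ card (M - T) * (\<Prod>s\<in>M. a s (f s)) else 0)"
      using finF by (simp add: sum.inter_filter)
  qed
  also have "\<dots> = (\<Sum>f\<in>?F. \<Sum>T\<in>Pow M. if f ` M \<subseteq> T then (-1) ^ card (M - T) * (\<Prod>s\<in>M. a s (f s)) else 0)"
    by (rule sum.swap)
  also have "\<dots> = (\<Sum>f\<in>?F. if f ` M = M then (\<Prod>s\<in>M. a s (f s)) else 0)"
  proof (rule sum.cong[OF HOL.refl])
    fix f assume f: "f \<in> ?F"
    then have "f ` M \<subseteq> M" by auto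
    have "(\<Sum>T\<in>Pow M. if f ` M \<subseteq> T then (-1) ^ card (M - T) * (\<Prod>s\<in>M. a s (f s)) else 0) =
      (\<Sum>T\<in>{T \<in> Pow M. f ` M \<subseteq> T}. (-1) ^ card (M - T) * (\<Prod>s\<in>M. a s (f s)))"
      by (rule sum.inter_filter[symmetric]) (use M in simp)
    also have "{T \<in> Pow M. f ` M \<subseteq> T} = {T. f ` M \<subseteq> T \<and> T \<subseteq> M}" by auto
    finally show "(\<Sum>T\<in>Pow M. if f ` M \<subseteq> T then (-1) ^ card (M - T) * (\<Prod>s\<in>M. a s (f s)) else 0) =
      (if f ` M = M then (\<Prod>s\<in>M. a s (f s)) else 0)"
      using alternating_sum_supersets[OF M \<open>f ` M \<subseteq> M\<close>, where ?'a = 'a]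
      by (simp flip: sum_distrib_right)
  qed
  also have "\<dots> = (\<Sum>f\<in>{f \<in> ?F. f ` M = M}. \<Prod>s\<in>M. a s (f s))"
    using finF by (simp add: sum.inter_filter)
  also have "\<dots> = (\<Sum>\<pi> | \<pi> permutes M. \<Prod>s\<in>M. a s (\<pi> s))"
  proof (rule sum.reindex_bij_witness[of _ "\<lambda>\<pi>. restrict \<pi> M" "\<lambda>f x. if x \<in> M then f x else x"])
    fix f assume f: "f \<in> {f \<in> ?F. f ` M = M}"
    show "restrict (\<lambda>x. if x \<in> M then f x else x) M = f"
      using f by (auto simp: fun_eq_iff restrict_def PiE_def extensional_def)
    have "inj_on f M" using f M by (simp add: eq_card_imp_inj_on)
    then have "bij_betw f M M" using f by (simp add: bij_betw_def)
    then have "bij_betw (\<lambda>x. if x \<in> M then f x else x) M M" by (rule bij_betw_cong[THEN iffD1, rotated]) simp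
    then show "(\<lambda>x. if x \<in> M then f x else x) \<in> {\<pi>. \<pi> permutes M}"
      by (auto intro: bij_imp_permutes)
    show "(\<Prod>s\<in>M. a s (if s \<in> M then f s else s)) = (\<Prod>s\<in>M. a s (f s))"
      by (rule prod.cong) auto
  next
    fix \<pi> assume \<pi>: "\<pi> \<in> {\<pi>. \<pi> permutes M}"
    then show "(\<lambda>x. if x \<in> M then restrict \<pi> M x else x) = \<pi>"
      by (auto simp: fun_eq_iff permutes_not_in)
    show "restrict \<pi> M \<in> {f \<in> ?F. f ` M = M}"
      using \<pi> permutes_image[of \<pi> M] by (auto simp: permutes_in_image image_def)
  qed
  finally show ?thesis .
qed

section \<open>Operators that commute with all tensor powers\<close>

text \<open>The multi-indices for the standard basis of the \<open>(d + 1)\<close>-fold tensor power of \<open>\<complex>\<^sup>n\<close>, with positions \<open>0, \<dots>, d\<close>.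
The position \<open>0\<close> will stand for the output of a matrix-valued contraction, the others for the letters of a word.\<close>

definition idx :: "nat \<Rightarrow> nat \<Rightarrow> (nat \<Rightarrow> nat) set" where
  "idx n d = {..d} \<rightarrow>\<^sub>E {..<n}"

text \<open>The matrix coefficient at \<open>(p, q)\<close> of the \<open>(d + 1)\<close>-fold tensor power of \<open>g\<close>.\<close>

definition kron :: "nat \<Rightarrow> complex mat \<Rightarrow> (nat \<Rightarrow> nat) \<Rightarrow> (nat \<Rightarrow> nat) \<Rightarrow> complex" where
  "kron d g p q = (\<Prod>s\<le>d. g $$ (p s, q s))"

definition kron_commute :: "nat \<Rightarrow> nat \<Rightarrow> ((nat \<Rightarrow> nat) \<Rightarrow> (nat \<Rightarrow> nat) \<Rightarrow> complex) \<Rightarrow> complex mat \<Rightarrow> bool" where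
  "kron_commute n d r g \<longleftrightarrow> (\<forall>p\<in>idx n d. \<forall>q\<in>idx n d.
     (\<Sum>k\<in>idx n d. kron d g p k * r k q) = (\<Sum>k\<in>idx n d. r p k * kron d g k q))"

lemma finite_idx [simp]: "finite (idx n d)"
  by (simp add: idx_def finite_PiE)

lemma idx_less: "p \<in> idx n d \<Longrightarrow> s \<le> d \<Longrightarrow> p s < n"
  by (auto simp: idx_def)

lemma idx_eqI: "p \<in> idx n d \<Longrightarrow> q \<in> idx n d \<Longrightarrow> (\<And>s. s \<le> d \<Longrightarrow> p s = q s) \<Longrightarrow> p = q"
  unfolding idx_def by (rule PiE_ext) auto

lemma idx_permute: "\<pi> permutes {..d} \<Longrightarrow> p \<in> idx n d \<Longrightarrow> p \<circ> \<pi> \<in> idx n d"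
  unfolding idx_def PiE_def extensional_def Pi_def
  by (auto simp: permutes_not_in dest: permutes_in_image[of \<pi> "{..d}"])

lemma finite_singular_shifts:
  fixes E :: "complex mat"
  assumes E: "E \<in> carrier_mat n n"
  shows "finite {y. det (y \<cdot>\<^sub>m 1\<^sub>m n + E) = 0}"
proof -
  have "det (y \<cdot>\<^sub>m 1\<^sub>m n + E) = poly (char_poly (- E)) y" for y
  proof -
    have "y \<cdot>\<^sub>m 1\<^sub>m n + E = - char_matrix (- E) y" using E by (auto simp: char_matrix_def)
    then show ?thesis using char_poly_matrix[of "- E" n y] E by simp
  qed
  moreover have "char_poly (- E) \<noteq> 0" using degree_monic_char_poly[of "- E" n] E by auto
  ultimately show ?thesis by (simp add: poly_roots_finite)
qed

text \<open>Both sides of the commutation relation are continuous in \<open>g\<close>, and \<open>E + y\<close> is invertible for all but finitely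
many scalars \<open>y\<close>.\<close>

lemma kron_commute_dense:
  assumes GL: "\<And>g. g \<in> carrier_mat n n \<Longrightarrow> det g \<noteq> 0 \<Longrightarrow> kron_commute n d r g"
    and E: "E \<in> carrier_mat n n"
  shows "kron_commute n d r E"
  unfolding kron_commute_def
proof (intro ballI)
  fix p q assume pq: "p \<in> idx n d" "q \<in> idx n d"
  define g where "g y = y \<cdot>\<^sub>m 1\<^sub>m n + E" for y
  define h where "h y = (\<Sum>k\<in>idx n d. kron d (g y) p k * r k q) - (\<Sum>k\<in>idx n d. r p k * kron d (g y) k q)" for y
  have gE: "g y $$ (a, b) = y * (if a = b then 1 else 0) + E $$ (a, b)" if "a < n" "b < n" for a b y
    using that E by (simp add: g_def)
  have k: "kron d (g y) p' q' = (\<Prod>s\<le>d. y * (if p' s = q' s then 1 else 0) + E $$ (p' s, q' s))"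
    if "p' \<in> idx n d" "q' \<in> idx n d" for p' q' y
    unfolding kron_def using that by (intro prod.cong HOL.refl gE) (auto intro: idx_less)
  have "h = (\<lambda>y. (\<Sum>k\<in>idx n d. (\<Prod>s\<le>d. y * (if p s = k s then 1 else 0) + E $$ (p s, k s)) * r k q)
      - (\<Sum>k\<in>idx n d. r p k * (\<Prod>s\<le>d. y * (if k s = q s then 1 else 0) + E $$ (k s, q s))))"
    unfolding h_def by (intro ext arg_cong2[where f = minus] sum.cong HOL.refl) (simp_all add: k pq)
  then have cont: "isCont h 0" by (simp only:) (intro continuous_intros)
  have "finite {y. det (g y) = 0}" unfolding g_def by (rule finite_singular_shifts[OF E])
  then have "eventually (\<lambda>y. \<forall>z\<in>{y. det (g y) = 0}. y \<noteq> z) (at 0)"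
    by (rule eventually_ball_finite) (auto intro: eventually_neq_at_within)
  then have "eventually (\<lambda>y. h y = 0) (at 0)"
  proof (rule eventually_mono)
    fix y assume "\<forall>z\<in>{y. det (g y) = 0}. y \<noteq> z"
    then have "kron_commute n d r (g y)" by (intro GL) (use E in \<open>auto simp: g_def\<close>)
    then show "h y = 0" using pq by (simp add: kron_commute_def h_def)
  qed
  then have "(h \<longlongrightarrow> 0) (at 0)" by (rule tendsto_eventually)
  moreover have "(h \<longlongrightarrow> h 0) (at 0)" using cont by (simp add: isCont_def)
  ultimately have "h 0 = 0" using LIM_unique by blast
  moreover have "g 0 = E" using E by (auto simp: g_def)
  ultimately show "(\<Sum>k\<in>idx n d. kron d E p k * r k q) = (\<Sum>k\<in>idx n d. r p k * kron d E k q)"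
    by (simp add: h_def)
qed

text \<open>The tensor powers of the sums of subfamilies of the matrix units \<open>E\<^bsub>K t, L t\<^esub>\<close> combine to the symmetrization
of their tensor product. This makes the span of all tensor powers concrete.\<close>

lemma kron_polarization:
  assumes "P \<in> idx n d" "Q \<in> idx n d" "K \<in> idx n d" "L \<in> idx n d"
  shows "(\<Sum>T\<in>Pow {..d}. (-1) ^ card ({..d} - T) * kron d (mat n n (\<lambda>(a, b). \<Sum>t\<in>T. of_bool (a = K t \<and> b = L t))) P Q) =
    (\<Sum>\<pi> | \<pi> permutes {..d}. of_bool (P = K \<circ> \<pi>) * of_bool (Q = L \<circ> \<pi>))"
proof -
  have "kron d (mat n n (\<lambda>(a, b). \<Sum>t\<in>T. of_bool (a = K t \<and> b = L t))) P Q =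
      (\<Prod>s\<le>d. \<Sum>t\<in>T. of_bool (P s = K t \<and> Q s = L t))" for T
    unfolding kron_def using assms by (intro prod.cong) (auto simp: idx_less)
  then have "(\<Sum>T\<in>Pow {..d}. (-1) ^ card ({..d} - T) * kron d (mat n n (\<lambda>(a, b). \<Sum>t\<in>T. of_bool (a = K t \<and> b = L t))) P Q)
    = (\<Sum>\<pi> | \<pi> permutes {..d}. \<Prod>s\<le>d. of_bool (P s = K (\<pi> s) \<and> Q s = L (\<pi> s)))"
    using permanent_inclusion_exclusion[of "{..d}" "\<lambda>s t. of_bool (P s = K t \<and> Q s = L t) :: complex"] by simp
  also have "\<dots> = (\<Sum>\<pi> | \<pi> permutes {..d}. of_bool (P = K \<circ> \<pi>) * of_bool (Q = L \<circ> \<pi>))"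
  proof (rule sum.cong[OF HOL.refl])
    fix \<pi> assume "\<pi> \<in> {\<pi>. \<pi> permutes {..d}}"
    then have "P = K \<circ> \<pi> \<longleftrightarrow> (\<forall>s\<le>d. P s = K (\<pi> s))" "Q = L \<circ> \<pi> \<longleftrightarrow> (\<forall>s\<le>d. Q s = L (\<pi> s))"
      using assms by (auto intro!: idx_eqI[of _ n d] simp: idx_permute)
    then show "(\<Prod>s\<le>d. of_bool (P s = K (\<pi> s) \<and> Q s = L (\<pi> s))) = (of_bool (P = K \<circ> \<pi>) * of_bool (Q = L \<circ> \<pi>) :: complex)"
      by (cases "P = K \<circ> \<pi>"; cases "Q = L \<circ> \<pi>") (auto intro!: prod.neutral)
  qed
  finally show ?thesis .
qed

text \<open>The entry \<open>(P, Q)\<close> of the statement that \<open>r\<close> commutes with the sum of the conjugates of the matrix unit \<open>E\<^bsub>K, L\<^esub>\<close>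
under all place permutations.\<close>

lemma commute_permutation_sums:
  assumes GL: "\<And>g. g \<in> carrier_mat n n \<Longrightarrow> kron_commute n d r g"
    and P: "P \<in> idx n d" and Q: "Q \<in> idx n d" and K: "K \<in> idx n d" and L: "L \<in> idx n d"
  shows "(\<Sum>\<pi> | \<pi> permutes {..d}. of_bool (P = K \<circ> \<pi>) * r (L \<circ> \<pi>) Q) =
         (\<Sum>\<pi> | \<pi> permutes {..d}. r P (K \<circ> \<pi>) * of_bool (Q = L \<circ> \<pi>))"
proof -
  define E where "E T = mat n n (\<lambda>(a, b). \<Sum>t\<in>T. of_bool (a = K t \<and> b = L t) :: complex)" for T
  let ?s = "\<lambda>T. (-1) ^ card ({..d} - T) :: complex"
  have "(\<Sum>T\<in>Pow {..d}. ?s T * (\<Sum>k\<in>idx n d. kron d (E T) P k * r k Q)) =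
        (\<Sum>T\<in>Pow {..d}. ?s T * (\<Sum>k\<in>idx n d. r P k * kron d (E T) k Q))"
  proof -
    have "(\<Sum>k\<in>idx n d. kron d (E T) P k * r k Q) = (\<Sum>k\<in>idx n d. r P k * kron d (E T) k Q)" for T
      using GL[of "E T"] P Q by (simp add: kron_commute_def E_def)
    then show ?thesis by simp
  qed
  moreover have "(\<Sum>T\<in>Pow {..d}. ?s T * (\<Sum>k\<in>idx n d. kron d (E T) P k * r k Q)) =
      (\<Sum>k\<in>idx n d. (\<Sum>T\<in>Pow {..d}. ?s T * kron d (E T) P k) * r k Q)"
    by (simp add: sum_distrib_left sum_distrib_right mult.assoc) (rule sum.swap)
  moreover have "\<dots> = (\<Sum>k\<in>idx n d. (\<Sum>\<pi> | \<pi> permutes {..d}. of_bool (P = K \<circ> \<pi>) * of_bool (k = L \<circ> \<pi>)) * r k Q)"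
    unfolding E_def by (intro sum.cong HOL.refl) (simp only: kron_polarization[OF P _ K L])
  moreover have "\<dots> = (\<Sum>\<pi> | \<pi> permutes {..d}. \<Sum>k\<in>idx n d. of_bool (P = K \<circ> \<pi>) * (of_bool (k = L \<circ> \<pi>) * r k Q))"
    by (simp only: sum_distrib_right mult.assoc) (rule sum.swap)
  moreover have "\<dots> = (\<Sum>\<pi> | \<pi> permutes {..d}. of_bool (P = K \<circ> \<pi>) * r (L \<circ> \<pi>) Q)"
    by (intro sum.cong HOL.refl) (auto simp: of_bool_def if_distrib[of "\<lambda>x. x * _"] idx_permute L cong: if_cong)
  moreover have "(\<Sum>T\<in>Pow {..d}. ?s T * (\<Sum>k\<in>idx n d. r P k * kron d (E T) k Q)) =
      (\<Sum>k\<in>idx n d. r P k * (\<Sum>T\<in>Pow {..d}. ?s T * kron d (E T) k Q))"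
    by (simp add: sum_distrib_left sum_distrib_right mult_ac) (rule sum.swap)
  moreover have "\<dots> = (\<Sum>k\<in>idx n d. r P k * (\<Sum>\<pi> | \<pi> permutes {..d}. of_bool (k = K \<circ> \<pi>) * of_bool (Q = L \<circ> \<pi>)))"
    unfolding E_def by (intro sum.cong HOL.refl) (simp only: kron_polarization[OF _ Q K L])
  moreover have "\<dots> = (\<Sum>\<pi> | \<pi> permutes {..d}. \<Sum>k\<in>idx n d. (of_bool (k = K \<circ> \<pi>) * r P k) * of_bool (Q = L \<circ> \<pi>))"
    by (simp only: sum_distrib_left mult_ac) (rule sum.swap)
  moreover have "\<dots> = (\<Sum>\<pi> | \<pi> permutes {..d}. r P (K \<circ> \<pi>) * of_bool (Q = L \<circ> \<pi>))"
    by (intro sum.cong HOL.refl) (auto simp: of_bool_def if_distrib[of "\<lambda>x. x * _"] idx_permute K cong: if_cong)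
  ultimately show ?thesis by simp
qed

lemma sum_rotate:
  "(\<Sum>a\<in>A. \<Sum>b\<in>B. \<Sum>c\<in>C. \<Sum>d\<in>D. f a b c d) = (\<Sum>b\<in>B. \<Sum>c\<in>C. \<Sum>d\<in>D. \<Sum>a\<in>A. f a b c d)"
proof -
  have "(\<Sum>a\<in>A. \<Sum>b\<in>B. \<Sum>c\<in>C. \<Sum>d\<in>D. f a b c d) = (\<Sum>b\<in>B. \<Sum>a\<in>A. \<Sum>c\<in>C. \<Sum>d\<in>D. f a b c d)"
    by (rule sum.swap)
  also have "\<dots> = (\<Sum>b\<in>B. \<Sum>c\<in>C. \<Sum>a\<in>A. \<Sum>d\<in>D. f a b c d)"
    by (rule sum.cong[OF HOL.refl], rule sum.swap)
  also have "\<dots> = (\<Sum>b\<in>B. \<Sum>c\<in>C. \<Sum>d\<in>D. \<Sum>a\<in>A. f a b c d)"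
    by (rule sum.cong[OF HOL.refl], rule sum.cong[OF HOL.refl], rule sum.swap)
  finally show ?thesis .
qed

text \<open>Write \<open>Y \<pi> = tr (r \<pi> r\<^sup>*)\<close>, up to replacing \<open>\<pi>\<close> by its inverse. Pairing \<open>commute_permutation_sums\<close> with the conjugate of
\<open>r\<close> in the indices \<open>P\<close> and \<open>K\<close> makes one side vanish by orthogonality to the permutations; the other side then says
that \<open>\<Sum>\<^sub>\<pi> Y \<pi> \<cdot> \<pi> = 0\<close> as an operator. Taking the trace against \<open>r\<^sup>*r\<close> turns this into \<open>\<Sum>\<^sub>\<pi> \<bar>Y \<pi>\<bar>\<^sup>2 = 0\<close>, and
\<open>Y id\<close> is the squared norm of \<open>r\<close>. This works for every \<open>d\<close>, also when \<open>d\<close> exceeds \<open>n\<close> and the permutations are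
linearly dependent.\<close>

lemma commutant_orthogonal_permutations:
  assumes GL: "\<And>g. g \<in> carrier_mat n n \<Longrightarrow> kron_commute n d r g"
    and orth: "\<And>\<pi>. \<pi> permutes {..d} \<Longrightarrow> (\<Sum>q\<in>idx n d. r (q \<circ> \<pi>) q) = 0"
    and p: "p \<in> idx n d" and q: "q \<in> idx n d"
  shows "r p q = 0"
proof -
  let ?I = "idx n d" and ?S = "{\<pi>. \<pi> permutes {..d}}"
  define Y where "Y \<pi> = (\<Sum>P\<in>?I. \<Sum>K\<in>?I. r P (K \<circ> \<pi>) * cnj (r P K))" for \<pi>
  have finS: "finite ?S" by (simp add: finite_permutations)
  have Y0: "(\<Sum>\<pi>\<in>?S. Y \<pi> * of_bool (Q = L \<circ> \<pi>)) = 0" if Q: "Q \<in> ?I" and L: "L \<in> ?I" for Q L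
  proof -
    have "(\<Sum>\<pi>\<in>?S. Y \<pi> * of_bool (Q = L \<circ> \<pi>)) =
       (\<Sum>\<pi>\<in>?S. \<Sum>P\<in>?I. \<Sum>K\<in>?I. r P (K \<circ> \<pi>) * of_bool (Q = L \<circ> \<pi>) * cnj (r P K))"
      by (simp add: Y_def sum_distrib_left sum_distrib_right mult_ac)
    also have "\<dots> = (\<Sum>P\<in>?I. \<Sum>K\<in>?I. \<Sum>\<pi>\<in>?S. r P (K \<circ> \<pi>) * of_bool (Q = L \<circ> \<pi>) * cnj (r P K))"
      by (subst sum.swap) (intro sum.cong HOL.refl sum.swap)
    also have "\<dots> = (\<Sum>P\<in>?I. \<Sum>K\<in>?I. (\<Sum>\<pi>\<in>?S. r P (K \<circ> \<pi>) * of_bool (Q = L \<circ> \<pi>)) * cnj (r P K))"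
      by (simp add: sum_distrib_right)
    also have "\<dots> = (\<Sum>P\<in>?I. \<Sum>K\<in>?I. (\<Sum>\<pi>\<in>?S. of_bool (P = K \<circ> \<pi>) * r (L \<circ> \<pi>) Q) * cnj (r P K))"
      by (intro sum.cong HOL.refl) (simp only: commute_permutation_sums[OF GL _ Q _ L])
    also have "\<dots> = (\<Sum>P\<in>?I. \<Sum>K\<in>?I. \<Sum>\<pi>\<in>?S. of_bool (P = K \<circ> \<pi>) * cnj (r P K) * r (L \<circ> \<pi>) Q)"
      by (simp add: sum_distrib_left sum_distrib_right mult_ac)
    also have "\<dots> = (\<Sum>\<pi>\<in>?S. \<Sum>K\<in>?I. \<Sum>P\<in>?I. of_bool (P = K \<circ> \<pi>) * cnj (r P K) * r (L \<circ> \<pi>) Q)"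
      by (subst sum.swap, subst (2) sum.swap) (intro sum.cong HOL.refl sum.swap)
    also have "\<dots> = (\<Sum>\<pi>\<in>?S. \<Sum>K\<in>?I. cnj (r (K \<circ> \<pi>) K) * r (L \<circ> \<pi>) Q)"
      by (intro sum.cong HOL.refl) (auto simp: of_bool_def if_distrib[of "\<lambda>x. x * _"] idx_permute cong: if_cong)
    also have "\<dots> = (\<Sum>\<pi>\<in>?S. cnj (\<Sum>K\<in>?I. r (K \<circ> \<pi>) K) * r (L \<circ> \<pi>) Q)"
      by (simp add: sum_distrib_right)
    also have "\<dots> = 0" using orth by simp
    finally show ?thesis .
  qed
  have "(\<Sum>\<pi>\<in>?S. Y \<pi> * cnj (Y \<pi>)) =
      (\<Sum>\<pi>\<in>?S. \<Sum>P\<in>?I. \<Sum>L\<in>?I. Y \<pi> * (cnj (r P (L \<circ> \<pi>)) * r P L))"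
    unfolding Y_def[of "_ :: nat \<Rightarrow> nat"] by (simp add: sum_distrib_left)
  also have "\<dots> = (\<Sum>\<pi>\<in>?S. \<Sum>P\<in>?I. \<Sum>L\<in>?I. \<Sum>Q\<in>?I. Y \<pi> * of_bool (Q = L \<circ> \<pi>) * (cnj (r P Q) * r P L))"
    by (intro sum.cong HOL.refl) (auto simp: of_bool_def if_distrib[of "\<lambda>x. _ * x"] if_distrib[of "\<lambda>x. x * _"] idx_permute cong: if_cong)
  also have "\<dots> = (\<Sum>P\<in>?I. \<Sum>L\<in>?I. \<Sum>Q\<in>?I. \<Sum>\<pi>\<in>?S. Y \<pi> * of_bool (Q = L \<circ> \<pi>) * (cnj (r P Q) * r P L))"
    by (rule sum_rotate)
  also have "\<dots> = 0"
    by (simp add: Y0 flip: sum_distrib_right)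
  finally have "(\<Sum>\<pi>\<in>?S. Y \<pi> * cnj (Y \<pi>)) = 0" .
  moreover have "(\<Sum>\<pi>\<in>?S. Y \<pi> * cnj (Y \<pi>)) = complex_of_real (\<Sum>\<pi>\<in>?S. (cmod (Y \<pi>))\<^sup>2)"
    by (simp add: complex_norm_square del: of_real_power)
  ultimately have "(\<Sum>\<pi>\<in>?S. (cmod (Y \<pi>))\<^sup>2) = 0" by (metis of_real_eq_0_iff)
  then have "Y id = 0"
    using finS permutes_id[of "{..d}"] by (subst (asm) sum_nonneg_eq_0_iff) auto
  moreover have "Y id = complex_of_real (\<Sum>P\<in>?I. \<Sum>K\<in>?I. (cmod (r P K))\<^sup>2)"
    by (simp add: Y_def complex_norm_square del: of_real_power)
  ultimately have "(\<Sum>P\<in>?I. \<Sum>K\<in>?I. (cmod (r P K))\<^sup>2) = 0" by (metis of_real_eq_0_iff)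
  then have "(\<Sum>K\<in>?I. (cmod (r p K))\<^sup>2) = 0"
    using p by (subst (asm) sum_nonneg_eq_0_iff) (auto intro: sum_nonneg)
  then show ?thesis using q by (subst (asm) sum_nonneg_eq_0_iff) auto
qed

section \<open>Substitutions are algebra homomorphisms\<close>

text \<open>The normally ordered monomials \<open>c \<cdot> \<eta>\<^sup>m \<cdot> \<xi>\<^sub>A\<close>, on which substitution is given by its defining formula.\<close>

definition smono :: "complex \<Rightarrow> svar fset \<Rightarrow> (svar \<Rightarrow>\<^sub>0 nat) \<Rightarrow> spoly" where
  "smono c A m = Ext (Poly_Mapping.single A (Poly_Mapping.single m c))"

lemma scoeff_smono: "scoeff (smono c A m) B = (if B = A then Poly_Mapping.single m c else 0)"
  by (simp add: smono_def Ext_inverse lookup_single when_def)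

lemma scoeff_sum: "scoeff (sum h I) A = (\<Sum>x\<in>I. scoeff (h x) A)"
  by (induction I rule: infinite_finite_induct) auto

lemma poly_mapping_sum_single:
  "(\<Sum>m\<in>Poly_Mapping.keys p. Poly_Mapping.single m (Poly_Mapping.lookup p m)) = p"
  by (rule poly_mapping_eqI) (simp add: lookup_sum lookup_single when_def in_keys_iff)

lemma spoly_sum_smono:
  "s = (\<Sum>A\<in>Poly_Mapping.keys (ext_coeffs s). \<Sum>m\<in>Poly_Mapping.keys (scoeff s A).
     smono (Poly_Mapping.lookup (scoeff s A) m) A m)"
proof (rule ext_eqI)
  fix B
  have "scoeff (\<Sum>A\<in>Poly_Mapping.keys (ext_coeffs s). \<Sum>m\<in>Poly_Mapping.keys (scoeff s A).
     smono (Poly_Mapping.lookup (scoeff s A) m) A m) B =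
     (\<Sum>A\<in>Poly_Mapping.keys (ext_coeffs s). if A = B then scoeff s B else 0)"
    unfolding scoeff_sum scoeff_smono by (intro sum.cong HOL.refl) (auto simp: poly_mapping_sum_single)
  also have "\<dots> = scoeff s B" by (simp add: in_keys_iff)
  finally show "scoeff s B = scoeff (\<Sum>A\<in>Poly_Mapping.keys (ext_coeffs s). \<Sum>m\<in>Poly_Mapping.keys (scoeff s A).
     smono (Poly_Mapping.lookup (scoeff s A) m) A m) B" ..
qed

lemma spoly_induct [case_names zero add mono]:
  assumes "P 0" "\<And>s t. P s \<Longrightarrow> P t \<Longrightarrow> P (s + t)" "\<And>c A m. P (smono c A m)"
  shows "P s"
proof -
  have sumI: "(\<And>x. x \<in> I \<Longrightarrow> P (h x)) \<Longrightarrow> P (sum h I)" for h and I :: "'x set"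
    by (induction I rule: infinite_finite_induct) (auto intro: assms)
  show ?thesis
    by (subst spoly_sum_smono) (intro sumI assms)
qed

lemma bos_smono: "bos v * smono c A m = smono c A (m + Poly_Mapping.single v 1)"
  by (rule ext_eqI) (auto simp: bos_def scoeff_smono mult_single add.commute)

text \<open>The sign counts the fermionic factors that the new one has to pass to reach its place.\<close>

lemma fer_smono:
  "fer v * smono c A m =
    (if v |\<in>| A then 0 else smono ((-1) ^ card {a. a |\<in>| A \<and> a < v} * c) (finsert v A) m)"
proof (rule ext_eqI)
  fix C
  have "scoeff (fer v * smono c A m) C =
    (\<Sum>B\<in>{B. B |\<subseteq>| C}. if B = {|v|} then ext_sign {|v|} (C |-| {|v|}) * scoeff (smono c A m) (C |-| {|v|}) else 0)"
    unfolding scoeff_mult by (rule sum.cong) (auto simp: scoeff_fer)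
  also have "\<dots> = (if v |\<in>| C \<and> C |-| {|v|} = A then ext_sign {|v|} A * Poly_Mapping.single m c else 0)"
    by (auto simp: scoeff_smono)
  also have "ext_sign {|v|} A * Poly_Mapping.single m c = (Poly_Mapping.single m ((-1) ^ card {a. a |\<in>| A \<and> a < v} * c) :: bpoly)"
  proof -
    have "{(a, b). a |\<in>| {|v|} \<and> b |\<in>| A \<and> b < a} = Pair v ` {a. a |\<in>| A \<and> a < v}" by auto
    then have "card {(a, b). a |\<in>| {|v|} \<and> b |\<in>| A \<and> b < a} = card {a. a |\<in>| A \<and> a < v}"
      by (simp add: card_image inj_on_def)
    then have e: "(ext_sign {|v|} A :: bpoly) = (-1) ^ card {a. a |\<in>| A \<and> a < v}"
      by (simp add: ext_sign_def)
    show ?thesis unfolding e by (simp add: minus_one_power_iff single_uminus)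
  qed
  also have "(if v |\<in>| C \<and> C |-| {|v|} = A then (Poly_Mapping.single m ((-1) ^ card {a. a |\<in>| A \<and> a < v} * c) :: bpoly) else 0)
    = scoeff (if v |\<in>| A then 0 else smono ((-1) ^ card {a. a |\<in>| A \<and> a < v} * c) (finsert v A) m) C"
  proof -
    have "v |\<in>| C \<and> C |-| {|v|} = A \<longleftrightarrow> v |\<notin>| A \<and> C = finsert v A" by auto
    then show ?thesis by (auto simp: scoeff_smono)
  qed
  finally show "scoeff (fer v * smono c A m) C = scoeff (if v |\<in>| A then 0 else smono ((-1) ^ card {a. a |\<in>| A \<and> a < v} * c) (finsert v A) m) C" .
qed

lemma sconst_smono: "sconst a * smono c A m = smono (a * c) A m"
  by (rule ext_eqI) (auto simp: sconst_def scoeff_smono mult_single)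

lemma smono_one: "smono c {||} 0 = sconst c"
  by (rule ext_eqI) (auto simp: sconst_def scoeff_smono scoeff_ext_scal)

lemma prod_list_insort_central:
  fixes h :: "'a::linorder \<Rightarrow> 'b::monoid_mult"
  assumes "\<And>y. y \<in> set xs \<Longrightarrow> h y * h x = h x * h y"
  shows "prod_list (map h (insort x xs)) = h x * prod_list (map h xs)"
  using assms
proof (induction xs)
  case (Cons y xs)
  have "h y * (h x * prod_list (map h xs)) = h x * (h y * prod_list (map h xs))"
    using Cons.prems[of y] by (simp add: mult.assoc[symmetric])
  then show ?case using Cons by auto
qed auto

lemma prod_list_sorted_insert_central:
  fixes h :: "'a::linorder \<Rightarrow> 'b::monoid_mult"
  assumes "finite K" "x \<notin> K" "\<And>y. h y * h x = h x * h y"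
  shows "prod_list (map h (sorted_list_of_set (insert x K))) = h x * prod_list (map h (sorted_list_of_set K))"
  using assms by (simp add: prod_list_insort_central)

text \<open>The sign here is the same as in \<open>fer_smono\<close>, which is what makes substitution compatible with multiplication by a
fermionic variable.\<close>

lemma prod_list_insort_anticommuting:
  fixes h :: "'a::linorder \<Rightarrow> 'b::ring_1"
  assumes "sorted xs" "x \<notin> set xs" "\<And>y. h y * h x = - (h x * h y)"
  shows "h x * prod_list (map h xs) = (-1) ^ length (filter (\<lambda>y. y < x) xs) * prod_list (map h (insort x xs))"
  using assms
proof (induction xs)
  case Nil
  show ?case by simp
next
  case (Cons y xs)
  show ?case
  proof (cases "x < y")
    case True
    then have "filter (\<lambda>z. z < x) (y # xs) = []" using Cons.prems(1) by (auto simp: filter_empty_conv)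
    then have "length (filter (\<lambda>z. z < x) (y # xs)) = 0" by (simp only: list.size)
    then show ?thesis using True less_imp_le[OF True] by (simp del: filter.simps)
  next
    case False
    then have yx: "y < x" using Cons.prems by auto
    have sw: "h x * h y = - (h y * h x)" using Cons.prems(3)[of y] by simp
    have "h x * (h y * prod_list (map h xs)) = - (h y * (h x * prod_list (map h xs)))"
      by (simp add: sw mult.assoc[symmetric])
    also have "\<dots> = - (h y * ((-1) ^ length (filter (\<lambda>y. y < x) xs) * prod_list (map h (insort x xs))))"
    proof -
      have "sorted xs" "x \<notin> set xs" using Cons.prems(1,2) by auto
      from Cons.IH[OF this Cons.prems(3)] show ?thesis by (simp only:)
    qed
    also have "\<dots> = (-1) ^ length (filter (\<lambda>z. z < x) (y # xs)) * prod_list (map h (insort x (y # xs)))"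
      using yx by (simp add: minus_one_power_iff linorder_class.not_le[THEN iffD2, OF yx])
    finally show ?thesis by simp
  qed
qed

lemma prod_list_anticommuting_repeated:
  fixes h :: "'a \<Rightarrow> 'b::ring_1"
  assumes "x \<in> set xs" "\<And>y. h x * h y = - (h y * h x)" "h x * h x = 0"
  shows "h x * prod_list (map h xs) = 0"
  using assms
proof (induction xs)
  case Nil
  from Nil.prems(1) show ?case by simp
next
  case (Cons y xs)
  show ?case
  proof (cases "x = y")
    case True
    then show ?thesis using Cons.prems(3) by (simp add: mult.assoc[symmetric])
  next
    case False
    have "h x * prod_list (map h (y # xs)) = - (h y * (h x * prod_list (map h xs)))"
      by (simp add: Cons.prems(2)[of y] mult.assoc[symmetric])
    also have "\<dots> = 0" using Cons.IH[OF _ Cons.prems(2,3)] Cons.prems(1) False by simp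
    finally show ?thesis .
  qed
qed

definition bos_value :: "(svar \<Rightarrow> spoly) \<Rightarrow> (svar \<Rightarrow>\<^sub>0 nat) \<Rightarrow> spoly" where
  "bos_value \<beta> m = prod_list (map (\<lambda>v. \<beta> v ^ Poly_Mapping.lookup m v) (sorted_list_of_set (Poly_Mapping.keys m)))"

definition fer_value :: "(svar \<Rightarrow> spoly) \<Rightarrow> svar fset \<Rightarrow> spoly" where
  "fer_value \<phi> A = prod_list (map \<phi> (sorted_list_of_fset A))"

text \<open>The definition of substitution sums over the supports of its argument; summing over a larger set common to
several arguments is what makes additivity accessible.\<close>

lemma ssubst_superset:
  assumes "finite K" "finite L" "Poly_Mapping.keys (ext_coeffs s) \<subseteq> K"
    and "\<And>A. Poly_Mapping.keys (scoeff s A) \<subseteq> L"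
  shows "ssubst \<beta> \<phi> s = (\<Sum>A\<in>K. \<Sum>m\<in>L. sconst (Poly_Mapping.lookup (scoeff s A) m) * bos_value \<beta> m * fer_value \<phi> A)"
proof -
  have in1: "(\<Sum>m\<in>Poly_Mapping.keys (scoeff s A). sconst (Poly_Mapping.lookup (scoeff s A) m) * bos_value \<beta> m * fer_value \<phi> A)
    = (\<Sum>m\<in>L. sconst (Poly_Mapping.lookup (scoeff s A) m) * bos_value \<beta> m * fer_value \<phi> A)" for A
    by (rule sum.mono_neutral_left) (use assms in \<open>auto simp: in_keys_iff sconst_hom\<close>)
  show ?thesis
    unfolding ssubst_def bos_value_def[symmetric] fer_value_def[symmetric] in1
    by (rule sum.mono_neutral_left) (use assms in \<open>auto simp: in_keys_iff sconst_hom\<close>)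
qed

lemma ssubst_add: "ssubst \<beta> \<phi> (s + t) = ssubst \<beta> \<phi> s + ssubst \<beta> \<phi> t"
proof -
  define K where "K = Poly_Mapping.keys (ext_coeffs s) \<union> Poly_Mapping.keys (ext_coeffs t)"
  define L where "L = (\<Union>A\<in>K. Poly_Mapping.keys (scoeff s A) \<union> Poly_Mapping.keys (scoeff t A))"
  have fin: "finite K" "finite L" by (auto simp: K_def L_def)
  have s: "Poly_Mapping.keys (scoeff s A) \<subseteq> L" and t: "Poly_Mapping.keys (scoeff t A) \<subseteq> L" for A
  proof -
    have "A \<in> K" if "scoeff s A \<noteq> 0 \<or> scoeff t A \<noteq> 0" using that by (auto simp: K_def in_keys_iff)
    then show "Poly_Mapping.keys (scoeff s A) \<subseteq> L" "Poly_Mapping.keys (scoeff t A) \<subseteq> L"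
      unfolding L_def by (cases "A \<in> K"; force)+
  qed
  have st: "Poly_Mapping.keys (scoeff (s + t) A) \<subseteq> L" for A
    using keys_add[of "scoeff s A" "scoeff t A"] s[of A] t[of A] by auto
  have stK: "Poly_Mapping.keys (ext_coeffs (s + t)) \<subseteq> K"
    unfolding plus_ext.rep_eq using keys_add[of "ext_coeffs s" "ext_coeffs t"] by (auto simp: K_def)
  show ?thesis
    by (subst (1 2 3) ssubst_superset[OF fin])
      (use s t st stK in \<open>auto simp: K_def lookup_add sconst_hom distrib_right sum.distrib\<close>)
qed

lemma ssubst_zero: "ssubst \<beta> \<phi> 0 = 0"
  using ssubst_add[of \<beta> \<phi> 0 0] by simp

lemma ssubst_smono: "ssubst \<beta> \<phi> (smono c A m) = sconst c * bos_value \<beta> m * fer_value \<phi> A"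
proof -
  have "Poly_Mapping.keys (ext_coeffs (smono c A m)) \<subseteq> {A}" by (auto simp: in_keys_iff scoeff_smono split: if_splits)
  moreover have "Poly_Mapping.keys (scoeff (smono c A m) B) \<subseteq> {m}" for B by (auto simp: scoeff_smono)
  ultimately show ?thesis
    using ssubst_superset[of "{A}" "{m}" "smono c A m" \<beta> \<phi>] by (simp add: scoeff_smono)
qed

lemma ssubst_sconst_mult: "ssubst \<beta> \<phi> (sconst c * s) = sconst c * ssubst \<beta> \<phi> s"
  by (induction s rule: spoly_induct)
    (simp_all add: ssubst_zero distrib_left ssubst_add sconst_smono ssubst_smono sconst_hom mult.assoc)

lemma ssubst_sconst: "ssubst \<beta> \<phi> (sconst c) = sconst c"
  using ssubst_smono[of \<beta> \<phi> c "{||}" 0]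
  by (simp add: smono_one bos_value_def fer_value_def sorted_list_of_fset.rep_eq)

text \<open>This permits setting the substituted values to \<open>0\<close> out of range, where the formula in the definition of the
action yields unspecified matrix entries.\<close>

lemma ssubst_cong:
  assumes "s \<in> spolys e f n"
    and "\<And>v. vidx v < e \<Longrightarrow> vrow v < n \<Longrightarrow> vcol v < n \<Longrightarrow> \<beta> v = \<beta>' v"
    and "\<And>v. vidx v < f \<Longrightarrow> vrow v < n \<Longrightarrow> vcol v < n \<Longrightarrow> \<phi> v = \<phi>' v"
  shows "ssubst \<beta> \<phi> s = ssubst \<beta>' \<phi>' s"
  unfolding ssubst_def
proof (intro sum.cong HOL.refl)
  fix A m assume A: "A \<in> Poly_Mapping.keys (ext_coeffs s)" and m: "m \<in> Poly_Mapping.keys (scoeff s A)"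
  then have r: "\<And>v. v |\<in>| A \<Longrightarrow> vidx v < f \<and> vrow v < n \<and> vcol v < n"
    "\<And>v. v \<in> Poly_Mapping.keys m \<Longrightarrow> vidx v < e \<and> vrow v < n \<and> vcol v < n"
    using assms(1) unfolding spolys_def by (auto simp: in_keys_iff)
  have "map (\<lambda>v. \<beta> v ^ Poly_Mapping.lookup m v) (sorted_list_of_set (Poly_Mapping.keys m)) =
     map (\<lambda>v. \<beta>' v ^ Poly_Mapping.lookup m v) (sorted_list_of_set (Poly_Mapping.keys m))"
    using r assms(2) by (intro map_cong HOL.refl) auto
  moreover have "map \<phi> (sorted_list_of_fset A) = map \<phi>' (sorted_list_of_fset A)"
    using r assms(3) by (intro map_cong HOL.refl) (auto simp: sorted_list_of_fset.rep_eq)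
  ultimately show "sconst (Poly_Mapping.lookup (scoeff s A) m) *
     prod_list (map (\<lambda>v. \<beta> v ^ Poly_Mapping.lookup m v) (sorted_list_of_set (Poly_Mapping.keys m))) *
     prod_list (map \<phi> (sorted_list_of_fset A)) = sconst (Poly_Mapping.lookup (scoeff s A) m) *
     prod_list (map (\<lambda>v. \<beta>' v ^ Poly_Mapping.lookup m v) (sorted_list_of_set (Poly_Mapping.keys m))) *
     prod_list (map \<phi>' (sorted_list_of_fset A))" by (simp only:)
qed

text \<open>Supercommutativity gives \<open>s * s = - (s * s)\<close>, and \<open>2\<close> is invertible.\<close>

lemma odd_square_zero:
  assumes "s \<in> part (S_alg e f n) 1"
  shows "s * s = 0"
proof -
  have "s * s = sconst (-1) * (s * s)" using S_alg_supercomm[OF assms assms] by simp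
  then have "s * s + s * s = 0" by (simp add: sconst_hom eq_neg_iff_add_eq_0)
  then have "sconst (1/2) * (s * s + s * s) = 0" by simp
  moreover have "sconst (1/2) * (s * s + s * s) = (sconst (1/2) + sconst (1/2)) * (s * s)"
    by (simp only: distrib_left distrib_right)
  moreover have "sconst (1/2) + sconst (1/2) = 1"
    unfolding sconst_hom(3)[symmetric] by (simp add: sconst_hom(2))
  ultimately show ?thesis by simp
qed

context
  fixes \<beta> \<phi> :: "svar \<Rightarrow> spoly" and e f n :: nat
  assumes even: "\<And>v. \<beta> v \<in> part (S_alg e f n) 0" and odd: "\<And>v. \<phi> v \<in> part (S_alg e f n) 1"
begin

lemma even_values_commute: "\<beta> v * \<beta> w = \<beta> w * \<beta> v"
  using S_alg_supercomm[OF even even, of v w] by (simp add: sconst_hom)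

lemma odd_values_anticommute: "\<phi> v * \<phi> w = - (\<phi> w * \<phi> v)"
  using S_alg_supercomm[OF odd odd, of v w] by (simp add: sconst_hom)

lemma bos_value_add_single: "bos_value \<beta> (m + Poly_Mapping.single v 1) = \<beta> v * bos_value \<beta> m"
proof -
  let ?K = "Poly_Mapping.keys m - {v}"
  let ?h = "\<lambda>m v. \<beta> v ^ Poly_Mapping.lookup m v"
  let ?m' = "m + Poly_Mapping.single v 1"
  have comm: "?h m' y * ?h m' x = ?h m' x * ?h m' y" for m' x y
    by (rule power_commuting_commutes) (rule power_commuting_commutes[symmetric], rule even_values_commute)
  have ins: "prod_list (map (?h m') (sorted_list_of_set (insert v ?K)))
      = ?h m' v * prod_list (map (?h m') (sorted_list_of_set ?K))" for m'
    by (rule prod_list_sorted_insert_central) (use comm in auto)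
  have k': "Poly_Mapping.keys ?m' = insert v ?K"
    by (auto simp: in_keys_iff lookup_add lookup_single when_def split: if_splits)
  have same: "prod_list (map (?h ?m') (sorted_list_of_set ?K)) = prod_list (map (?h m) (sorted_list_of_set ?K))"
    by (rule arg_cong[where f = prod_list], rule map_cong) (auto simp: lookup_add lookup_single when_def)
  have m: "bos_value \<beta> m = ?h m v * prod_list (map (?h m) (sorted_list_of_set ?K))"
  proof (cases "v \<in> Poly_Mapping.keys m")
    case True
    then have "insert v ?K = Poly_Mapping.keys m" by auto
    then show ?thesis using ins[of m] by (simp add: bos_value_def)
  next
    case False
    then have "?K = Poly_Mapping.keys m" by auto
    with False show ?thesis by (simp add: bos_value_def in_keys_iff)
  qed
  show ?thesis
    unfolding m bos_value_def[of _ ?m'] k' ins same by (simp add: lookup_add mult.assoc)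
qed

lemma fer_value_finsert:
  "\<phi> v * fer_value \<phi> A = (if v |\<in>| A then 0 else sconst ((-1) ^ card {a. a |\<in>| A \<and> a < v}) * fer_value \<phi> (finsert v A))"
proof (cases "v |\<in>| A")
  case True
  then show ?thesis unfolding fer_value_def
    by (simp, intro prod_list_anticommuting_repeated odd_values_anticommute odd_square_zero[OF odd])
      (auto simp: sorted_list_of_fset.rep_eq)
next
  case False
  have "\<phi> v * fer_value \<phi> A = (-1) ^ length (filter (\<lambda>y. y < v) (sorted_list_of_fset A)) *
     prod_list (map \<phi> (insort v (sorted_list_of_fset A)))"
    unfolding fer_value_def
    by (rule prod_list_insort_anticommuting[OF _ _ odd_values_anticommute]) (use False in \<open>auto simp: sorted_list_of_fset.rep_eq\<close>)
  also have "insort v (sorted_list_of_fset A) = sorted_list_of_fset (finsert v A)"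
    using False by (simp add: sorted_list_of_fset.rep_eq)
  also have "length (filter (\<lambda>y. y < v) (sorted_list_of_fset A)) = card {a. a |\<in>| A \<and> a < v}"
  proof -
    have "distinct (filter (\<lambda>y. y < v) (sorted_list_of_fset A))"
      by (simp add: sorted_list_of_fset.rep_eq)
    from distinct_card[OF this] show ?thesis by (simp add: sorted_list_of_fset.rep_eq)
  qed
  finally show ?thesis using False
    by (simp add: fer_value_def minus_one_power_iff sconst_hom)
qed

lemma ssubst_bos_mult: "ssubst \<beta> \<phi> (bos v * s) = \<beta> v * ssubst \<beta> \<phi> s"
proof (induction s rule: spoly_induct)
  case (mono c A m)
  then show ?case
    unfolding bos_smono ssubst_smono bos_value_add_single by (simp add: mult.assoc sconst_left_commute)
qed (simp_all add: ssubst_zero ssubst_add distrib_left)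

lemma bos_value_even: "bos_value \<beta> m \<in> part (S_alg e f n) 0"
proof -
  have "\<beta> v ^ k \<in> part (S_alg e f n) 0" for v k
    by (induction k) (use part_S_alg_mult[OF even, of _ 0] in \<open>auto simp: part_S_alg_closed\<close>)
  then have "prod_list (map (\<lambda>v. \<beta> v ^ Poly_Mapping.lookup m v) xs) \<in> part (S_alg e f n) 0" for xs
    by (induction xs) (use part_S_alg_mult[of _ e f n 0 _ 0] in \<open>auto simp: part_S_alg_closed\<close>)
  then show ?thesis by (simp add: bos_value_def)
qed

lemma ssubst_fer_mult: "ssubst \<beta> \<phi> (fer v * s) = \<phi> v * ssubst \<beta> \<phi> s"
proof (induction s rule: spoly_induct)
  case (mono c A m)
  have "\<phi> v * bos_value \<beta> m = bos_value \<beta> m * \<phi> v"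
    using S_alg_supercomm[OF odd bos_value_even, of v m] by (simp add: sconst_hom)
  then have vb: "\<phi> v * (bos_value \<beta> m * t) = bos_value \<beta> m * (\<phi> v * t)" for t
    by (simp only: mult.assoc[symmetric])
  have "\<phi> v * ssubst \<beta> \<phi> (smono c A m) = sconst c * (bos_value \<beta> m * (\<phi> v * fer_value \<phi> A))"
    unfolding ssubst_smono mult.assoc sconst_left_commute[of "\<phi> v"] vb ..
  also have "\<dots> = ssubst \<beta> \<phi> (fer v * smono c A m)"
  proof (cases "v |\<in>| A")
    case False
    then show ?thesis
      by (simp add: fer_smono fer_value_finsert ssubst_smono sconst_left_commute[of "bos_value \<beta> m"] mult.commute[of _ c] sconst_hom(4) mult.assoc)
  qed (simp add: fer_smono fer_value_finsert ssubst_zero)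
  finally show ?case ..
qed (simp_all add: ssubst_zero ssubst_add distrib_left)

end

section \<open>Words in the entries of the generic matrices\<close>

definition ent :: "nat \<Rightarrow> gvar \<times> nat \<times> nat \<Rightarrow> spoly" where
  "ent n = (\<lambda>(v, h, k). gen_mat n v $$ (h, k))"

definition ents :: "nat \<Rightarrow> nat \<Rightarrow> nat \<Rightarrow> (gvar \<times> nat \<times> nat) set" where
  "ents e f n = gvars e f \<times> {..<n} \<times> {..<n}"

lemma ent_bos: "i < e \<Longrightarrow> h < n \<Longrightarrow> k < n \<Longrightarrow> \<exists>x\<in>ents e f n. ent n x = bos (SVar i h k)"
  by (intro bexI[of _ "(Bos i, h, k)"]) (auto simp: ent_def ents_def gvars_def)

lemma ent_fer: "i < f \<Longrightarrow> h < n \<Longrightarrow> k < n \<Longrightarrow> \<exists>x\<in>ents e f n. ent n x = fer (SVar i h k)"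
  by (intro bexI[of _ "(Fer i, h, k)"]) (auto simp: ent_def ents_def gvars_def)

lemma bos_monomial_word:
  assumes "\<And>v. v \<in> Poly_Mapping.keys m \<Longrightarrow> vidx v < e \<and> vrow v < n \<and> vcol v < n"
  shows "\<exists>u\<in>lists (ents e f n). smono 1 {||} m = prod_list (map (ent n) u)"
  using assms
proof (induction "sum (Poly_Mapping.lookup m) (Poly_Mapping.keys m)" arbitrary: m)
  case 0
  then have "\<forall>v\<in>Poly_Mapping.keys m. Poly_Mapping.lookup m v = 0" by simp
  then have "m = 0" by (intro poly_mapping_eqI) (auto simp: in_keys_iff)
  then show ?case by (intro bexI[of _ "[]"]) (auto simp: smono_one sconst_hom)
next
  case (Suc d)
  then obtain v where v: "v \<in> Poly_Mapping.keys m" by (metis Zero_not_Suc ex_in_conv sum.empty)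
  define m' where "m' = m - Poly_Mapping.single v 1"
  have m: "m = m' + Poly_Mapping.single v 1"
    using v by (intro poly_mapping_eqI) (auto simp: m'_def lookup_add lookup_minus lookup_single when_def in_keys_iff)
  have keys: "Poly_Mapping.keys m' \<subseteq> Poly_Mapping.keys m"
    by (auto simp: m in_keys_iff lookup_add)
  have "sum (Poly_Mapping.lookup m) (Poly_Mapping.keys m) =
     (\<Sum>w\<in>Poly_Mapping.keys m. Poly_Mapping.lookup m' w) + (\<Sum>w\<in>Poly_Mapping.keys m. if w = v then 1 else 0)"
    unfolding sum.distrib[symmetric]
    by (rule sum.cong) (auto simp: m lookup_add lookup_single when_def)
  also have "(\<Sum>w\<in>Poly_Mapping.keys m. Poly_Mapping.lookup m' w) = sum (Poly_Mapping.lookup m') (Poly_Mapping.keys m')"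
    by (rule sum.mono_neutral_right) (use keys in \<open>auto simp: in_keys_iff\<close>)
  finally have "d = sum (Poly_Mapping.lookup m') (Poly_Mapping.keys m')" using Suc.hyps(2) v by simp
  from Suc.hyps(1)[OF this] keys Suc.prems obtain u where
    u: "u \<in> lists (ents e f n)" "smono 1 {||} m' = prod_list (map (ent n) u)" by blast
  obtain x where x: "x \<in> ents e f n" "ent n x = bos v"
    using ent_bos[of "vidx v" e "vrow v" n "vcol v" f] Suc.prems[OF v] by auto
  have "smono 1 {||} m = bos v * smono 1 {||} m'"
    unfolding m by (rule bos_smono[symmetric])
  then show ?case
    by (intro bexI[of _ "x # u"]) (use u x in auto)
qed

lemma monomial_word:
  assumes "A \<in> fsets f n" "\<And>v. v \<in> Poly_Mapping.keys m \<Longrightarrow> vidx v < e \<and> vrow v < n \<and> vcol v < n"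
  shows "\<exists>a. \<exists>u\<in>lists (ents e f n). smono 1 A m = sconst a * prod_list (map (ent n) u)"
  using assms(1)
proof (induction A rule: fset_induct_stronger)
  case empty
  obtain u where "u \<in> lists (ents e f n)" "smono 1 {||} m = prod_list (map (ent n) u)"
    using bos_monomial_word[of m e n f] assms(2) by blast
  then show ?case by (intro exI[of _ 1] bexI[of _ u]) (simp_all add: sconst_hom)
next
  case (insert v A)
  then obtain a u where u: "u \<in> lists (ents e f n)" "smono 1 A m = sconst a * prod_list (map (ent n) u)"
    by (auto simp: fsets_def)
  obtain x where x: "x \<in> ents e f n" "ent n x = fer v"
    using ent_fer[of "vidx v" f "vrow v" n "vcol v" e] insert.prems by (auto simp: fsets_def)
  define \<sigma> :: complex where "\<sigma> = (-1) ^ card {a. a |\<in>| A \<and> a < v}"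
  have \<sigma>: "\<sigma> * \<sigma> = 1" by (simp add: \<sigma>_def minus_one_power_iff)
  have "fer v * smono 1 A m = smono \<sigma> (finsert v A) m"
    using \<open>v |\<notin>| A\<close> fer_smono[of v 1 A m] by (simp add: \<sigma>_def)
  then have "smono 1 (finsert v A) m = sconst \<sigma> * (fer v * smono 1 A m)" by (simp add: sconst_smono \<sigma>)
  also have "\<dots> = sconst (\<sigma> * a) * (fer v * prod_list (map (ent n) u))"
    by (simp add: u sconst_hom(4) sconst_left_commute[of "fer v"] mult.assoc)
  finally show ?case
    using x u by (intro exI[of _ "\<sigma> * a"] bexI[of _ "x # u"]) auto
qed

text \<open>The elements of \<open>S\<close> are the linear combinations of products of entries of generic matrices, in any order. This is
the form in which generators are used: for equality of homomorphisms and for writing elements as contractions.\<close>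

lemma spolys_word_induct [consumes 1, case_names zero add word]:
  assumes "s \<in> spolys e f n"
    and "P 0" "\<And>s t. P s \<Longrightarrow> P t \<Longrightarrow> P (s + t)"
    and "\<And>a u. u \<in> lists (ents e f n) \<Longrightarrow> P (sconst a * prod_list (map (ent n) u))"
  shows "P s"
proof -
  have sumI: "(\<And>x. x \<in> I \<Longrightarrow> P (h x)) \<Longrightarrow> P (sum h I)" for h and I :: "'x set"
    by (induction I rule: infinite_finite_induct) (auto intro: assms)
  show ?thesis
  proof (subst spoly_sum_smono, intro sumI)
    fix A m assume A: "A \<in> Poly_Mapping.keys (ext_coeffs s)" and m: "m \<in> Poly_Mapping.keys (scoeff s A)"
    then have "A \<in> fsets f n" "\<And>v. v \<in> Poly_Mapping.keys m \<Longrightarrow> vidx v < e \<and> vrow v < n \<and> vcol v < n"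
      using assms(1) unfolding spolys_def fsets_def by (auto simp: in_keys_iff)
    from monomial_word[OF this] obtain a u where
      u: "u \<in> lists (ents e f n)" "smono 1 A m = sconst a * prod_list (map (ent n) u)" by blast
    let ?c = "Poly_Mapping.lookup (scoeff s A) m"
    have "smono ?c A m = sconst ?c * smono 1 A m" by (simp add: sconst_smono)
    also have "\<dots> = sconst (?c * a) * prod_list (map (ent n) u)" by (simp add: u sconst_hom(4) mult.assoc)
    finally show "P (smono ?c A m)" using assms(4)[OF u(1)] by simp
  qed
qed

lemma prod_list_spolys: "(\<And>x. x \<in> set xs \<Longrightarrow> x \<in> spolys e f n) \<Longrightarrow> prod_list xs \<in> spolys e f n"
  by (induction xs) (auto intro: spolys_closed)

lemma sconst_spolys: "sconst c \<in> spolys e f n"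
  using spolys_closed(6)[OF spolys_closed(2), of c e f n] by simp

lemma ent_spolys: "x \<in> ents e f n \<Longrightarrow> ent n x \<in> spolys e f n"
  using gen_mat_part by (fastforce simp: ents_def ent_def part_M_alg part_S_alg)

lemma cmat_part: "g \<in> carrier_mat n n \<Longrightarrow> cmat g \<in> part (M_alg e f n) 0"
  using part_S_alg_closed(4)[OF part_S_alg_closed(2)] by (auto simp: part_M_alg)

section \<open>Linear substitutions of the generic matrices\<close>

locale spoly_hom =
  fixes F :: "spoly \<Rightarrow> spoly" and e f n :: nat
  assumes add: "s \<in> spolys e f n \<Longrightarrow> t \<in> spolys e f n \<Longrightarrow> F (s + t) = F s + F t"
    and mult: "s \<in> spolys e f n \<Longrightarrow> t \<in> spolys e f n \<Longrightarrow> F (s * t) = F s * F t"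
    and const: "F (sconst c) = sconst c"
    and closed: "s \<in> spolys e f n \<Longrightarrow> F s \<in> spolys e f n"
begin

lemma zero: "F 0 = 0" using const[of 0] by (simp add: sconst_hom)

lemma one: "F 1 = 1" using const[of 1] by (simp add: sconst_hom)

lemma sum: "(\<And>x. x \<in> I \<Longrightarrow> h x \<in> spolys e f n) \<Longrightarrow> F (sum h I) = (\<Sum>x\<in>I. F (h x))"
  by (induction I rule: infinite_finite_induct) (auto simp: zero add spolys_sum)

lemma prod_list: "(\<And>x. x \<in> set xs \<Longrightarrow> x \<in> spolys e f n) \<Longrightarrow> F (prod_list xs) = prod_list (map F xs)"
  by (induction xs) (auto simp: one mult prod_list_spolys)

lemma sconst_mult: "s \<in> spolys e f n \<Longrightarrow> F (sconst c * s) = sconst c * F s"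
  by (simp add: mult sconst_spolys const)

lemma mat_mult:
  assumes "A \<in> carrier (M_alg e f n)" "B \<in> carrier (M_alg e f n)"
  shows "map_mat F (A * B) = map_mat F A * map_mat F B"
proof (rule eq_matI)
  fix i j assume "i < dim_row (map_mat F A * map_mat F B)" "j < dim_col (map_mat F A * map_mat F B)"
  then have ij: "i < n" "j < n" using assms by (auto simp: carrier_M_alg)
  have c: "A \<in> carrier_mat n n" "B \<in> carrier_mat n n" using assms by (auto simp: carrier_M_alg)
  have "map_mat F (A * B) $$ (i, j) = F (\<Sum>k<n. A $$ (i, k) * B $$ (k, j))"
    using c ij by (simp add: mat_mult_entry[OF c ij] del: index_mult_mat(1))
  also have "\<dots> = (\<Sum>k<n. F (A $$ (i, k)) * F (B $$ (k, j)))"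
    using assms ij by (subst sum) (auto simp: carrier_M_alg spolys_closed mult)
  also have "\<dots> = (map_mat F A * map_mat F B) $$ (i, j)"
    using c ij by (subst mat_mult_entry[of _ n]) auto
  finally show "map_mat F (A * B) $$ (i, j) = (map_mat F A * map_mat F B) $$ (i, j)" .
qed (use assms in \<open>auto simp: carrier_M_alg\<close>)

lemma map_cmat: "map_mat F (cmat g) = cmat g"
  by (rule eq_matI) (auto simp: const)

end

lemma spoly_hom_comp:
  assumes "spoly_hom F e f n" "spoly_hom F' e f n"
  shows "spoly_hom (\<lambda>s. F (F' s)) e f n"
  using assms unfolding spoly_hom_def by simp

lemma spoly_hom_eq:
  assumes F: "spoly_hom F e f n" and F': "spoly_hom F' e f n"
    and eq: "\<And>v. v \<in> gvars e f \<Longrightarrow> map_mat F (gen_mat n v) = map_mat F' (gen_mat n v)"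
    and s: "s \<in> spolys e f n"
  shows "F s = F' s"
proof -
  interpret F: spoly_hom F e f n by (rule F)
  interpret F': spoly_hom F' e f n by (rule F')
  have ent: "F (ent n x) = F' (ent n x)" if x: "x \<in> ents e f n" for x
  proof -
    obtain v h k where x': "x = (v, h, k)" "v \<in> gvars e f" "h < n" "k < n"
      using x by (auto simp: ents_def)
    have "gen_mat n v \<in> carrier_mat n n" by (cases v) auto
    then show ?thesis using arg_cong[OF eq[OF x'(2)], of "\<lambda>M. M $$ (h, k)"] x' by (simp add: ent_def)
  qed
  have "s \<in> spolys e f n \<and> F s = F' s" using s
  proof (induction rule: spolys_word_induct)
    case zero
    then show ?case by (simp add: F.zero F'.zero spolys_closed)
  next
    case (add s t)
    then show ?case by (simp add: F.add F'.add spolys_closed)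
  next
    case (word a u)
    then have u: "set (map (ent n) u) \<subseteq> spolys e f n" using ent_spolys by auto
    then have "prod_list (map (ent n) u) \<in> spolys e f n" by (intro prod_list_spolys) auto
    moreover have "map F (map (ent n) u) = map F' (map (ent n) u)"
      using word by (auto simp: ent in_lists_conv_set)
    moreover have "F (prod_list (map (ent n) u)) = prod_list (map F (map (ent n) u))"
      by (rule F.prod_list) (use u in auto)
    moreover have "F' (prod_list (map (ent n) u)) = prod_list (map F' (map (ent n) u))"
      by (rule F'.prod_list) (use u in auto)
    ultimately have "F (prod_list (map (ent n) u)) = F' (prod_list (map (ent n) u))" by (simp only:)
    with \<open>prod_list (map (ent n) u) \<in> spolys e f n\<close> show ?case
      by (simp add: F.sconst_mult F'.sconst_mult spolys_closed)
  qed
  then show ?thesis by simp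
qed

context
  fixes \<beta> \<phi> :: "svar \<Rightarrow> spoly" and e f n :: nat
  assumes even: "\<And>v. \<beta> v \<in> part (S_alg e f n) 0" and odd: "\<And>v. \<phi> v \<in> part (S_alg e f n) 1"
begin

lemma ssubst_closed: "ssubst \<beta> \<phi> s \<in> spolys e f n"
proof (induction s rule: spoly_induct)
  case (mono c A m)
  have "bos_value \<beta> m \<in> spolys e f n" using bos_value_even[OF even odd] by (simp add: part_S_alg)
  moreover have "fer_value \<phi> A \<in> spolys e f n"
    unfolding fer_value_def by (rule prod_list_spolys) (use odd in \<open>auto simp: part_S_alg\<close>)
  ultimately show ?case by (simp add: ssubst_smono spolys_closed)
qed (auto simp: ssubst_zero ssubst_add spolys_closed)

lemma ssubst_ent_mult:
  assumes "x \<in> ents e' f' n'"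
  shows "ssubst \<beta> \<phi> (ent n' x * t) = ssubst \<beta> \<phi> (ent n' x) * ssubst \<beta> \<phi> t"
proof -
  obtain v h k where x: "x = (v, h, k)" "h < n'" "k < n'" using assms by (auto simp: ents_def)
  show ?thesis
    by (cases v) (simp_all add: x ent_def ssubst_gen ssubst_bos_mult[OF even odd] ssubst_fer_mult[OF even odd])
qed

text \<open>Multiplicativity needs to be checked only for a first factor that is an entry of a generic matrix, where it is
\<open>ssubst_bos_mult\<close> or \<open>ssubst_fer_mult\<close>.\<close>

lemma ssubst_mult:
  assumes "s \<in> spolys e' f' n'"
  shows "ssubst \<beta> \<phi> (s * t) = ssubst \<beta> \<phi> s * ssubst \<beta> \<phi> t"
  using assms
proof (induction rule: spolys_word_induct)
  case zero
  then show ?case by (simp add: ssubst_zero)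
next
  case (add s t)
  then show ?case by (simp add: distrib_right ssubst_add)
next
  case (word a u)
  have "ssubst \<beta> \<phi> (prod_list (map (ent n') u) * t) = ssubst \<beta> \<phi> (prod_list (map (ent n') u)) * ssubst \<beta> \<phi> t"
    using word
  proof (induction u)
    case Nil
    then show ?case using ssubst_sconst[of \<beta> \<phi> 1] by (simp add: sconst_hom)
  next
    case (Cons x u)
    then have "x \<in> ents e' f' n'" by simp
    then show ?case using Cons by (simp add: mult.assoc ssubst_ent_mult)
  qed
  then show ?case by (simp add: mult.assoc ssubst_sconst_mult)
qed

end

text \<open>The substitution that replaces every generic matrix \<open>x\<close> by \<open>g x h\<close>. The group acts through \<open>h = g\<close> and the inverse on
the left; the one-sided substitutions make sense for singular matrices too and are polynomial in \<open>g\<close>.\<close>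

definition msub :: "nat \<Rightarrow> complex mat \<Rightarrow> complex mat \<Rightarrow> spoly \<Rightarrow> spoly" where
  "msub n g h = ssubst
     (\<lambda>v. (cmat g * gen_mat n (Bos (vidx v)) * cmat h) $$ (vrow v, vcol v))
     (\<lambda>v. (cmat g * gen_mat n (Fer (vidx v)) * cmat h) $$ (vrow v, vcol v))"

lemma act_eq_msub: "act n g = msub n (inv\<^bsub>GL n\<^esub> g) g"
  by (simp add: act_def msub_def)

lemma gen_mat_carrier: "gen_mat n v \<in> carrier_mat n n"
  by (cases v) auto

lemma spoly_hom_msub:
  assumes g: "g \<in> carrier_mat n n" and h: "h \<in> carrier_mat n n"
  shows "spoly_hom (msub n g h) e f n"
proof -
  let ?M = "\<lambda>v. cmat g * gen_mat n v * cmat h"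
  have M: "?M v \<in> part (M_alg e f n) (gdeg v)" if "v \<in> gvars e f" for v
    using part_M_alg_mult[OF part_M_alg_mult[OF cmat_part[OF g] gen_mat_part[OF that]] cmat_part[OF h]] by (cases v) simp_all
  \<comment> \<open>Cutting off the values out of range makes them homogeneous everywhere.\<close>
  define \<beta> where "\<beta> v = (if vidx v < e \<and> vrow v < n \<and> vcol v < n then ?M (Bos (vidx v)) $$ (vrow v, vcol v) else 0)" for v
  define \<phi> where "\<phi> v = (if vidx v < f \<and> vrow v < n \<and> vcol v < n then ?M (Fer (vidx v)) $$ (vrow v, vcol v) else 0)" for v
  have even: "\<beta> v \<in> part (S_alg e f n) 0" for v
    using M[of "Bos (vidx v)"] by (auto simp: \<beta>_def gvars_def part_M_alg part_S_alg_closed)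
  have odd: "\<phi> v \<in> part (S_alg e f n) 1" for v
    using M[of "Fer (vidx v)"] by (auto simp: \<phi>_def gvars_def part_M_alg part_S_alg_closed)
  have eq: "msub n g h s = ssubst \<beta> \<phi> s" if "s \<in> spolys e f n" for s
    unfolding msub_def by (rule ssubst_cong[OF that]) (auto simp: \<beta>_def \<phi>_def)
  show ?thesis
    by unfold_locales
      (auto simp: eq spolys_closed ssubst_add ssubst_mult[OF even odd] ssubst_closed[OF even odd]
         sconst_spolys ssubst_sconst)
qed

lemma msub_gen_mat:
  assumes "g \<in> carrier_mat n n" "h \<in> carrier_mat n n"
  shows "map_mat (msub n g h) (gen_mat n v) = cmat g * gen_mat n v * cmat h"
  using assms
  by (cases v) (auto simp: msub_def ssubst_gen simp del: index_mult_mat(1) intro!: eq_matI)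

lemma cmat_mult: 
  assumes "A \<in> carrier_mat n n" "B \<in> carrier_mat n n"
  shows "cmat (A * B) = cmat A * cmat B"
proof -
  have sc: "sconst (sum h I) = (\<Sum>x\<in>I. sconst (h x))" for h :: "nat \<Rightarrow> complex" and I
    by (induction I rule: infinite_finite_induct) (auto simp: sconst_hom)
  show ?thesis
    by (rule eq_matI) (use assms in \<open>auto simp: scalar_prod_def sc sconst_hom(4)\<close>)
qed

lemma cmat_one: "cmat (1\<^sub>m n) = 1\<^sub>m n"
  by (rule eq_matI) (auto simp: sconst_hom)

lemma M_alg_mult_closed: "A \<in> carrier (M_alg e f n) \<Longrightarrow> B \<in> carrier (M_alg e f n) \<Longrightarrow> A * B \<in> carrier (M_alg e f n)"
  using ring.ring_simprules(5)[of "M_alg e f n" A B] trace_superalgebra_M_alg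
  by (simp add: trace_superalgebra_def superalgebra_def)

lemma cmat_M_alg: "g \<in> carrier_mat n n \<Longrightarrow> cmat g \<in> carrier (M_alg e f n)"
  using cmat_part[of g n e f] by (auto simp: part_M_alg carrier_M_alg part_S_alg)

lemma gen_mat_M_alg: "v \<in> gvars e f \<Longrightarrow> gen_mat n v \<in> carrier (M_alg e f n)"
  using gen_mat_part[of v e f n] by (auto simp: part_M_alg carrier_M_alg part_S_alg)

text \<open>The composition of substitutions reverses the order on the left: \<open>g' x h'\<close> becomes \<open>g' (g x h) h'\<close>.\<close>

lemma msub_msub:
  assumes c: "g \<in> carrier_mat n n" "h \<in> carrier_mat n n" "g' \<in> carrier_mat n n" "h' \<in> carrier_mat n n"
    and s: "s \<in> spolys e f n"
  shows "msub n g h (msub n g' h' s) = msub n (g' * g) (h * h') s"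
proof (rule spoly_hom_eq[OF spoly_hom_comp[OF spoly_hom_msub[OF c(1,2)] spoly_hom_msub[OF c(3,4)]] spoly_hom_msub _ s])
  fix v assume v: "v \<in> gvars e f"
  interpret spoly_hom "msub n g h" e f n by (rule spoly_hom_msub[OF c(1,2)])
  let ?X = "gen_mat n v"
  have X: "?X \<in> carrier_mat n n" by (rule gen_mat_carrier)
  have "map_mat (\<lambda>s. msub n g h (msub n g' h' s)) ?X = map_mat (msub n g h) (map_mat (msub n g' h') ?X)"
    by (rule eq_matI) auto
  also have "\<dots> = map_mat (msub n g h) (cmat g' * ?X * cmat h')"
    by (simp only: msub_gen_mat[OF c(3,4)])
  also have "\<dots> = cmat g' * (cmat g * ?X * cmat h) * cmat h'"
    using v c by (subst mat_mult mat_mult; simp add: M_alg_mult_closed cmat_M_alg gen_mat_M_alg mat_mult map_cmat msub_gen_mat)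
  also have "\<dots> = cmat (g' * g) * ?X * cmat (h * h')"
    using c X by (simp add: cmat_mult assoc_mult_mat[of _ n n _ n _ n])
  also have "\<dots> = map_mat (msub n (g' * g) (h * h')) ?X"
    using c by (simp add: msub_gen_mat)
  finally show "map_mat (\<lambda>s. msub n g h (msub n g' h' s)) ?X = map_mat (msub n (g' * g) (h * h')) ?X" .
qed (use c in auto)

lemma GL_inverse:
  assumes "g \<in> carrier_mat n n" "g' \<in> carrier_mat n n" "g * g' = 1\<^sub>m n" "g' * g = 1\<^sub>m n"
  shows "g \<in> carrier (GL n)" "inv\<^bsub>GL n\<^esub> g = g'"
proof -
  show g: "g \<in> carrier (GL n)" using assms by (auto simp: GL_def units_of_def Units_def ring_mat_def)
  have g': "g' \<in> carrier (GL n)" using assms by (auto simp: GL_def units_of_def Units_def ring_mat_def)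
  have "g' \<otimes>\<^bsub>GL n\<^esub> g = \<one>\<^bsub>GL n\<^esub>" using assms by (simp add: GL_def units_of_def ring_mat_def)
  then show "inv\<^bsub>GL n\<^esub> g = g'" using g g' by (intro group.inv_equality[OF group_GL])
qed

lemma GL_inv_carrier:
  assumes "g \<in> carrier (GL n)"
  shows "g \<in> carrier_mat n n" "inv\<^bsub>GL n\<^esub> g \<in> carrier_mat n n"
    "g * inv\<^bsub>GL n\<^esub> g = 1\<^sub>m n" "inv\<^bsub>GL n\<^esub> g * g = 1\<^sub>m n"
proof -
  interpret group "GL n" by (rule group_GL)
  show "g \<in> carrier_mat n n" "inv\<^bsub>GL n\<^esub> g \<in> carrier_mat n n" using assms GL_carrier_mat by blast+
  have "g \<otimes>\<^bsub>GL n\<^esub> inv\<^bsub>GL n\<^esub> g = \<one>\<^bsub>GL n\<^esub>" "inv\<^bsub>GL n\<^esub> g \<otimes>\<^bsub>GL n\<^esub> g = \<one>\<^bsub>GL n\<^esub>"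
    using assms by (simp_all add: r_inv l_inv)
  then show "g * inv\<^bsub>GL n\<^esub> g = 1\<^sub>m n" "inv\<^bsub>GL n\<^esub> g * g = 1\<^sub>m n"
    by (simp_all add: GL_def units_of_def ring_mat_def)
qed

text \<open>Equivariance without inverses. Apply the substitution \<open>x \<mapsto> g x\<close> to \<open>g\<^sup>-\<^sup>1 M g = g \<cdot> M\<close>: on the right-hand side,
\<open>g\<^sup>-\<^sup>1 x g\<close> turns into \<open>x g\<close>.\<close>

lemma equivariant_left_right:
  assumes M: "M \<in> M_inv e f n"
    and g: "g \<in> carrier_mat n n" "g' \<in> carrier_mat n n" "g * g' = 1\<^sub>m n" "g' * g = 1\<^sub>m n"
  shows "map_mat (msub n g (1\<^sub>m n)) M * cmat g = cmat g * map_mat (msub n (1\<^sub>m n) g) M"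
proof -
  have Mc: "M \<in> carrier (M_alg e f n)" and inv: "mat_act n g M = M"
    using M GL_inverse(1)[OF g] by (auto simp: M_inv_def)
  have Mm: "M \<in> carrier_mat n n" using Mc by (simp add: carrier_M_alg)
  interpret spoly_hom "msub n g (1\<^sub>m n)" e f n using g by (intro spoly_hom_msub) auto
  define N where "N = map_mat (msub n g' g) M"
  have Nm: "N \<in> carrier_mat n n" using Mm by (simp add: N_def)
  have gg: "cmat g * cmat g' = 1\<^sub>m n" "cmat g' * cmat g = 1\<^sub>m n"
    using g by (simp_all add: cmat_one flip: cmat_mult)
  have MN: "cmat g * N * cmat g' = M"
    using inv by (simp add: mat_act_def act_eq_msub GL_inverse(2)[OF g] N_def)
  have "cmat g' * M * cmat g = cmat g' * (cmat g * N * cmat g') * cmat g" by (simp only: MN)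
  also have "\<dots> = (cmat g' * cmat g) * N * (cmat g' * cmat g)"
    using g Nm by (simp add: assoc_mult_mat[of _ n n _ n _ n])
  also have "\<dots> = N" using Nm by (simp add: gg)
  finally have N: "N = cmat g' * M * cmat g" ..
  have "map_mat (msub n (1\<^sub>m n) g) M = map_mat (msub n g (1\<^sub>m n)) N"
    using Mm Mc g by (auto simp: N_def msub_msub[of g n "1\<^sub>m n" g' g _ e f] carrier_M_alg intro!: eq_matI)
  also have "\<dots> = cmat g' * map_mat (msub n g (1\<^sub>m n)) M * cmat g"
    unfolding N using Mc g by (simp add: mat_mult M_alg_mult_closed cmat_M_alg map_cmat)
  finally have "cmat g * map_mat (msub n (1\<^sub>m n) g) M = cmat g * (cmat g' * map_mat (msub n g (1\<^sub>m n)) M * cmat g)" by simp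
  also have "\<dots> = (cmat g * cmat g') * map_mat (msub n g (1\<^sub>m n)) M * cmat g"
    using g Mm by (simp add: assoc_mult_mat[of _ n n _ n _ n])
  also have "\<dots> = map_mat (msub n g (1\<^sub>m n)) M * cmat g" using g Mm by (simp add: gg)
  finally show ?thesis ..
qed

section \<open>Contraction of tensors with words\<close>

lemma sum_idx_0: "(\<Sum>q\<in>idx n 0. F q) = (\<Sum>a<n. F ((\<lambda>_. undefined)(0 := a)))"
  by (rule sum.reindex_bij_witness[of _ "\<lambda>a. (\<lambda>_. undefined)(0 := a)" "\<lambda>q. q 0"])
    (auto simp: idx_def PiE_def extensional_def fun_eq_iff intro!: arg_cong[where f = F])

lemma sum_idx_Suc: "(\<Sum>q\<in>idx n (Suc d). F q) = (\<Sum>q\<in>idx n d. \<Sum>a<n. F (q(Suc d := a)))"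
  unfolding sum.cartesian_product
  by (rule sum.reindex_bij_witness[of _ "\<lambda>(q, a). q(Suc d := a)" "\<lambda>q. (restrict q {..d}, q (Suc d))"])
    (auto simp: idx_def PiE_def Pi_def extensional_def fun_eq_iff le_Suc_eq restrict_def intro!: arg_cong[where f = F])

lemma prod_list_sum_expand:
  fixes G :: "nat \<Rightarrow> nat \<Rightarrow> 'a::semiring_1"
  assumes "l < n"
  shows "(\<Sum>k\<in>idx n d. of_bool (k 0 = l) * prod_list (map (\<lambda>t. G t (k t)) [1..<Suc d])) =
    prod_list (map (\<lambda>t. \<Sum>a<n. G t a) [1..<Suc d])"
proof (induction d)
  case 0
  then show ?case using assms by (simp add: sum_idx_0)
next
  case (Suc d)
  have up: "[1..<Suc (Suc d)] = [1..<Suc d] @ [Suc d]" by simp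
  have m: "map (\<lambda>t. G t ((k(Suc d := a)) t)) [1..<Suc d] = map (\<lambda>t. G t (k t)) [1..<Suc d]" for k a
    by (rule map_cong) auto
  have "(\<Sum>k\<in>idx n (Suc d). of_bool (k 0 = l) * prod_list (map (\<lambda>t. G t (k t)) [1..<Suc (Suc d)])) =
     (\<Sum>k\<in>idx n d. \<Sum>a<n. (of_bool (k 0 = l) * prod_list (map (\<lambda>t. G t (k t)) [1..<Suc d])) * G (Suc d) a)"
    unfolding sum_idx_Suc up map_append prod_list.append m
    by (simp add: mult.assoc)
  also have "\<dots> = (\<Sum>k\<in>idx n d. of_bool (k 0 = l) * prod_list (map (\<lambda>t. G t (k t)) [1..<Suc d])) * (\<Sum>a<n. G (Suc d) a)"
    by (simp only: sum_product)
  also have "\<dots> = prod_list (map (\<lambda>t. \<Sum>a<n. G t a) [1..<Suc (Suc d)])"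
    unfolding Suc up by simp
  finally show ?case .
qed

lemma prod_list_sconst_mult:
  "prod_list (map (\<lambda>t. sconst (h t) * x t) ts) = sconst (prod_list (map h ts)) * prod_list (map x ts)"
proof (induction ts)
  case (Cons t ts)
  have "sconst (h t) * x t * (sconst a * y) = sconst (h t * a) * (x t * y)" for a y
    by (simp only: sconst_hom(4) mult.assoc sconst_left_commute[of "x t"])
  then show ?case using Cons by simp
qed (simp add: sconst_hom)

lemma kron_prod_list:
  "kron d g p q = g $$ (p 0, q 0) * prod_list (map (\<lambda>t. g $$ (p t, q t)) [1..<Suc d])"
proof -
  have "{..d} = {0..d}" by auto
  then have "kron d g p q = g $$ (p 0, q 0) * (\<Prod>t\<in>{Suc 0..d}. g $$ (p t, q t))"
    unfolding kron_def by (simp add: prod.atLeast_Suc_atMost)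
  also have "{Suc 0..d} = set [1..<Suc d]" by auto
  finally show ?thesis by (simp only: prod.distinct_set_conv_list[OF distinct_upt])
qed

text \<open>A product of matrix entries, one from each matrix of the list. The position \<open>t\<close> of \<open>p\<close> and \<open>q\<close> belongs to the matrix
number \<open>t\<close>, counted from \<open>1\<close>; the position \<open>0\<close> does not occur.\<close>

definition entry_prod :: "spoly mat list \<Rightarrow> (nat \<Rightarrow> nat) \<Rightarrow> (nat \<Rightarrow> nat) \<Rightarrow> spoly" where
  "entry_prod As p q = prod_list (map (\<lambda>t. (As ! (t - 1)) $$ (p t, q t)) [1..<Suc (length As)])"

text \<open>The pairing of the operators \<open>c w\<close> with the words \<open>w \<in> W\<close>. At the position \<open>0\<close>, the row index of \<open>c w\<close> is the column
index of the resulting matrix and conversely, as in \<open>M \<mapsto> tr (M y)\<close> for an additional generic matrix \<open>y\<close>. With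
this convention the contraction of a permutation is built from matrix products.\<close>

definition contract :: "nat \<Rightarrow> gvar list set \<Rightarrow> (gvar list \<Rightarrow> (nat \<Rightarrow> nat) \<Rightarrow> (nat \<Rightarrow> nat) \<Rightarrow> complex) \<Rightarrow>
    nat \<Rightarrow> nat \<Rightarrow> spoly" where
  "contract n W c i j = (\<Sum>w\<in>W. \<Sum>p\<in>idx n (length w). \<Sum>q\<in>idx n (length w).
     of_bool (q 0 = i \<and> p 0 = j) * (sconst (c w p q) * entry_prod (map (gen_mat n) w) p q))"

lemma entry_prod_gen:
  "entry_prod (map (gen_mat n) w) p q = prod_list (map (\<lambda>t. gen_mat n (w ! (t - 1)) $$ (p t, q t)) [1..<Suc (length w)])"
proof -
  have "map (\<lambda>t. (map (gen_mat n) w ! (t - 1)) $$ (p t, q t)) [1..<Suc (length w)] =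
     map (\<lambda>t. gen_mat n (w ! (t - 1)) $$ (p t, q t)) [1..<Suc (length w)]"
    by (rule map_cong) auto
  then show ?thesis by (simp only: entry_prod_def length_map)
qed

lemma gen_entry_spolys: "v \<in> gvars e f \<Longrightarrow> a < n \<Longrightarrow> b < n \<Longrightarrow> gen_mat n v $$ (a, b) \<in> spolys e f n"
  using gen_mat_M_alg[of v e f n] by (simp add: carrier_M_alg)

lemma entry_prod_gen_spolys:
  assumes "set w \<subseteq> gvars e f" "p \<in> idx n (length w)" "q \<in> idx n (length w)"
  shows "entry_prod (map (gen_mat n) w) p q \<in> spolys e f n"
  unfolding entry_prod_gen
  by (rule prod_list_spolys) (use assms in \<open>auto intro!: gen_entry_spolys simp: idx_less subset_iff\<close>)

lemma of_bool_spolys_mult: "s \<in> spolys e f n \<Longrightarrow> of_bool P * s \<in> spolys e f n"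
  by (cases P) (auto simp: spolys_closed)

lemma (in spoly_hom) of_bool_mult: "F (of_bool P * s) = of_bool P * F s"
  by (cases P) (auto simp: zero)

lemma (in spoly_hom) sum_of_bool_sconst:
  assumes "\<And>w p q. w \<in> W \<Longrightarrow> p \<in> I w \<Longrightarrow> q \<in> J w \<Longrightarrow> x w p q \<in> spolys e f n"
  shows "F (\<Sum>w\<in>W. \<Sum>p\<in>I w. \<Sum>q\<in>J w. of_bool (P w p q) * (sconst (c w p q) * x w p q)) =
    (\<Sum>w\<in>W. \<Sum>p\<in>I w. \<Sum>q\<in>J w. of_bool (P w p q) * (sconst (c w p q) * F (x w p q)))"
  using assms
  by (simp add: sum spolys_sum of_bool_spolys_mult spolys_closed(6) of_bool_mult sconst_mult cong: sum.cong)

lemma msub_left_entry_prod: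
  assumes g: "g \<in> carrier_mat n n" and w: "set w \<subseteq> gvars e f"
    and p: "p \<in> idx n (length w)" and q: "q \<in> idx n (length w)" and l: "l < n"
  shows "msub n g (1\<^sub>m n) (entry_prod (map (gen_mat n) w) p q) * sconst (g $$ (p 0, l)) =
    (\<Sum>k\<in>idx n (length w). of_bool (k 0 = l) * (sconst (kron (length w) g p k) * entry_prod (map (gen_mat n) w) k q))"
proof -
  interpret spoly_hom "msub n g (1\<^sub>m n)" e f n using g by (intro spoly_hom_msub) auto
  let ?d = "length w" and ?x = "\<lambda>t. gen_mat n (w ! (t - 1))"
  let ?ts = "[1..<Suc ?d]"
  have c: "?x t \<in> carrier_mat n n" for t by (rule gen_mat_carrier)
  have ent: "msub n g (1\<^sub>m n) (?x t $$ (p t, q t)) = (\<Sum>a<n. sconst (g $$ (p t, a)) * ?x t $$ (a, q t))"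
    if t: "t \<in> set ?ts" for t
  proof -
    have pt: "p t < n" "q t < n" using t p q by (auto intro: idx_less)
    have "msub n g (1\<^sub>m n) (?x t $$ (p t, q t)) = map_mat (msub n g (1\<^sub>m n)) (?x t) $$ (p t, q t)"
      using c[of t] pt by simp
    also have "\<dots> = (cmat g * ?x t) $$ (p t, q t)"
      using g c[of t] by (simp add: msub_gen_mat cmat_one)
    also have "\<dots> = (\<Sum>a<n. sconst (g $$ (p t, a)) * ?x t $$ (a, q t))"
      using g c[of t] pt by (subst mat_mult_entry[of _ n]) auto
    finally show ?thesis .
  qed
  have "msub n g (1\<^sub>m n) (entry_prod (map (gen_mat n) w) p q) = prod_list (map (msub n g (1\<^sub>m n)) (map (\<lambda>t. ?x t $$ (p t, q t)) ?ts))"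
    unfolding entry_prod_gen
    by (rule prod_list) (use w p q in \<open>auto intro!: gen_entry_spolys simp: idx_less subset_iff\<close>)
  also have "map (msub n g (1\<^sub>m n)) (map (\<lambda>t. ?x t $$ (p t, q t)) ?ts) = map (\<lambda>t. \<Sum>a<n. sconst (g $$ (p t, a)) * ?x t $$ (a, q t)) ?ts"
    unfolding map_map by (rule map_cong[OF HOL.refl]) (simp only: o_apply ent)
  also have "prod_list \<dots> = (\<Sum>k\<in>idx n ?d. of_bool (k 0 = l) * prod_list (map (\<lambda>t. sconst (g $$ (p t, k t)) * ?x t $$ (k t, q t)) ?ts))"
    by (rule prod_list_sum_expand[OF l, symmetric])
  finally have eq: "msub n g (1\<^sub>m n) (entry_prod (map (gen_mat n) w) p q) =
     (\<Sum>k\<in>idx n ?d. of_bool (k 0 = l) * (sconst (prod_list (map (\<lambda>t. g $$ (p t, k t)) ?ts)) * entry_prod (map (gen_mat n) w) k q))"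
    unfolding prod_list_sconst_mult entry_prod_gen .
  show ?thesis
    unfolding eq sum_distrib_right sconst_central[symmetric, of _ "g $$ (p 0, l)"] sum_distrib_left
  proof (rule sum.cong[OF HOL.refl])
    fix k
    show "sconst (g $$ (p 0, l)) * (of_bool (k 0 = l) * (sconst (prod_list (map (\<lambda>t. g $$ (p t, k t)) ?ts)) * entry_prod (map (gen_mat n) w) k q)) =
      of_bool (k 0 = l) * (sconst (kron ?d g p k) * entry_prod (map (gen_mat n) w) k q)"
      by (cases "k 0 = l") (simp_all only: kron_prod_list sconst_hom(4) mult.assoc of_bool_def simp_thms if_True if_False mult_1 mult_zero_left mult_zero_right)
  qed
qed

lemma msub_right_entry_prod:
  assumes g: "g \<in> carrier_mat n n" and w: "set w \<subseteq> gvars e f"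
    and p: "p \<in> idx n (length w)" and q: "q \<in> idx n (length w)" and l: "l < n"
  shows "sconst (g $$ (l, q 0)) * msub n (1\<^sub>m n) g (entry_prod (map (gen_mat n) w) p q) =
    (\<Sum>k\<in>idx n (length w). of_bool (k 0 = l) * (sconst (kron (length w) g k q) * entry_prod (map (gen_mat n) w) p k))"
proof -
  interpret spoly_hom "msub n (1\<^sub>m n) g" e f n using g by (intro spoly_hom_msub) auto
  let ?d = "length w" and ?x = "\<lambda>t. gen_mat n (w ! (t - 1))"
  let ?ts = "[1..<Suc ?d]"
  have c: "?x t \<in> carrier_mat n n" for t by (rule gen_mat_carrier)
  have ent: "msub n (1\<^sub>m n) g (?x t $$ (p t, q t)) = (\<Sum>a<n. sconst (g $$ (a, q t)) * ?x t $$ (p t, a))"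
    if t: "t \<in> set ?ts" for t
  proof -
    have pt: "p t < n" "q t < n" using t p q by (auto intro: idx_less)
    have "msub n (1\<^sub>m n) g (?x t $$ (p t, q t)) = map_mat (msub n (1\<^sub>m n) g) (?x t) $$ (p t, q t)"
      using c[of t] pt by simp
    also have "\<dots> = (?x t * cmat g) $$ (p t, q t)"
      using g c[of t] by (simp add: msub_gen_mat cmat_one)
    also have "\<dots> = (\<Sum>a<n. ?x t $$ (p t, a) * sconst (g $$ (a, q t)))"
      using g c[of t] pt by (subst mat_mult_entry[of _ n]) auto
    finally show ?thesis by (simp only: sconst_central)
  qed
  have "msub n (1\<^sub>m n) g (entry_prod (map (gen_mat n) w) p q) = prod_list (map (msub n (1\<^sub>m n) g) (map (\<lambda>t. ?x t $$ (p t, q t)) ?ts))"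
    unfolding entry_prod_gen
    by (rule prod_list) (use w p q in \<open>auto intro!: gen_entry_spolys simp: idx_less subset_iff\<close>)
  also have "map (msub n (1\<^sub>m n) g) (map (\<lambda>t. ?x t $$ (p t, q t)) ?ts) = map (\<lambda>t. \<Sum>a<n. sconst (g $$ (a, q t)) * ?x t $$ (p t, a)) ?ts"
    unfolding map_map by (rule map_cong[OF HOL.refl]) (simp only: o_apply ent)
  also have "prod_list \<dots> = (\<Sum>k\<in>idx n ?d. of_bool (k 0 = l) * prod_list (map (\<lambda>t. sconst (g $$ (k t, q t)) * ?x t $$ (p t, k t)) ?ts))"
    by (rule prod_list_sum_expand[OF l, symmetric])
  finally have eq: "msub n (1\<^sub>m n) g (entry_prod (map (gen_mat n) w) p q) =
     (\<Sum>k\<in>idx n ?d. of_bool (k 0 = l) * (sconst (prod_list (map (\<lambda>t. g $$ (k t, q t)) ?ts)) * entry_prod (map (gen_mat n) w) p k))"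
    unfolding prod_list_sconst_mult entry_prod_gen .
  show ?thesis
    unfolding eq sum_distrib_left
  proof (rule sum.cong[OF HOL.refl])
    fix k
    show "sconst (g $$ (l, q 0)) * (of_bool (k 0 = l) * (sconst (prod_list (map (\<lambda>t. g $$ (k t, q t)) ?ts)) * entry_prod (map (gen_mat n) w) p k)) =
      of_bool (k 0 = l) * (sconst (kron ?d g k q) * entry_prod (map (gen_mat n) w) p k)"
      by (cases "k 0 = l") (simp_all only: kron_prod_list sconst_hom(4) mult.assoc of_bool_def simp_thms if_True if_False mult_1 mult_zero_left mult_zero_right)
  qed
qed

lemma sconst_sum: "sconst (sum h I) = (\<Sum>x\<in>I. sconst (h x))"
  by (induction I rule: infinite_finite_induct) (auto simp: sconst_hom)

text \<open>Multiplying every letter by \<open>g\<close> on the left, and the output by \<open>g\<close> on the right, applies the transpose of \<open>g\<close>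
to all \<open>d + 1\<close> row positions of the coefficients.\<close>

lemma contract_left_mult:
  assumes g: "g \<in> carrier_mat n n" and W: "\<And>w. w \<in> W \<Longrightarrow> set w \<subseteq> gvars e f"
    and i: "i < n" and l: "l < n"
  shows "(\<Sum>j<n. msub n g (1\<^sub>m n) (contract n W c i j) * sconst (g $$ (j, l))) =
    contract n W (\<lambda>w p q. \<Sum>k\<in>idx n (length w). kron (length w) g k p * c w k q) i l"
proof -
  interpret spoly_hom "msub n g (1\<^sub>m n)" e f n using g by (intro spoly_hom_msub) auto
  let ?I = "\<lambda>w. idx n (length w)" and ?x = "\<lambda>w. entry_prod (map (gen_mat n) w)"
  have F: "msub n g (1\<^sub>m n) (contract n W c i j) = (\<Sum>w\<in>W. \<Sum>p\<in>?I w. \<Sum>q\<in>?I w.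
     of_bool (q 0 = i \<and> p 0 = j) * (sconst (c w p q) * msub n g (1\<^sub>m n) (?x w p q)))" for j
    unfolding contract_def
    by (rule sum_of_bool_sconst) (intro entry_prod_gen_spolys W)
  have "(\<Sum>j<n. msub n g (1\<^sub>m n) (contract n W c i j) * sconst (g $$ (j, l))) =
     (\<Sum>w\<in>W. \<Sum>p\<in>?I w. \<Sum>q\<in>?I w. \<Sum>j<n. of_bool (q 0 = i \<and> p 0 = j) * (sconst (c w p q) * msub n g (1\<^sub>m n) (?x w p q)) * sconst (g $$ (j, l)))"
    unfolding F sum_distrib_right
    by (subst sum.swap, intro sum.cong HOL.refl, subst sum.swap, intro sum.cong HOL.refl, rule sum.swap)
  also have "\<dots> = (\<Sum>w\<in>W. \<Sum>p\<in>?I w. \<Sum>q\<in>?I w. of_bool (q 0 = i) * (sconst (c w p q) * (msub n g (1\<^sub>m n) (?x w p q) * sconst (g $$ (p 0, l)))))"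
  proof (intro sum.cong HOL.refl)
    fix w p q assume "w \<in> W" "p \<in> ?I w" "q \<in> ?I w"
    then have "p 0 < n" by (auto intro: idx_less)
    have "(\<Sum>j<n. of_bool (q 0 = i \<and> p 0 = j) * (sconst (c w p q) * msub n g (1\<^sub>m n) (?x w p q)) * sconst (g $$ (j, l))) =
       (\<Sum>j<n. if j = p 0 then of_bool (q 0 = i) * (sconst (c w p q) * (msub n g (1\<^sub>m n) (?x w p q) * sconst (g $$ (p 0, l)))) else 0)"
      by (intro sum.cong HOL.refl) (auto simp: mult.assoc)
    also have "\<dots> = of_bool (q 0 = i) * (sconst (c w p q) * (msub n g (1\<^sub>m n) (?x w p q) * sconst (g $$ (p 0, l))))"
      using \<open>p 0 < n\<close> by simp
    finally show "(\<Sum>j<n. of_bool (q 0 = i \<and> p 0 = j) * (sconst (c w p q) * msub n g (1\<^sub>m n) (?x w p q)) * sconst (g $$ (j, l))) =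
       of_bool (q 0 = i) * (sconst (c w p q) * (msub n g (1\<^sub>m n) (?x w p q) * sconst (g $$ (p 0, l))))" .
  qed
  also have "\<dots> = (\<Sum>w\<in>W. \<Sum>p\<in>?I w. \<Sum>q\<in>?I w. \<Sum>k\<in>?I w. of_bool (q 0 = i \<and> k 0 = l) * (sconst (kron (length w) g p k * c w p q) * ?x w k q))"
  proof (intro sum.cong HOL.refl)
    fix w p q assume w: "w \<in> W" "p \<in> ?I w" "q \<in> ?I w"
    show "of_bool (q 0 = i) * (sconst (c w p q) * (msub n g (1\<^sub>m n) (?x w p q) * sconst (g $$ (p 0, l)))) =
      (\<Sum>k\<in>?I w. of_bool (q 0 = i \<and> k 0 = l) * (sconst (kron (length w) g p k * c w p q) * ?x w k q))"
      unfolding msub_left_entry_prod[OF g W[OF w(1)] w(2,3) l] sum_distrib_left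
      by (intro sum.cong HOL.refl) (auto simp: sconst_hom(4) mult.assoc mult.commute[of "kron _ _ _ _"])
  qed
  also have "\<dots> = contract n W (\<lambda>w p q. \<Sum>k\<in>?I w. kron (length w) g k p * c w k q) i l"
    unfolding contract_def sconst_sum sum_distrib_right sum_distrib_left
    by (rule sum.cong[OF HOL.refl], rule HOL.trans[OF sum.cong[OF HOL.refl sum.swap]],
        rule HOL.trans[OF sum.swap], rule sum.cong[OF HOL.refl], rule sum.swap)
  finally show ?thesis .
qed

lemma contract_right_mult:
  assumes g: "g \<in> carrier_mat n n" and W: "\<And>w. w \<in> W \<Longrightarrow> set w \<subseteq> gvars e f"
    and i: "i < n" and l: "l < n"
  shows "(\<Sum>j<n. sconst (g $$ (i, j)) * msub n (1\<^sub>m n) g (contract n W c j l)) =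
    contract n W (\<lambda>w p q. \<Sum>k\<in>idx n (length w). c w p k * kron (length w) g q k) i l"
proof -
  interpret spoly_hom "msub n (1\<^sub>m n) g" e f n using g by (intro spoly_hom_msub) auto
  let ?I = "\<lambda>w. idx n (length w)" and ?x = "\<lambda>w. entry_prod (map (gen_mat n) w)"
  have F: "msub n (1\<^sub>m n) g (contract n W c j l) = (\<Sum>w\<in>W. \<Sum>p\<in>?I w. \<Sum>q\<in>?I w.
     of_bool (q 0 = j \<and> p 0 = l) * (sconst (c w p q) * msub n (1\<^sub>m n) g (?x w p q)))" for j
    unfolding contract_def
    by (rule sum_of_bool_sconst) (intro entry_prod_gen_spolys W)
  have "(\<Sum>j<n. sconst (g $$ (i, j)) * msub n (1\<^sub>m n) g (contract n W c j l)) =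
     (\<Sum>w\<in>W. \<Sum>p\<in>?I w. \<Sum>q\<in>?I w. \<Sum>j<n. sconst (g $$ (i, j)) * (of_bool (q 0 = j \<and> p 0 = l) * (sconst (c w p q) * msub n (1\<^sub>m n) g (?x w p q))))"
    unfolding F sum_distrib_left
    by (subst sum.swap, intro sum.cong HOL.refl, subst sum.swap, intro sum.cong HOL.refl, rule sum.swap)
  also have "\<dots> = (\<Sum>w\<in>W. \<Sum>p\<in>?I w. \<Sum>q\<in>?I w. of_bool (p 0 = l) * (sconst (c w p q) * (sconst (g $$ (i, q 0)) * msub n (1\<^sub>m n) g (?x w p q))))"
  proof (intro sum.cong HOL.refl)
    fix w p q assume "w \<in> W" "p \<in> ?I w" "q \<in> ?I w"
    then have "q 0 < n" by (auto intro: idx_less)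
    have "(\<Sum>j<n. sconst (g $$ (i, j)) * (of_bool (q 0 = j \<and> p 0 = l) * (sconst (c w p q) * msub n (1\<^sub>m n) g (?x w p q)))) =
       (\<Sum>j<n. if j = q 0 then of_bool (p 0 = l) * (sconst (c w p q) * (sconst (g $$ (i, q 0)) * msub n (1\<^sub>m n) g (?x w p q))) else 0)"
      by (intro sum.cong HOL.refl) (auto simp: sconst_left_commute[of "sconst (g $$ (i, q 0))"])
    also have "\<dots> = of_bool (p 0 = l) * (sconst (c w p q) * (sconst (g $$ (i, q 0)) * msub n (1\<^sub>m n) g (?x w p q)))"
      using \<open>q 0 < n\<close> by simp
    finally show "(\<Sum>j<n. sconst (g $$ (i, j)) * (of_bool (q 0 = j \<and> p 0 = l) * (sconst (c w p q) * msub n (1\<^sub>m n) g (?x w p q)))) =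
       of_bool (p 0 = l) * (sconst (c w p q) * (sconst (g $$ (i, q 0)) * msub n (1\<^sub>m n) g (?x w p q)))" .
  qed
  also have "\<dots> = (\<Sum>w\<in>W. \<Sum>p\<in>?I w. \<Sum>q\<in>?I w. \<Sum>k\<in>?I w. of_bool (k 0 = i \<and> p 0 = l) * (sconst (c w p q * kron (length w) g k q) * ?x w p k))"
  proof (intro sum.cong HOL.refl)
    fix w p q assume w: "w \<in> W" "p \<in> ?I w" "q \<in> ?I w"
    show "of_bool (p 0 = l) * (sconst (c w p q) * (sconst (g $$ (i, q 0)) * msub n (1\<^sub>m n) g (?x w p q))) =
      (\<Sum>k\<in>?I w. of_bool (k 0 = i \<and> p 0 = l) * (sconst (c w p q * kron (length w) g k q) * ?x w p k))"
      unfolding msub_right_entry_prod[OF g W[OF w(1)] w(2,3) i] sum_distrib_left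
      by (intro sum.cong HOL.refl) (auto simp: sconst_hom(4) mult.assoc)
  qed
  also have "\<dots> = contract n W (\<lambda>w p q. \<Sum>k\<in>?I w. c w p k * kron (length w) g q k) i l"
    unfolding contract_def sconst_sum sum_distrib_right sum_distrib_left
    by (rule sum.cong[OF HOL.refl], rule sum.cong[OF HOL.refl], rule sum.swap)
  finally show ?thesis .
qed

section \<open>The module over the trace algebra spanned by the words\<close>

lemma word_mat_simps [simp]: "word_mat n [] = 1\<^sub>m n" "word_mat n (v # w) = gen_mat n v * word_mat n w"
  by (simp_all add: word_mat_def)

lemma word_mat_carrier: "word_mat n w \<in> carrier_mat n n"
  by (induction w) (auto intro: mult_carrier_mat gen_mat_carrier)

lemma word_mat_append: "word_mat n (u @ w) = word_mat n u * word_mat n w"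
  by (induction u)
    (simp_all add: left_mult_one_mat[OF word_mat_carrier] assoc_mult_mat[OF gen_mat_carrier word_mat_carrier word_mat_carrier])

lemma word_mat_single: "word_mat n [v] = gen_mat n v"
  using right_mult_one_mat[OF gen_mat_carrier] by simp

definition wdeg :: "gvar list \<Rightarrow> bit" where "wdeg w = sum_list (map gdeg w)"

lemma word_mat_part: "set w \<subseteq> gvars e f \<Longrightarrow> word_mat n w \<in> part (M_alg e f n) (wdeg w)"
proof (induction w)
  case Nil
  then show ?case by (auto simp: wdeg_def part_M_alg part_S_alg_closed)
next
  case (Cons v w)
  then have "gen_mat n v * word_mat n w \<in> part (M_alg e f n) (gdeg v + wdeg w)"
    by (intro part_M_alg_mult gen_mat_part) auto
  then show ?case by (simp add: wdeg_def)
qed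

lemma word_entry_part:
  "set w \<subseteq> gvars e f \<Longrightarrow> i < n \<Longrightarrow> j < n \<Longrightarrow> word_mat n w $$ (i, j) \<in> part (S_alg e f n) (wdeg w)"
  using word_mat_part[of w e f n] by (simp add: part_M_alg)

definition trace_algebra :: "nat \<Rightarrow> nat \<Rightarrow> nat \<Rightarrow> spoly set" where
  "trace_algebra e f n = subalgebra_generated (S_alg e f n) {mtrace (word_mat n w) | w. set w \<subseteq> gvars e f}"

lemma trace_algebra_closed:
  "1 \<in> trace_algebra e f n" "0 \<in> trace_algebra e f n"
  "set w \<subseteq> gvars e f \<Longrightarrow> mtrace (word_mat n w) \<in> trace_algebra e f n"
  "s \<in> trace_algebra e f n \<Longrightarrow> t \<in> trace_algebra e f n \<Longrightarrow> s + t \<in> trace_algebra e f n"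
  "s \<in> trace_algebra e f n \<Longrightarrow> t \<in> trace_algebra e f n \<Longrightarrow> s * t \<in> trace_algebra e f n"
  "s \<in> trace_algebra e f n \<Longrightarrow> sconst c * s \<in> trace_algebra e f n"
proof -
  note gen = subalgebra_generated.intros[where A = "S_alg e f n" and V = "{mtrace (word_mat n w) | w. set w \<subseteq> gvars e f}", folded trace_algebra_def, simplified]
  show 1: "1 \<in> trace_algebra e f n" by (rule gen)
  show "0 \<in> trace_algebra e f n" using gen(5)[OF 1, of 0] by (simp add: sconst_hom)
  show "set w \<subseteq> gvars e f \<Longrightarrow> mtrace (word_mat n w) \<in> trace_algebra e f n" using gen(2) by blast
qed (auto simp: trace_algebra_def intro: subalgebra_generated.intros[where A = "S_alg e f n" and V = "{mtrace (word_mat n w) | w. set w \<subseteq> gvars e f}", simplified])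

text \<open>The linear combinations of words with coefficients in the trace algebra. Working with this set instead of the
algebra generated by traces and words has the advantage that the trace maps it into the trace algebra.\<close>

inductive_set trace_module :: "nat \<Rightarrow> nat \<Rightarrow> nat \<Rightarrow> spoly mat set" for e f n where
  word: "s \<in> trace_algebra e f n \<Longrightarrow> set w \<subseteq> gvars e f \<Longrightarrow> s \<cdot>\<^sub>m word_mat n w \<in> trace_module e f n"
| add: "A \<in> trace_module e f n \<Longrightarrow> B \<in> trace_module e f n \<Longrightarrow> A + B \<in> trace_module e f n"

lemma trace_module_carrier: "A \<in> trace_module e f n \<Longrightarrow> A \<in> carrier_mat n n"
  by (induction rule: trace_module.induct) (auto simp: word_mat_carrier)

lemma mtrace_add: "A \<in> carrier_mat n n \<Longrightarrow> B \<in> carrier_mat n n \<Longrightarrow> mtrace (A + B) = mtrace A + mtrace B"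
  by (simp add: mtrace_carrier[of _ n] sum.distrib)

lemma mtrace_trace_module: "A \<in> trace_module e f n \<Longrightarrow> mtrace A \<in> trace_algebra e f n"
proof (induction rule: trace_module.induct)
  case (word s w)
  then show ?case by (simp add: mtrace_scalar[OF word_mat_carrier] trace_algebra_closed)
next
  case (add A B)
  then show ?case by (simp add: mtrace_add[OF trace_module_carrier trace_module_carrier] trace_algebra_closed)
qed

lemma trace_module_scalar:
  "A \<in> trace_module e f n \<Longrightarrow> sconst c \<cdot>\<^sub>m A \<in> trace_module e f n"
proof (induction rule: trace_module.induct)
  case (word s w)
  have "sconst c \<cdot>\<^sub>m (s \<cdot>\<^sub>m word_mat n w) = (sconst c * s) \<cdot>\<^sub>m word_mat n w"
    by (rule eq_matI) (auto simp: mult.assoc)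
  then show ?case using word by (simp add: trace_module.word trace_algebra_closed)
next
  case (add A B)
  have "sconst c \<cdot>\<^sub>m (A + B) = sconst c \<cdot>\<^sub>m A + sconst c \<cdot>\<^sub>m B"
    using add(1,2)[THEN trace_module_carrier] by (auto simp: distrib_left intro!: eq_matI)
  then show ?case using add by (simp add: trace_module.add)
qed

lemma trace_module_mult_word:
  assumes "A \<in> trace_module e f n" and u: "set u \<subseteq> gvars e f"
  shows "A * word_mat n u \<in> trace_module e f n"
  using assms(1)
proof (induction rule: trace_module.induct)
  case (word s w)
  have "(s \<cdot>\<^sub>m word_mat n w) * word_mat n u = s \<cdot>\<^sub>m word_mat n (w @ u)"
  proof -
    have "(s \<cdot>\<^sub>m word_mat n w) * word_mat n u = ((s \<cdot>\<^sub>m 1\<^sub>m n) * word_mat n w) * word_mat n u"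
      by (simp add: scalar_mat_mult[OF word_mat_carrier])
    also have "\<dots> = (s \<cdot>\<^sub>m 1\<^sub>m n) * (word_mat n w * word_mat n u)"
      by (rule assoc_mult_mat[of _ n n _ n _ n]) (auto simp: word_mat_carrier)
    also have "\<dots> = s \<cdot>\<^sub>m word_mat n (w @ u)"
      by (simp add: scalar_mat_mult[OF word_mat_carrier] flip: word_mat_append)
    finally show ?thesis .
  qed
  then show ?case using word u by (simp add: trace_module.word)
next
  case (add A B)
  have "(A + B) * word_mat n u = A * word_mat n u + B * word_mat n u"
    by (rule add_mult_distrib_mat[of _ n n _ _ n]) (use add trace_module_carrier word_mat_carrier in auto)
  then show ?case using add by (simp add: trace_module.add)
qed

lemma mtrace_word_part: "set u \<subseteq> gvars e f \<Longrightarrow> mtrace (word_mat n u) \<in> part (S_alg e f n) (wdeg u)"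
  by (rule mtrace_part[OF word_mat_part])

text \<open>A trace on the right can be moved to the left at the cost of a sign that depends only on the degrees.\<close>

lemma trace_module_mult_trace:
  assumes "A \<in> trace_module e f n" and u: "set u \<subseteq> gvars e f"
  shows "map_mat (\<lambda>x. x * mtrace (word_mat n u)) A \<in> trace_module e f n"
  using assms(1)
proof (induction rule: trace_module.induct)
  case (word s w)
  let ?t = "mtrace (word_mat n u)"
  have "map_mat (\<lambda>x. x * ?t) (s \<cdot>\<^sub>m word_mat n w) = (s * (sconst (koszul (wdeg w) (wdeg u)) * ?t)) \<cdot>\<^sub>m word_mat n w"
  proof (rule eq_matI)
    fix i j assume "i < dim_row ((s * (sconst (koszul (wdeg w) (wdeg u)) * ?t)) \<cdot>\<^sub>m word_mat n w)"
      "j < dim_col ((s * (sconst (koszul (wdeg w) (wdeg u)) * ?t)) \<cdot>\<^sub>m word_mat n w)"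
    then have ij: "i < n" "j < n" using word_mat_carrier[of n w] by auto
    have "word_mat n w $$ (i, j) * ?t = sconst (koszul (wdeg w) (wdeg u)) * (?t * word_mat n w $$ (i, j))"
      by (rule S_alg_supercomm[OF word_entry_part[OF word(2) ij] mtrace_word_part[OF u]])
    then show "map_mat (\<lambda>x. x * ?t) (s \<cdot>\<^sub>m word_mat n w) $$ (i, j) = ((s * (sconst (koszul (wdeg w) (wdeg u)) * ?t)) \<cdot>\<^sub>m word_mat n w) $$ (i, j)"
      using ij word_mat_carrier[of n w] by (simp add: mult.assoc)
  qed (auto simp: word_mat_carrier)
  then show ?case using word u by (simp add: trace_module.word trace_algebra_closed)
next
  case (add A B)
  have "map_mat (\<lambda>x. x * mtrace (word_mat n u)) (A + B) =
     map_mat (\<lambda>x. x * mtrace (word_mat n u)) A + map_mat (\<lambda>x. x * mtrace (word_mat n u)) B"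
    using add(1,2)[THEN trace_module_carrier] by (auto simp: distrib_right intro!: eq_matI)
  then show ?case using add by (simp add: trace_module.add)
qed

lemma trace_module_zero: "0\<^sub>m n n \<in> trace_module e f n"
proof -
  have "0 \<cdot>\<^sub>m word_mat n [] \<in> trace_module e f n"
    by (rule trace_module.word) (auto simp: trace_algebra_closed)
  moreover have "0 \<cdot>\<^sub>m word_mat n [] = (0\<^sub>m n n :: spoly mat)" by (auto intro!: eq_matI)
  ultimately show ?thesis by simp
qed

lemma trace_module_sum:
  assumes "\<And>x. x \<in> I \<Longrightarrow> mat n n (\<lambda>(i, j). h x i j) \<in> trace_module e f n"
  shows "mat n n (\<lambda>(i, j). \<Sum>x\<in>I. h x i j) \<in> trace_module e f n"
  using assms
proof (induction I rule: infinite_finite_induct)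
  case (insert x I)
  have "mat n n (\<lambda>(i, j). \<Sum>x\<in>insert x I. h x i j) = mat n n (\<lambda>(i, j). h x i j) + mat n n (\<lambda>(i, j). \<Sum>x\<in>I. h x i j)"
    using insert.hyps by (auto intro!: eq_matI)
  then show ?case using insert by (simp add: trace_module.add)
next
  case empty
  have "mat n n (\<lambda>(i, j). \<Sum>x\<in>{}. h x i j) = 0\<^sub>m n n" by (auto intro!: eq_matI)
  then show ?case by (simp only: trace_module_zero)
next
  case (infinite I)
  then have "mat n n (\<lambda>(i, j). \<Sum>x\<in>I. h x i j) = 0\<^sub>m n n" by (auto intro!: eq_matI)
  then show ?case by (simp only: trace_module_zero)
qed

section \<open>Permutation tensors contract to traces and words\<close>

text \<open>The contraction of the place permutation \<open>\<pi>\<close>, with arbitrary words in place of letters. This generality is what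
the induction on the number of words needs, because it merges two words into one.\<close>

definition perm_contract :: "nat \<Rightarrow> gvar list list \<Rightarrow> (nat \<Rightarrow> nat) \<Rightarrow> nat \<Rightarrow> nat \<Rightarrow> spoly" where
  "perm_contract n ws \<pi> i j = (\<Sum>q\<in>idx n (length ws).
     of_bool (q 0 = i \<and> q (\<pi> 0) = j) * entry_prod (map (word_mat n) ws) (q \<circ> \<pi>) q)"

lemma entry_prod_snoc:
  "entry_prod (As @ [B]) p q = entry_prod As p q * B $$ (p (Suc (length As)), q (Suc (length As)))"
proof -
  have "map (\<lambda>t. ((As @ [B]) ! (t - 1)) $$ (p t, q t)) [1..<Suc (length As)] = map (\<lambda>t. (As ! (t - 1)) $$ (p t, q t)) [1..<Suc (length As)]"
    by (rule map_cong) (auto simp: nth_append)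
  moreover have "[1..<Suc (length (As @ [B]))] = [1..<Suc (length As)] @ [Suc (length As)]" by simp
  ultimately show ?thesis
    unfolding entry_prod_def by (simp only: map_append prod_list.append) simp
qed

lemma entry_prod_cong:
  assumes "length As = d" "\<And>t. 1 \<le> t \<Longrightarrow> t \<le> d \<Longrightarrow> p t = p' t" "\<And>t. 1 \<le> t \<Longrightarrow> t \<le> d \<Longrightarrow> q t = q' t"
  shows "entry_prod As p q = entry_prod As p' q'"
  unfolding entry_prod_def by (rule arg_cong[where f = prod_list], rule map_cong) (use assms in auto)

lemma prod_list_part:
  "(\<And>t. t \<in> set ts \<Longrightarrow> x t \<in> part (S_alg e f n) (\<delta> t)) \<Longrightarrow>
    prod_list (map x ts) \<in> part (S_alg e f n) (sum_list (map \<delta> ts))"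
proof (induction ts)
  case (Cons t ts)
  then have "x t * prod_list (map x ts) \<in> part (S_alg e f n) (\<delta> t + sum_list (map \<delta> ts))"
    by (intro part_S_alg_mult) auto
  then show ?case by (simp only: list.map prod_list.Cons sum_list.Cons)
qed (simp add: part_S_alg_closed)

text \<open>A fixed position splits off a trace.\<close>

lemma perm_contract_fixed:
  assumes \<pi>: "\<pi> permutes {..length us}" 
  shows "perm_contract n (us @ [u]) \<pi> i j = perm_contract n us \<pi> i j * mtrace (word_mat n u)"
proof -
  let ?d = "length us" and ?A = "map (word_mat n) us" and ?B = "word_mat n u"
  have le: "\<pi> t \<le> ?d" if "t \<le> ?d" for t using permutes_in_image[OF \<pi>, of t] that by simp
  have fixed: "\<pi> (Suc ?d) = Suc ?d" by (rule permutes_not_in[OF \<pi>]) simp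
  have "perm_contract n (us @ [u]) \<pi> i j = (\<Sum>q\<in>idx n ?d. \<Sum>a<n.
      of_bool (q 0 = i \<and> q (\<pi> 0) = j) * (entry_prod ?A (q \<circ> \<pi>) q * ?B $$ (a, a)))"
    unfolding perm_contract_def length_append list.size add_Suc_right add_0_right sum_idx_Suc
  proof (intro sum.cong HOL.refl)
    fix q a
    have "entry_prod (map (word_mat n) (us @ [u])) (q(Suc ?d := a) \<circ> \<pi>) (q(Suc ?d := a)) =
       entry_prod ?A (q(Suc ?d := a) \<circ> \<pi>) (q(Suc ?d := a)) * ?B $$ (a, a)"
      by (simp add: entry_prod_snoc fixed)
    also have "entry_prod ?A (q(Suc ?d := a) \<circ> \<pi>) (q(Suc ?d := a)) = entry_prod ?A (q \<circ> \<pi>) q"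
      by (rule entry_prod_cong[of _ ?d]) (use le in \<open>fastforce+\<close>)
    finally have eq: "entry_prod (map (word_mat n) (us @ [u])) (q(Suc ?d := a) \<circ> \<pi>) (q(Suc ?d := a)) =
       entry_prod ?A (q \<circ> \<pi>) q * ?B $$ (a, a)" .
    show "of_bool ((q(Suc ?d := a)) 0 = i \<and> (q(Suc ?d := a)) (\<pi> 0) = j) *
         entry_prod (map (word_mat n) (us @ [u])) (q(Suc ?d := a) \<circ> \<pi>) (q(Suc ?d := a)) =
       of_bool (q 0 = i \<and> q (\<pi> 0) = j) * (entry_prod ?A (q \<circ> \<pi>) q * ?B $$ (a, a))"
      unfolding eq using le[of 0] by simp
  qed
  also have "\<dots> = perm_contract n us \<pi> i j * mtrace ?B"
    unfolding perm_contract_def mtrace_carrier[OF word_mat_carrier] sum_product by (simp only: mult.assoc)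
  finally show ?thesis .
qed

text \<open>Removing the last position from its cycle: its predecessor \<open>b\<close> is sent to its successor.\<close>

lemma removed_permutation:
  assumes \<pi>: "\<pi> permutes {..Suc d}" and b: "b \<le> d" "\<pi> b = Suc d"
  defines "\<pi>' \<equiv> \<pi> \<circ> transpose b (Suc d)"
  shows "\<pi>' permutes {..d}" "\<pi>' b = \<pi> (Suc d)" "\<And>t. t \<le> d \<Longrightarrow> t \<noteq> b \<Longrightarrow> \<pi>' t = \<pi> t"
proof -
  have "\<pi>' permutes {..Suc d}" unfolding \<pi>'_def
    by (intro permutes_compose[OF _ \<pi>] permutes_swap_id) (use b in auto)
  moreover have "\<pi>' x = x" if "x \<in> {..Suc d} - {..d}" for x
  proof -
    have "x = Suc d" using that by auto
    then show ?thesis using b by (simp add: \<pi>'_def)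
  qed
  ultimately show "\<pi>' permutes {..d}" by (rule permutes_superset)
qed (use b in \<open>auto simp: \<pi>'_def transpose_def\<close>)

text \<open>If the output position precedes the last one, summation over the index at the output is matrix multiplication
by the last word.\<close>

lemma perm_contract_output:
  assumes \<pi>: "\<pi> permutes {..Suc (length us)}" and 0: "\<pi> 0 = Suc (length us)"
    and ij: "i < n" "j < n"
  shows "perm_contract n (us @ [u]) \<pi> i j =
    (\<Sum>l<n. perm_contract n us (\<pi> \<circ> transpose 0 (Suc (length us))) i l * word_mat n u $$ (l, j))"
proof -
  let ?d = "length us" and ?A = "map (word_mat n) us" and ?B = "word_mat n u"
  define \<pi>' where "\<pi>' = \<pi> \<circ> transpose 0 (Suc ?d)"
  note \<pi>' = removed_permutation[OF \<pi> _ 0, folded \<pi>'_def, simplified]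
  have le: "\<pi>' t \<le> ?d" if "t \<le> ?d" for t using permutes_in_image[OF \<pi>'(1), of t] that by simp
  have "perm_contract n (us @ [u]) \<pi> i j = (\<Sum>q\<in>idx n ?d. \<Sum>a<n.
      of_bool (q 0 = i \<and> a = j) * (entry_prod ?A (q \<circ> \<pi>') q * ?B $$ (q (\<pi>' 0), a)))"
    unfolding perm_contract_def length_append list.size add_Suc_right add_0_right sum_idx_Suc
  proof (intro sum.cong HOL.refl)
    fix q a
    have "entry_prod (map (word_mat n) (us @ [u])) (q(Suc ?d := a) \<circ> \<pi>) (q(Suc ?d := a)) =
       entry_prod ?A (q(Suc ?d := a) \<circ> \<pi>) (q(Suc ?d := a)) * ?B $$ (q (\<pi>' 0), a)"
      using le[of 0] by (simp add: entry_prod_snoc \<pi>'(2)[symmetric])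
    also have "entry_prod ?A (q(Suc ?d := a) \<circ> \<pi>) (q(Suc ?d := a)) = entry_prod ?A (q \<circ> \<pi>') q"
      by (rule entry_prod_cong[of _ ?d]) (use le \<pi>'(3)[symmetric] in \<open>fastforce+\<close>)
    finally have eq: "entry_prod (map (word_mat n) (us @ [u])) (q(Suc ?d := a) \<circ> \<pi>) (q(Suc ?d := a)) =
       entry_prod ?A (q \<circ> \<pi>') q * ?B $$ (q (\<pi>' 0), a)" .
    show "of_bool ((q(Suc ?d := a)) 0 = i \<and> (q(Suc ?d := a)) (\<pi> 0) = j) *
         entry_prod (map (word_mat n) (us @ [u])) (q(Suc ?d := a) \<circ> \<pi>) (q(Suc ?d := a)) =
       of_bool (q 0 = i \<and> a = j) * (entry_prod ?A (q \<circ> \<pi>') q * ?B $$ (q (\<pi>' 0), a))"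
      unfolding eq by (simp add: 0)
  qed
  also have "\<dots> = (\<Sum>q\<in>idx n ?d. of_bool (q 0 = i) * (entry_prod ?A (q \<circ> \<pi>') q * ?B $$ (q (\<pi>' 0), j)))"
  proof (intro sum.cong HOL.refl)
    fix q
    have "(\<Sum>a<n. of_bool (q 0 = i \<and> a = j) * (entry_prod ?A (q \<circ> \<pi>') q * ?B $$ (q (\<pi>' 0), a))) =
      (\<Sum>a<n. if a = j then of_bool (q 0 = i) * (entry_prod ?A (q \<circ> \<pi>') q * ?B $$ (q (\<pi>' 0), j)) else 0)"
      by (intro sum.cong HOL.refl) auto
    then show "(\<Sum>a<n. of_bool (q 0 = i \<and> a = j) * (entry_prod ?A (q \<circ> \<pi>') q * ?B $$ (q (\<pi>' 0), a))) =
      of_bool (q 0 = i) * (entry_prod ?A (q \<circ> \<pi>') q * ?B $$ (q (\<pi>' 0), j))" using ij by simp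
  qed
  also have "\<dots> = (\<Sum>q\<in>idx n ?d. \<Sum>l<n. of_bool (q 0 = i \<and> q (\<pi>' 0) = l) * entry_prod ?A (q \<circ> \<pi>') q * ?B $$ (l, j))"
  proof (intro sum.cong HOL.refl)
    fix q assume q: "q \<in> idx n ?d"
    then have "q (\<pi>' 0) < n" using le[of 0] by (auto intro: idx_less)
    have "(\<Sum>l<n. of_bool (q 0 = i \<and> q (\<pi>' 0) = l) * entry_prod ?A (q \<circ> \<pi>') q * ?B $$ (l, j)) =
      (\<Sum>l<n. if l = q (\<pi>' 0) then of_bool (q 0 = i) * (entry_prod ?A (q \<circ> \<pi>') q * ?B $$ (q (\<pi>' 0), j)) else 0)"
      by (intro sum.cong HOL.refl) (auto simp: mult.assoc)
    then show "of_bool (q 0 = i) * (entry_prod ?A (q \<circ> \<pi>') q * ?B $$ (q (\<pi>' 0), j)) =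
      (\<Sum>l<n. of_bool (q 0 = i \<and> q (\<pi>' 0) = l) * entry_prod ?A (q \<circ> \<pi>') q * ?B $$ (l, j))"
      using \<open>q (\<pi>' 0) < n\<close> by simp
  qed
  also have "\<dots> = (\<Sum>l<n. perm_contract n us \<pi>' i l * ?B $$ (l, j))"
    unfolding perm_contract_def sum_distrib_right by (rule sum.swap)
  finally show ?thesis unfolding \<pi>'_def .
qed

lemma entry_prod_split:
  assumes "1 \<le> b" "b \<le> length As"
  shows "entry_prod As p q = prod_list (map (\<lambda>t. (As ! (t - 1)) $$ (p t, q t)) [1..<b]) *
     ((As ! (b - 1)) $$ (p b, q b) * prod_list (map (\<lambda>t. (As ! (t - 1)) $$ (p t, q t)) [Suc b..<Suc (length As)]))"
proof -
  have "[1..<Suc (length As)] = [1..<b] @ b # [Suc b..<Suc (length As)]"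
    using assms by (metis le_Suc_eq le_imp_less_Suc less_imp_le_nat upt_add_eq_append upt_conv_Cons le_add_diff_inverse)
  then show ?thesis unfolding entry_prod_def by (simp only: map_append prod_list.append list.map prod_list.Cons)
qed

text \<open>If a position \<open>b\<close> other than the output precedes the last one, summation over the shared index multiplies the
two words, once the last factor has been moved next to the factor number \<open>b\<close>. The sign is uniform, because all
entries of a word are homogeneous of the same degree.\<close>

lemma perm_contract_merge:
  assumes \<pi>: "\<pi> permutes {..Suc (length us)}" and b: "1 \<le> b" "b \<le> length us" "\<pi> b = Suc (length us)"
    and us: "\<And>w. w \<in> set us \<Longrightarrow> set w \<subseteq> gvars e f" and u: "set u \<subseteq> gvars e f"
  shows "\<exists>c. \<forall>i j. perm_contract n (us @ [u]) \<pi> i j =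
    sconst c * perm_contract n (us[b - 1 := u @ us ! (b - 1)]) (\<pi> \<circ> transpose b (Suc (length us))) i j"
proof -
  let ?d = "length us" and ?A = "map (word_mat n) us" and ?B = "word_mat n u"
  define us' where "us' = us[b - 1 := u @ us ! (b - 1)]"
  define \<pi>' where "\<pi>' = \<pi> \<circ> transpose b (Suc ?d)"
  note \<pi>' = removed_permutation[OF \<pi> b(2,3), folded \<pi>'_def]
  have le: "\<pi>' t \<le> ?d" if "t \<le> ?d" for t using permutes_in_image[OF \<pi>'(1), of t] that by simp
  let ?x = "\<lambda>q t. (?A ! (t - 1)) $$ (q (\<pi>' t), q t)"
  let ?deg = "\<lambda>t. wdeg (us ! (t - 1))"
  define \<delta> where "\<delta> = ?deg b + sum_list (map ?deg [Suc b..<Suc ?d])"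
  define c where "c = koszul \<delta> (wdeg u)"
  have main: "(\<Sum>a<n. entry_prod (map (word_mat n) (us @ [u])) (q(Suc ?d := a) \<circ> \<pi>) (q(Suc ?d := a))) =
     sconst c * entry_prod (map (word_mat n) us') (q \<circ> \<pi>') q" if q: "q \<in> idx n ?d" for q
  proof -
    define X where "X = prod_list (map (?x q) [1..<b])"
    define Y where "Y = prod_list (map (?x q) [Suc b..<Suc ?d])"
    define Ab where "Ab a = word_mat n (us ! (b - 1)) $$ (a, q b)" for a
    have qless: "q t < n" "q (\<pi>' t) < n" if "t \<le> ?d" for t using q that le by (auto intro: idx_less)
    have Y: "Y \<in> part (S_alg e f n) (sum_list (map ?deg [Suc b..<Suc ?d]))"
      unfolding Y_def
    proof (rule prod_list_part)
      fix t assume "t \<in> set [Suc b..<Suc ?d]"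
      then have t: "t \<le> ?d" "t - 1 < ?d" by auto
      then show "?x q t \<in> part (S_alg e f n) (?deg t)"
        using qless[OF t(1)] us[of "us ! (t - 1)"] by (simp add: word_entry_part)
    qed
    have bd: "b - 1 < ?d" using b by auto
    have "entry_prod (map (word_mat n) (us @ [u])) (q(Suc ?d := a) \<circ> \<pi>) (q(Suc ?d := a)) =
       sconst c * (X * ((?B $$ (q (\<pi>' b), a) * Ab a) * Y))" if a: "a < n" for a
    proof -
      have *: "?A ! (t - 1) $$ ((q(Suc ?d := a) \<circ> \<pi>) t, (q(Suc ?d := a)) t) = ?x q t" if "t \<le> ?d" "t \<noteq> b" for t
        using that \<pi>'(3)[OF that] le[OF that(1)] by auto
      have m: "map (\<lambda>t. ?A ! (t - 1) $$ ((q(Suc ?d := a) \<circ> \<pi>) t, (q(Suc ?d := a)) t)) ts = map (?x q) ts"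
        if "\<And>t. t \<in> set ts \<Longrightarrow> t \<le> ?d \<and> t \<noteq> b" for ts
        by (rule map_cong[OF HOL.refl]) (use that * in blast)
      have ab: "?A ! (b - 1) $$ ((q(Suc ?d := a) \<circ> \<pi>) b, (q(Suc ?d := a)) b) = Ab a"
        using b bd by (simp add: Ab_def)
      have e: "entry_prod ?A (q(Suc ?d := a) \<circ> \<pi>) (q(Suc ?d := a)) = X * (Ab a * Y)"
        using b unfolding X_def Y_def
        by (subst entry_prod_split[of b]) (simp, simp, subst ab, subst m, simp, subst m, auto)
      have even_values_commute: "?B $$ ((q(Suc ?d := a) \<circ> \<pi>) (Suc ?d), (q(Suc ?d := a)) (Suc ?d)) = ?B $$ (q (\<pi>' b), a)"
        using le[of b] b by (simp add: \<pi>'(2)[symmetric])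
      have "entry_prod (map (word_mat n) (us @ [u])) (q(Suc ?d := a) \<circ> \<pi>) (q(Suc ?d := a)) =
         X * ((Ab a * Y) * ?B $$ (q (\<pi>' b), a))"
        using even_values_commute by (simp add: entry_prod_snoc e mult.assoc)
      also have "(Ab a * Y) * ?B $$ (q (\<pi>' b), a) = sconst c * (?B $$ (q (\<pi>' b), a) * (Ab a * Y))"
        unfolding c_def \<delta>_def
      proof (rule S_alg_supercomm)
        show "Ab a * Y \<in> part (S_alg e f n) (?deg b + sum_list (map ?deg [Suc b..<Suc ?d]))"
          unfolding Ab_def using b bd a qless us[of "us ! (b - 1)"] by (intro part_S_alg_mult Y word_entry_part) auto
        show "?B $$ (q (\<pi>' b), a) \<in> part (S_alg e f n) (wdeg u)"
          using a qless b u by (intro word_entry_part) auto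
      qed
      also have "X * \<dots> = sconst c * (X * ((?B $$ (q (\<pi>' b), a) * Ab a) * Y))"
        by (simp only: sconst_left_commute[of X] mult.assoc)
      finally show ?thesis .
    qed
    then have "(\<Sum>a<n. entry_prod (map (word_mat n) (us @ [u])) (q(Suc ?d := a) \<circ> \<pi>) (q(Suc ?d := a))) =
       sconst c * (X * ((\<Sum>a<n. ?B $$ (q (\<pi>' b), a) * Ab a) * Y))"
      by (simp add: sum_distrib_left sum_distrib_right)
    also have "(\<Sum>a<n. ?B $$ (q (\<pi>' b), a) * Ab a) = word_mat n (u @ us ! (b - 1)) $$ (q (\<pi>' b), q b)"
      unfolding word_mat_append Ab_def using b qless
      by (subst mat_mult_entry[OF word_mat_carrier word_mat_carrier]) auto
    also have "X * (\<dots> * Y) = entry_prod (map (word_mat n) us') (q \<circ> \<pi>') q"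
    proof -
      have m: "map (\<lambda>t. (map (word_mat n) us' ! (t - 1)) $$ ((q \<circ> \<pi>') t, q t)) ts = map (?x q) ts"
        if "\<And>t. t \<in> set ts \<Longrightarrow> 1 \<le> t \<and> t \<le> ?d \<and> t \<noteq> b" for ts
      proof (rule map_cong[OF HOL.refl])
        fix t assume "t \<in> set ts"
        then have "t - 1 < ?d" "t - 1 \<noteq> b - 1" using that[of t] b by auto
        then show "(map (word_mat n) us' ! (t - 1)) $$ ((q \<circ> \<pi>') t, q t) = ?x q t"
          by (simp add: us'_def)
      qed
      have "entry_prod (map (word_mat n) us') (q \<circ> \<pi>') q =
        prod_list (map (\<lambda>t. (map (word_mat n) us' ! (t - 1)) $$ ((q \<circ> \<pi>') t, q t)) [1..<b]) *
       ((map (word_mat n) us' ! (b - 1)) $$ ((q \<circ> \<pi>') b, q b) *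
         prod_list (map (\<lambda>t. (map (word_mat n) us' ! (t - 1)) $$ ((q \<circ> \<pi>') t, q t)) [Suc b..<Suc ?d]))"
        using b entry_prod_split[of b "map (word_mat n) us'" "q \<circ> \<pi>'" q] by (simp add: us'_def)
      also have "\<dots> = X * (word_mat n (u @ us ! (b - 1)) $$ (q (\<pi>' b), q b) * Y)"
      proof -
        have "map (\<lambda>t. (map (word_mat n) us' ! (t - 1)) $$ ((q \<circ> \<pi>') t, q t)) [1..<b] = map (?x q) [1..<b]"
          by (rule m) (use b in auto)
        moreover have "map (\<lambda>t. (map (word_mat n) us' ! (t - 1)) $$ ((q \<circ> \<pi>') t, q t)) [Suc b..<Suc ?d] = map (?x q) [Suc b..<Suc ?d]"
          by (rule m) auto
        moreover have "map (word_mat n) us' ! (b - 1) = word_mat n (u @ us ! (b - 1))"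
          using bd by (simp add: us'_def)
        ultimately show ?thesis unfolding X_def Y_def by (simp only: o_apply)
      qed
      finally show ?thesis ..
    qed
    finally show ?thesis .
  qed
  have "perm_contract n (us @ [u]) \<pi> i j = sconst c * perm_contract n us' \<pi>' i j" for i j
  proof -
    have "perm_contract n (us @ [u]) \<pi> i j = (\<Sum>q\<in>idx n ?d. \<Sum>a<n. of_bool (q 0 = i \<and> q (\<pi>' 0) = j) *
       entry_prod (map (word_mat n) (us @ [u])) (q(Suc ?d := a) \<circ> \<pi>) (q(Suc ?d := a)))"
      unfolding perm_contract_def length_append list.size add_Suc_right add_0_right sum_idx_Suc
      using \<pi>'(3)[of 0] le[of 0] b by (intro sum.cong HOL.refl) auto
    also have "\<dots> = (\<Sum>q\<in>idx n ?d. of_bool (q 0 = i \<and> q (\<pi>' 0) = j) * (sconst c * entry_prod (map (word_mat n) us') (q \<circ> \<pi>') q))"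
      by (intro sum.cong HOL.refl) (simp only: main flip: sum_distrib_left)
    also have "\<dots> = sconst c * perm_contract n us' \<pi>' i j"
      unfolding perm_contract_def sum_distrib_left by (simp add: us'_def sconst_left_commute[of "of_bool _"])
    finally show ?thesis .
  qed
  then show ?thesis unfolding us'_def \<pi>'_def by blast
qed

text \<open>Induction on the number of words, removing the last position. Each of the three preceding cases keeps the
result within the module.\<close>

lemma perm_contract_trace_module:
  assumes "\<And>w. w \<in> set ws \<Longrightarrow> set w \<subseteq> gvars e f" "\<pi> permutes {..length ws}"
  shows "mat n n (\<lambda>(i, j). perm_contract n ws \<pi> i j) \<in> trace_module e f n"
  using assms
proof (induction "length ws" arbitrary: ws \<pi>)
  case 0
  then have ws: "ws = []" by simp
  have "\<pi> 0 = 0" using 0 permutes_in_image[of \<pi> "{..0}" 0] by simp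
  have "mat n n (\<lambda>(i, j). perm_contract n ws \<pi> i j) = 1 \<cdot>\<^sub>m word_mat n []"
  proof (rule eq_matI)
    fix i j assume "i < dim_row (1 \<cdot>\<^sub>m word_mat n [])" "j < dim_col (1 \<cdot>\<^sub>m word_mat n [])"
    then have ij: "i < n" "j < n" by auto
    have "perm_contract n ws \<pi> i j = (\<Sum>a<n. of_bool (a = i \<and> a = j))"
      by (simp add: ws perm_contract_def sum_idx_0 \<open>\<pi> 0 = 0\<close> entry_prod_def)
    also have "\<dots> = (\<Sum>a<n. if a = i then of_bool (i = j) else 0)" by (intro sum.cong) auto
    also have "\<dots> = of_bool (i = j)" using ij by simp
    finally show "mat n n (\<lambda>(i, j). perm_contract n ws \<pi> i j) $$ (i, j) = (1 \<cdot>\<^sub>m word_mat n []) $$ (i, j)"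
      using ij by simp
  qed auto
  then show ?case by (simp only:) (intro trace_module.word trace_algebra_closed, simp)
next
  case (Suc d)
  then obtain us u where ws: "ws = us @ [u]" by (metis append_butlast_last_id length_0_conv nat.distinct(1))
  have d: "length us = d" using Suc.hyps(2) ws by simp
  have us: "\<And>w. w \<in> set us \<Longrightarrow> set w \<subseteq> gvars e f" and u: "set u \<subseteq> gvars e f" using Suc.prems(1) ws by auto
  have \<pi>: "\<pi> permutes {..Suc (length us)}" using Suc.prems(2) ws by simp
  show ?case
  proof (cases "\<pi> (Suc d) = Suc d")
    case True
    have \<pi>d: "\<pi> permutes {..length us}"
    proof (rule permutes_superset[OF \<pi>])
      fix x assume "x \<in> {..Suc (length us)} - {..length us}"
      then have "x = Suc d" using d by auto
      then show "\<pi> x = x" using True by simp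
    qed
    have "mat n n (\<lambda>(i, j). perm_contract n ws \<pi> i j) =
       map_mat (\<lambda>x. x * mtrace (word_mat n u)) (mat n n (\<lambda>(i, j). perm_contract n us \<pi> i j))"
      by (auto simp: ws perm_contract_fixed[OF \<pi>d] intro!: eq_matI)
    then show ?thesis
      using trace_module_mult_trace[OF Suc.hyps(1)[OF d[symmetric] us \<pi>d] u] by simp
  next
    case False
    obtain b where b: "\<pi> b = Suc d" using \<pi> by (metis permutes_surj surjD)
    have "b \<le> Suc d" using b permutes_in_image[OF \<pi>, of b] d by simp
    with b False have bd: "b \<le> d" by (metis le_SucE)
    have b': "\<pi> b = Suc (length us)" "b \<le> length us" using b bd d by auto
    note \<pi>' = removed_permutation(1)[OF \<pi> b'(2,1)]
    show ?thesis
    proof (cases "b = 0")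
      case True
      let ?T = "mat n n (\<lambda>(i, j). perm_contract n us (\<pi> \<circ> transpose 0 (Suc (length us))) i j)"
      have "mat n n (\<lambda>(i, j). perm_contract n ws \<pi> i j) = ?T * word_mat n u"
      proof (rule eq_matI)
        fix i j assume "i < dim_row (?T * word_mat n u)" "j < dim_col (?T * word_mat n u)"
        then have ij: "i < n" "j < n" using word_mat_carrier[of n u] by auto
        have "(?T * word_mat n u) $$ (i, j) = (\<Sum>l<n. ?T $$ (i, l) * word_mat n u $$ (l, j))"
          by (rule mat_mult_entry[OF _ word_mat_carrier ij]) simp
        also have "\<dots> = perm_contract n (us @ [u]) \<pi> i j"
          using ij b' True by (subst perm_contract_output[OF \<pi> _ ij]) auto
        finally show "mat n n (\<lambda>(i, j). perm_contract n ws \<pi> i j) $$ (i, j) = (?T * word_mat n u) $$ (i, j)"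
          using ij by (simp add: ws)
      qed (use word_mat_carrier[of n u] in auto)
      then show ?thesis
        using trace_module_mult_word[OF Suc.hyps(1)[OF d[symmetric] us, of "\<pi> \<circ> transpose 0 (Suc (length us))"] u] \<pi>' True by simp
    next
      case False
      then have "1 \<le> b" by simp
      from perm_contract_merge[OF \<pi> this b'(2,1) us u, of n]
      obtain c where c: "\<And>i j. perm_contract n (us @ [u]) \<pi> i j =
        sconst c * perm_contract n (us[b - 1 := u @ us ! (b - 1)]) (\<pi> \<circ> transpose b (Suc (length us))) i j" by blast
      let ?us' = "us[b - 1 := u @ us ! (b - 1)]"
      let ?T = "mat n n (\<lambda>(i, j). perm_contract n ?us' (\<pi> \<circ> transpose b (Suc (length us))) i j)"
      have "mat n n (\<lambda>(i, j). perm_contract n ws \<pi> i j) = sconst c \<cdot>\<^sub>m ?T"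
        by (auto simp: ws c intro!: eq_matI)
      moreover have "?T \<in> trace_module e f n"
      proof (rule Suc.hyps(1))
        show "d = length ?us'" using d by simp
        fix w assume "w \<in> set ?us'"
        then have "w = u @ us ! (b - 1) \<or> w \<in> set us" by (metis in_set_conv_nth length_list_update nth_list_update_eq nth_list_update_neq)
        moreover have "set (us ! (b - 1)) \<subseteq> gvars e f" using \<open>1 \<le> b\<close> bd d by (intro us) auto
        ultimately show "set w \<subseteq> gvars e f" using us u by (elim disjE) auto
      qed (use \<pi>' in simp)
      ultimately show ?thesis by (simp add: trace_module_scalar)
    qed
  qed
qed

text \<open>The previous lemma applied to one-letter words.\<close>

lemma contract_permutations:
  assumes W: "\<And>w. w \<in> W \<Longrightarrow> set w \<subseteq> gvars e f"
  shows "mat n n (\<lambda>(i, j). contract n W (\<lambda>w p q. \<Sum>\<pi> | \<pi> permutes {..length w}. a w \<pi> * of_bool (p = q \<circ> \<pi>)) i j)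
    \<in> trace_module e f n"
proof -
  let ?S = "\<lambda>w. {\<pi>. \<pi> permutes {..length (w :: gvar list)}}"
  let ?I = "\<lambda>w. idx n (length (w :: gvar list))"
  let ?ws = "\<lambda>w. map (\<lambda>v. [v]) (w :: gvar list)"
  have x: "map (word_mat n) (?ws w) = map (gen_mat n) w" for w by (simp only: map_map o_def word_mat_single)
  have eq: "contract n W (\<lambda>w p q. \<Sum>\<pi>\<in>?S w. a w \<pi> * of_bool (p = q \<circ> \<pi>)) i j =
     (\<Sum>w\<in>W. \<Sum>\<pi>\<in>?S w. sconst (a w \<pi>) * perm_contract n (?ws w) \<pi> i j)" for i j
    unfolding contract_def
  proof (rule sum.cong[OF HOL.refl])
    fix w
    let ?x = "entry_prod (map (gen_mat n) w)"
    have "(\<Sum>p\<in>?I w. \<Sum>q\<in>?I w. of_bool (q 0 = i \<and> p 0 = j) * (sconst (\<Sum>\<pi>\<in>?S w. a w \<pi> * of_bool (p = q \<circ> \<pi>)) * ?x p q))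
      = (\<Sum>p\<in>?I w. \<Sum>q\<in>?I w. \<Sum>\<pi>\<in>?S w. of_bool (q 0 = i \<and> p 0 = j) * (sconst (a w \<pi> * of_bool (p = q \<circ> \<pi>)) * ?x p q))"
      by (simp only: sconst_sum sum_distrib_left sum_distrib_right)
    also have "\<dots> = (\<Sum>\<pi>\<in>?S w. \<Sum>q\<in>?I w. \<Sum>p\<in>?I w. of_bool (q 0 = i \<and> p 0 = j) * (sconst (a w \<pi> * of_bool (p = q \<circ> \<pi>)) * ?x p q))"
      by (rule HOL.trans[OF sum.swap], rule HOL.trans[OF sum.cong[OF HOL.refl sum.swap]], rule sum.swap)
    also have "\<dots> = (\<Sum>\<pi>\<in>?S w. \<Sum>q\<in>?I w. sconst (a w \<pi>) * (of_bool (q 0 = i \<and> q (\<pi> 0) = j) * ?x (q \<circ> \<pi>) q))"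
    proof (intro sum.cong HOL.refl)
      fix \<pi> q assume *: "\<pi> \<in> ?S w" "q \<in> ?I w"
      have "(\<Sum>p\<in>?I w. of_bool (q 0 = i \<and> p 0 = j) * (sconst (a w \<pi> * of_bool (p = q \<circ> \<pi>)) * ?x p q)) =
         (\<Sum>p\<in>?I w. if p = q \<circ> \<pi> then sconst (a w \<pi>) * (of_bool (q 0 = i \<and> q (\<pi> 0) = j) * ?x (q \<circ> \<pi>) q) else 0)"
        by (intro sum.cong HOL.refl) (auto simp: sconst_hom(1))
      then show "(\<Sum>p\<in>?I w. of_bool (q 0 = i \<and> p 0 = j) * (sconst (a w \<pi> * of_bool (p = q \<circ> \<pi>)) * ?x p q)) =
         sconst (a w \<pi>) * (of_bool (q 0 = i \<and> q (\<pi> 0) = j) * ?x (q \<circ> \<pi>) q)"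
        using * by (simp add: idx_permute)
    qed
    also have "\<dots> = (\<Sum>\<pi>\<in>?S w. sconst (a w \<pi>) * perm_contract n (?ws w) \<pi> i j)"
      unfolding perm_contract_def x by (simp only: sum_distrib_left length_map)
    finally show "(\<Sum>p\<in>?I w. \<Sum>q\<in>?I w. of_bool (q 0 = i \<and> p 0 = j) * (sconst (\<Sum>\<pi>\<in>?S w. a w \<pi> * of_bool (p = q \<circ> \<pi>)) * ?x p q))
      = (\<Sum>\<pi>\<in>?S w. sconst (a w \<pi>) * perm_contract n (?ws w) \<pi> i j)" .
  qed
  show ?thesis
    unfolding eq
  proof (intro trace_module_sum)
    fix w \<pi> assume w: "w \<in> W" "\<pi> \<in> ?S w"
    have "mat n n (\<lambda>(i, j). perm_contract n (?ws w) \<pi> i j) \<in> trace_module e f n"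
      by (rule perm_contract_trace_module) (use w W[OF w(1)] in auto)
    from trace_module_scalar[OF this, of "a w \<pi>"]
    have "sconst (a w \<pi>) \<cdot>\<^sub>m mat n n (\<lambda>(i, j). perm_contract n (?ws w) \<pi> i j) \<in> trace_module e f n" .
    moreover have "sconst (a w \<pi>) \<cdot>\<^sub>m mat n n (\<lambda>(i, j). perm_contract n (?ws w) \<pi> i j) =
      mat n n (\<lambda>(i, j). sconst (a w \<pi>) * perm_contract n (?ws w) \<pi> i j)" by (auto intro!: eq_matI)
    ultimately show "mat n n (\<lambda>(i, j). sconst (a w \<pi>) * perm_contract n (?ws w) \<pi> i j) \<in> trace_module e f n" by simp
  qed
qed

section \<open>Traces and words are equivariant\<close>

lemma spoly_hom_act: "g \<in> carrier (GL n) \<Longrightarrow> spoly_hom (act n g) e f n"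
  unfolding act_eq_msub by (intro spoly_hom_msub GL_inv_carrier)

lemma cmat_GL:
  assumes "g \<in> carrier (GL n)"
  shows "cmat g * cmat (inv\<^bsub>GL n\<^esub> g) = 1\<^sub>m n" "cmat (inv\<^bsub>GL n\<^esub> g) * cmat g = 1\<^sub>m n"
  using GL_inv_carrier[OF assms] by (simp_all add: cmat_one flip: cmat_mult)

text \<open>This form is linear and multiplicative in \<open>M\<close> at sight, and for generic matrices it is \<open>act_gen_mat\<close>.\<close>

lemma M_inv_iff:
  "M \<in> M_inv e f n \<longleftrightarrow> M \<in> carrier (M_alg e f n) \<and>
     (\<forall>g\<in>carrier (GL n). map_mat (act n g) M = cmat (inv\<^bsub>GL n\<^esub> g) * M * cmat g)"
proof -
  have "mat_act n g M = M \<longleftrightarrow> map_mat (act n g) M = cmat (inv\<^bsub>GL n\<^esub> g) * M * cmat g"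
    if M: "M \<in> carrier_mat n n" and g: "g \<in> carrier (GL n)" for M g
  proof -
    let ?g = "cmat g" and ?h = "cmat (inv\<^bsub>GL n\<^esub> g)" and ?N = "map_mat (act n g) M"
    have c: "?g \<in> carrier_mat n n" "?h \<in> carrier_mat n n" "?N \<in> carrier_mat n n"
      using GL_inv_carrier[OF g] M by auto
    have "?h * (?g * ?N * ?h) * ?g = (?h * ?g) * ?N * (?h * ?g)"
      using c by (simp add: assoc_mult_mat[of _ n n _ n _ n])
    then have 1: "?h * (?g * ?N * ?h) * ?g = ?N" using c by (simp add: cmat_GL[OF g])
    have "?g * (?h * M * ?g) * ?h = (?g * ?h) * M * (?g * ?h)"
      using c M by (simp add: assoc_mult_mat[of _ n n _ n _ n])
    then have 2: "?g * (?h * M * ?g) * ?h = M" using M by (simp add: cmat_GL[OF g])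
    show ?thesis unfolding mat_act_def using 1 2 by metis
  qed
  then show ?thesis unfolding M_inv_def by (auto simp: carrier_M_alg)
qed

lemma S_inv_closed:
  "1 \<in> S_inv e f n"
  "s \<in> S_inv e f n \<Longrightarrow> t \<in> S_inv e f n \<Longrightarrow> s + t \<in> S_inv e f n"
  "s \<in> S_inv e f n \<Longrightarrow> t \<in> S_inv e f n \<Longrightarrow> s * t \<in> S_inv e f n"
  "s \<in> S_inv e f n \<Longrightarrow> sconst c * s \<in> S_inv e f n"
  by (auto simp: S_inv_def spolys_closed spoly_hom.add[OF spoly_hom_act] spoly_hom.mult[OF spoly_hom_act]
      spoly_hom.one[OF spoly_hom_act] spoly_hom.sconst_mult[OF spoly_hom_act])

lemma M_inv_mult:
  assumes A: "A \<in> M_inv e f n" and B: "B \<in> M_inv e f n"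
  shows "A * B \<in> M_inv e f n"
  unfolding M_inv_iff
proof (intro conjI ballI)
  have AB: "A \<in> carrier (M_alg e f n)" "B \<in> carrier (M_alg e f n)" using A B by (auto simp: M_inv_iff)
  then show "A * B \<in> carrier (M_alg e f n)" by (rule M_alg_mult_closed)
  have c: "A \<in> carrier_mat n n" "B \<in> carrier_mat n n" using AB by (auto simp: carrier_M_alg)
  fix g assume g: "g \<in> carrier (GL n)"
  interpret spoly_hom "act n g" e f n by (rule spoly_hom_act[OF g])
  let ?g = "cmat g" and ?h = "cmat (inv\<^bsub>GL n\<^esub> g)"
  have gc: "?g \<in> carrier_mat n n" "?h \<in> carrier_mat n n" using GL_inv_carrier[OF g] by auto
  have "map_mat (act n g) (A * B) = (?h * A * ?g) * (?h * B * ?g)"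
    using A B g by (simp add: mat_mult[OF AB] M_inv_iff)
  also have "\<dots> = ?h * A * ((?g * ?h) * (B * ?g))"
    using gc c by (simp add: assoc_mult_mat[of _ n n _ n _ n])
  also have "\<dots> = ?h * (A * B) * ?g"
    unfolding cmat_GL[OF g] using gc c by (simp add: assoc_mult_mat[of _ n n _ n _ n])
  finally show "map_mat (act n g) (A * B) = ?h * (A * B) * ?g" .
qed

lemma M_inv_add:
  assumes A: "A \<in> M_inv e f n" and B: "B \<in> M_inv e f n"
  shows "A + B \<in> M_inv e f n"
  unfolding M_inv_iff
proof (intro conjI ballI)
  have AB: "A \<in> carrier (M_alg e f n)" "B \<in> carrier (M_alg e f n)" using A B by (auto simp: M_inv_iff)
  then show "A + B \<in> carrier (M_alg e f n)" by (auto simp: carrier_M_alg spolys_closed)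
  have c: "A \<in> carrier_mat n n" "B \<in> carrier_mat n n" using AB by (auto simp: carrier_M_alg)
  fix g assume g: "g \<in> carrier (GL n)"
  interpret spoly_hom "act n g" e f n by (rule spoly_hom_act[OF g])
  let ?g = "cmat g" and ?h = "cmat (inv\<^bsub>GL n\<^esub> g)"
  have gc: "?g \<in> carrier_mat n n" "?h \<in> carrier_mat n n" using GL_inv_carrier[OF g] by auto
  have "map_mat (act n g) (A + B) = map_mat (act n g) A + map_mat (act n g) B"
    using AB by (auto simp: carrier_M_alg add intro!: eq_matI)
  also have "\<dots> = ?h * A * ?g + ?h * B * ?g" using A B g by (simp add: M_inv_iff)
  also have "\<dots> = ?h * (A + B) * ?g"
    using gc c by (simp add: mult_add_distrib_mat[of _ n n] add_mult_distrib_mat[of _ n n])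
  finally show "map_mat (act n g) (A + B) = ?h * (A + B) * ?g" .
qed

lemma scalar_invariant:
  assumes s: "s \<in> S_inv e f n"
  shows "s \<cdot>\<^sub>m 1\<^sub>m n \<in> M_inv e f n"
  unfolding M_inv_iff
proof (intro conjI ballI)
  show "s \<cdot>\<^sub>m 1\<^sub>m n \<in> carrier (M_alg e f n)" using s by (auto simp: carrier_M_alg S_inv_def spolys_closed)
  fix g assume g: "g \<in> carrier (GL n)"
  interpret spoly_hom "act n g" e f n by (rule spoly_hom_act[OF g])
  let ?g = "cmat g" and ?h = "cmat (inv\<^bsub>GL n\<^esub> g)"
  have gc: "?g \<in> carrier_mat n n" "?h \<in> carrier_mat n n" using GL_inv_carrier[OF g] by auto
  have "?h * (s \<cdot>\<^sub>m 1\<^sub>m n) = s \<cdot>\<^sub>m ?h"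
    unfolding scalar_mat_mult(2)[OF gc(2)] by (rule eq_matI) (auto simp: sconst_central)
  also have "\<dots> = (s \<cdot>\<^sub>m 1\<^sub>m n) * ?h" by (rule scalar_mat_mult(1)[OF gc(2), symmetric])
  finally have "?h * (s \<cdot>\<^sub>m 1\<^sub>m n) * ?g = (s \<cdot>\<^sub>m 1\<^sub>m n) * (?h * ?g)"
    using gc by (simp add: assoc_mult_mat[of _ n n _ n _ n])
  also have "\<dots> = s \<cdot>\<^sub>m 1\<^sub>m n" by (simp add: cmat_GL[OF g] right_mult_one_mat[of _ n n])
  also have "\<dots> = map_mat (act n g) (s \<cdot>\<^sub>m 1\<^sub>m n)"
    using s g by (auto simp: S_inv_def zero intro!: eq_matI)
  finally show "map_mat (act n g) (s \<cdot>\<^sub>m 1\<^sub>m n) = ?h * (s \<cdot>\<^sub>m 1\<^sub>m n) * ?g" ..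
qed

lemma mtrace_cmat_commute:
  assumes "g \<in> carrier_mat n n" "X \<in> carrier_mat n n"
  shows "mtrace (cmat g * X) = mtrace (X * cmat g)"
proof -
  have c: "cmat g \<in> carrier_mat n n" using assms by simp
  have "mtrace (cmat g * X) = (\<Sum>i<n. \<Sum>k<n. cmat g $$ (i, k) * X $$ (k, i))"
    using assms c by (simp add: mtrace_carrier[of _ n] mat_mult_entry del: index_mult_mat)
  also have "\<dots> = (\<Sum>k<n. \<Sum>i<n. X $$ (k, i) * cmat g $$ (i, k))"
    using assms by (subst sum.swap) (auto simp: sconst_central intro!: sum.cong)
  also have "\<dots> = mtrace (X * cmat g)"
    using assms c by (simp add: mtrace_carrier[of _ n] mat_mult_entry del: index_mult_mat)
  finally show ?thesis .
qed

lemma mtrace_invariant: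
  assumes M: "M \<in> M_inv e f n"
  shows "mtrace M \<in> S_inv e f n"
  unfolding S_inv_def
proof (intro CollectI conjI ballI)
  have Mc: "M \<in> carrier (M_alg e f n)" using M by (simp add: M_inv_iff)
  then have c: "M \<in> carrier_mat n n" by (simp add: carrier_M_alg)
  show "mtrace M \<in> carrier (S_alg e f n)"
    using Mc by (auto simp: mtrace_carrier[OF c] carrier_M_alg intro: spolys_sum)
  fix g assume g: "g \<in> carrier (GL n)"
  interpret spoly_hom "act n g" e f n by (rule spoly_hom_act[OF g])
  let ?g = "cmat g" and ?h = "cmat (inv\<^bsub>GL n\<^esub> g)"
  have gc: "?g \<in> carrier_mat n n" "?h \<in> carrier_mat n n" using GL_inv_carrier[OF g] by auto
  have "act n g (mtrace M) = (\<Sum>i<n. act n g (M $$ (i, i)))"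
    unfolding mtrace_carrier[OF c] using Mc by (intro sum) (auto simp: carrier_M_alg)
  also have "\<dots> = mtrace (map_mat (act n g) M)"
    using c by (simp add: mtrace_carrier[of _ n])
  also have "\<dots> = mtrace (?h * (M * ?g))"
    using M g gc c by (simp add: M_inv_iff assoc_mult_mat[of _ n n _ n _ n])
  also have "\<dots> = mtrace (M * ?g * ?h)"
    using c gc GL_inv_carrier[OF g] by (intro mtrace_cmat_commute) auto
  also have "M * ?g * ?h = M * (?g * ?h)" using c gc by (rule assoc_mult_mat)
  also have "\<dots> = M" using c by (simp add: cmat_GL[OF g] right_mult_one_mat)
  finally show "act n g (mtrace M) = mtrace M" .
qed

lemma gen_mat_invariant: "v \<in> gvars e f \<Longrightarrow> gen_mat n v \<in> M_inv e f n"
  unfolding M_inv_iff by (auto simp: gen_mat_M_alg act_gen_mat)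

lemma one_invariant: "1\<^sub>m n \<in> M_inv e f n"
proof -
  have "1 \<cdot>\<^sub>m 1\<^sub>m n = (1\<^sub>m n :: spoly mat)" by (auto intro!: eq_matI)
  moreover have "1 \<cdot>\<^sub>m 1\<^sub>m n \<in> M_inv e f n" by (rule scalar_invariant[OF S_inv_closed(1)])
  ultimately show ?thesis by simp
qed

lemma word_mat_invariant: "set w \<subseteq> gvars e f \<Longrightarrow> word_mat n w \<in> M_inv e f n"
  by (induction w) (auto simp: one_invariant intro: M_inv_mult gen_mat_invariant)

lemma trace_algebra_subset_S_inv: "trace_algebra e f n \<subseteq> S_inv e f n"
proof
  fix s assume "s \<in> trace_algebra e f n"
  then show "s \<in> S_inv e f n"
    unfolding trace_algebra_def
    by (induction rule: subalgebra_generated.induct)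
      (auto simp: S_inv_closed mtrace_invariant word_mat_invariant)
qed

lemma trace_module_subset_M_inv: "trace_module e f n \<subseteq> M_inv e f n"
proof
  fix A assume "A \<in> trace_module e f n"
  then show "A \<in> M_inv e f n"
  proof (induction rule: trace_module.induct)
    case (word s w)
    then have "(s \<cdot>\<^sub>m 1\<^sub>m n) * word_mat n w \<in> M_inv e f n"
      by (intro M_inv_mult scalar_invariant word_mat_invariant trace_algebra_subset_S_inv[THEN subsetD])
    then show ?case by (simp add: scalar_mat_mult[OF word_mat_carrier])
  qed (rule M_inv_add)
qed

lemma M_inv_sconst:
  assumes "A \<in> M_inv e f n"
  shows "sconst c \<cdot>\<^sub>m A \<in> M_inv e f n"
proof -
  have "A \<in> carrier_mat n n" using assms by (simp add: M_inv_iff carrier_M_alg)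
  moreover have "sconst c \<in> S_inv e f n" using S_inv_closed(4)[OF S_inv_closed(1), of c e f n] by simp
  ultimately show ?thesis
    using M_inv_mult[OF scalar_invariant assms, of "sconst c"] by (simp add: scalar_mat_mult)
qed

section \<open>Every matrix over the polynomial superalgebra is a contraction\<close>

definition is_contraction :: "nat \<Rightarrow> nat \<Rightarrow> nat \<Rightarrow> (nat \<Rightarrow> nat \<Rightarrow> spoly) \<Rightarrow> bool" where
  "is_contraction e f n h \<longleftrightarrow> (\<exists>W c. finite W \<and> (\<forall>w\<in>W. set w \<subseteq> gvars e f) \<and>
     (\<forall>i<n. \<forall>j<n. h i j = contract n W c i j))"

lemma contract_add:
  "contract n W (\<lambda>w p q. c w p q + c' w p q) i j = contract n W c i j + contract n W c' i j"
  unfolding contract_def sum.distrib[symmetric] by (simp only: sconst_hom(3) distrib_left distrib_right)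

lemma contract_scale:
  "contract n W (\<lambda>w p q. a * c w p q) i j = sconst a * contract n W c i j"
  unfolding contract_def sum_distrib_left
  by (simp only: sconst_hom(4) mult.assoc sconst_left_commute[of "of_bool _"])

lemma contract_mono:
  assumes "finite W'" "W \<subseteq> W'"
  shows "contract n W' (\<lambda>w p q. if w \<in> W then c w p q else 0) i j = contract n W c i j"
  unfolding contract_def
  by (rule sum.mono_neutral_cong_right) (use assms in \<open>auto simp: sconst_hom(1)\<close>)

lemma is_contraction_add:
  assumes "is_contraction e f n h" "is_contraction e f n h'"
  shows "is_contraction e f n (\<lambda>i j. h i j + h' i j)"
proof -
  obtain W c W' c' where W: "finite W" "\<forall>w\<in>W. set w \<subseteq> gvars e f" "\<forall>i<n. \<forall>j<n. h i j = contract n W c i j"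
    and W': "finite W'" "\<forall>w\<in>W'. set w \<subseteq> gvars e f" "\<forall>i<n. \<forall>j<n. h' i j = contract n W' c' i j"
    using assms unfolding is_contraction_def by metis
  have "\<forall>i<n. \<forall>j<n. h i j + h' i j = contract n (W \<union> W')
     (\<lambda>w p q. (if w \<in> W then c w p q else 0) + (if w \<in> W' then c' w p q else 0)) i j"
    using W W' by (simp only: contract_add contract_mono finite_UnI Un_upper1 Un_upper2) simp
  with W W' show ?thesis unfolding is_contraction_def
    by (intro exI[of _ "W \<union> W'"] exI conjI) auto
qed

lemma is_contraction_zero: "is_contraction e f n (\<lambda>i j. 0)"
  unfolding is_contraction_def by (intro exI[of _ "{}"] exI conjI) (auto simp: contract_def)

lemma is_contraction_sum:
  "(\<And>x. x \<in> I \<Longrightarrow> is_contraction e f n (h x)) \<Longrightarrow> is_contraction e f n (\<lambda>i j. \<Sum>x\<in>I. h x i j)"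
  by (induction I rule: infinite_finite_induct) (auto simp: is_contraction_zero intro: is_contraction_add)

lemma sum_singleton: "(\<Sum>x\<in>{a}. F x) = (F a :: 'b :: comm_monoid_add)"
  by simp

text \<open>One word and one pair of multi-indices suffice, with the matrix indices placed at the position \<open>0\<close>.\<close>

lemma is_contraction_word:
  assumes u: "u \<in> lists (ents e f n)" and i0: "i0 < n" and j0: "j0 < n"
  shows "is_contraction e f n (\<lambda>i j. of_bool (i = i0 \<and> j = j0) * (sconst a * prod_list (map (ent n) u)))"
proof -
  define w where "w = map fst u"
  define d where "d = length u"
  define p0 where "p0 t = (if t = 0 then j0 else if t \<le> d then fst (snd (u ! (t - 1))) else undefined)" for t
  define q0 where "q0 t = (if t = 0 then i0 else if t \<le> d then snd (snd (u ! (t - 1))) else undefined)" for t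
  have ut: "u ! (t - 1) \<in> ents e f n" if "t \<noteq> 0" "t \<le> d" for t
    using u that by (auto simp: d_def in_lists_conv_set)
  have ut': "fst (snd (u ! (t - 1))) < n" "snd (snd (u ! (t - 1))) < n" if "t \<noteq> 0" "t \<le> d" for t
    using ut[OF that] by (auto simp: ents_def)
  have p0: "p0 \<in> idx n d" and q0: "q0 \<in> idx n d"
    using ut' i0 j0 by (simp_all add: idx_def PiE_def Pi_def extensional_def p0_def q0_def)
  have lw: "length w = d" by (simp add: w_def d_def)
  have x: "entry_prod (map (gen_mat n) w) p0 q0 = prod_list (map (ent n) u)"
    unfolding entry_prod_gen
    by (rule arg_cong[where f = prod_list], rule nth_equalityI)
      (auto simp: lw d_def w_def ent_def p0_def q0_def split_beta nth_append simp del: upt_Suc)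
  have "contract n {w} (\<lambda>w p q. if p = p0 \<and> q = q0 then a else 0) i j =
     of_bool (i = i0 \<and> j = j0) * (sconst a * prod_list (map (ent n) u))" for i j
  proof -
    have "contract n {w} (\<lambda>w p q. if p = p0 \<and> q = q0 then a else 0) i j =
      (\<Sum>p\<in>idx n d. \<Sum>q\<in>idx n d. of_bool (q 0 = i \<and> p 0 = j) *
         (sconst (if p = p0 \<and> q = q0 then a else 0) * entry_prod (map (gen_mat n) w) p q))"
      unfolding contract_def by (simp only: lw sum_singleton)
    also have "\<dots> = (\<Sum>p\<in>idx n d. \<Sum>q\<in>idx n d. if q = q0 then (if p = p0 then
         of_bool (q0 0 = i \<and> p0 0 = j) * (sconst a * entry_prod (map (gen_mat n) w) p0 q0) else 0) else 0)"
      by (intro sum.cong HOL.refl) (auto simp: sconst_hom(1))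
    also have "\<dots> = of_bool (q0 0 = i \<and> p0 0 = j) * (sconst a * entry_prod (map (gen_mat n) w) p0 q0)"
      using p0 q0 by simp
    also have "of_bool (q0 0 = i \<and> p0 0 = j) = (of_bool (i = i0 \<and> j = j0) :: spoly)"
      by (auto simp: p0_def q0_def)
    finally show ?thesis by (simp only: x)
  qed
  moreover have "set w \<subseteq> gvars e f" using u by (auto simp: w_def ents_def)
  ultimately show ?thesis unfolding is_contraction_def
    by (intro exI[of _ "{w}"] exI[of _ "\<lambda>w p q. if p = p0 \<and> q = q0 then a else 0"]) auto
qed

lemma M_alg_is_contraction:
  assumes M: "M \<in> carrier (M_alg e f n)"
  shows "is_contraction e f n (\<lambda>i j. M $$ (i, j))"
proof -
  have single: "is_contraction e f n (\<lambda>i j. of_bool (i = i0 \<and> j = j0) * s)"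
    if "s \<in> spolys e f n" "i0 < n" "j0 < n" for s i0 j0
    using that(1)
  proof (induction rule: spolys_word_induct)
    case (add s t)
    then show ?case using is_contraction_add[OF add] by (simp only: distrib_left)
  qed (use that in \<open>auto simp: is_contraction_zero intro: is_contraction_word\<close>)
  have "is_contraction e f n (\<lambda>i j. \<Sum>i0<n. \<Sum>j0<n. of_bool (i = i0 \<and> j = j0) * M $$ (i0, j0))"
    using M by (intro is_contraction_sum single) (auto simp: carrier_M_alg)
  moreover have "(\<Sum>i0<n. \<Sum>j0<n. of_bool (i = i0 \<and> j = j0) * M $$ (i0, j0)) = M $$ (i, j)" if "i < n" "j < n" for i j
  proof -
    have "(\<Sum>i0<n. \<Sum>j0<n. of_bool (i = i0 \<and> j = j0) * M $$ (i0, j0)) =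
       (\<Sum>i0<n. \<Sum>j0<n. if j0 = j then (if i0 = i then M $$ (i, j) else 0) else 0)"
      by (intro sum.cong HOL.refl) auto
    then show ?thesis using that by simp
  qed
  ultimately show ?thesis unfolding is_contraction_def by simp
qed

section \<open>Invariant tensors are combinations of permutations\<close>

lemma det_nonzero_GL: "g \<in> carrier_mat n n \<Longrightarrow> det g \<noteq> 0 \<Longrightarrow> g \<in> carrier (GL n)"
  using det_non_zero_imp_unit[of g n "()"] by (simp add: GL_def units_of_def)

text \<open>The index set for families of operators, one for each word of \<open>W\<close>. The words have to be treated together, because
reordering the letters of a word produces linear relations between different words.\<close>

definition positions :: "nat \<Rightarrow> gvar list set \<Rightarrow> (gvar list \<times> (nat \<Rightarrow> nat) \<times> (nat \<Rightarrow> nat)) set" where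
  "positions n W = (SIGMA w:W. idx n (length w) \<times> idx n (length w))"

lemma finite_positions: "finite W \<Longrightarrow> finite (positions n W)"
  by (auto simp: positions_def)

lemma sum_positions:
  "finite W \<Longrightarrow> (\<Sum>z\<in>positions n W. F z) = (\<Sum>w\<in>W. \<Sum>p\<in>idx n (length w). \<Sum>q\<in>idx n (length w). F (w, p, q))"
  unfolding positions_def by (simp add: sum.Sigma sum.cartesian_product split_beta)

abbreviation family :: "(gvar list \<times> (nat \<Rightarrow> nat) \<times> (nat \<Rightarrow> nat) \<Rightarrow> complex) \<Rightarrow>
    gvar list \<Rightarrow> (nat \<Rightarrow> nat) \<Rightarrow> (nat \<Rightarrow> nat) \<Rightarrow> complex" where
  "family x \<equiv> \<lambda>w p q. x (w, p, q)"

definition contract_relations :: "nat \<Rightarrow> gvar list set \<Rightarrow> (gvar list \<times> (nat \<Rightarrow> nat) \<times> (nat \<Rightarrow> nat) \<Rightarrow> complex) set" where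
  "contract_relations n W = {x. \<forall>i<n. \<forall>j<n. contract n W (family x) i j = 0}"

definition perm_family :: "(gvar list \<Rightarrow> (nat \<Rightarrow> nat) \<Rightarrow> complex) \<Rightarrow>
    gvar list \<times> (nat \<Rightarrow> nat) \<times> (nat \<Rightarrow> nat) \<Rightarrow> complex" where
  "perm_family a = (\<lambda>(w, p, q). \<Sum>\<pi> | \<pi> permutes {..length w}. a w \<pi> * of_bool (p = q \<circ> \<pi>))"

definition left_kron :: "nat \<Rightarrow> complex mat \<Rightarrow> (gvar list \<times> (nat \<Rightarrow> nat) \<times> (nat \<Rightarrow> nat) \<Rightarrow> complex) \<Rightarrow>
    gvar list \<times> (nat \<Rightarrow> nat) \<times> (nat \<Rightarrow> nat) \<Rightarrow> complex" where
  "left_kron n g x = (\<lambda>(w, p, q). \<Sum>k\<in>idx n (length w). kron (length w) g k p * x (w, k, q))"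

definition right_kron :: "nat \<Rightarrow> complex mat \<Rightarrow> (gvar list \<times> (nat \<Rightarrow> nat) \<times> (nat \<Rightarrow> nat) \<Rightarrow> complex) \<Rightarrow>
    gvar list \<times> (nat \<Rightarrow> nat) \<times> (nat \<Rightarrow> nat) \<Rightarrow> complex" where
  "right_kron n g x = (\<lambda>(w, p, q). \<Sum>k\<in>idx n (length w). x (w, p, k) * kron (length w) g q k)"

text \<open>The contraction of the product is obtained from the contraction of \<open>x\<close> by a substitution, which maps \<open>0\<close> to
\<open>0\<close>, and a multiplication by \<open>g\<close>.\<close>

lemma contract_relations_kron:
  assumes g: "g \<in> carrier_mat n n" and W: "\<And>w. w \<in> W \<Longrightarrow> set w \<subseteq> gvars e f" and x: "x \<in> contract_relations n W"
  shows "left_kron n g x \<in> contract_relations n W" "right_kron n g x \<in> contract_relations n W"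
proof -
  interpret l: spoly_hom "msub n g (1\<^sub>m n)" e f n using g by (intro spoly_hom_msub) auto
  interpret r: spoly_hom "msub n (1\<^sub>m n) g" e f n using g by (intro spoly_hom_msub) auto
  show "left_kron n g x \<in> contract_relations n W"
    unfolding contract_relations_def
  proof (intro CollectI allI impI)
    fix i l assume il: "i < n" "l < n"
    have "contract n W (family (left_kron n g x)) i l = (\<Sum>j<n. msub n g (1\<^sub>m n) (contract n W (family x) i j) * sconst (g $$ (j, l)))"
      by (simp add: contract_left_mult[OF g W il] left_kron_def)
    also have "\<dots> = 0" using x il by (simp add: contract_relations_def l.zero)
    finally show "contract n W (family (left_kron n g x)) i l = 0" .
  qed
  show "right_kron n g x \<in> contract_relations n W"
    unfolding contract_relations_def
  proof (intro CollectI allI impI)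
    fix i l assume il: "i < n" "l < n"
    have "contract n W (family (right_kron n g x)) i l = (\<Sum>j<n. sconst (g $$ (i, j)) * msub n (1\<^sub>m n) g (contract n W (family x) j l))"
      by (simp add: contract_right_mult[OF g W il] right_kron_def)
    also have "\<dots> = 0" using x il by (simp add: contract_relations_def r.zero)
    finally show "contract n W (family (right_kron n g x)) i l = 0" .
  qed
qed

definition conj_transpose :: "nat \<Rightarrow> complex mat \<Rightarrow> complex mat" where
  "conj_transpose n g = mat n n (\<lambda>(i, j). cnj (g $$ (j, i)))"

lemma kron_conj_transpose: "p \<in> idx n d \<Longrightarrow> q \<in> idx n d \<Longrightarrow> kron d (conj_transpose n g) p q = cnj (kron d g q p)"
  unfolding kron_def conj_transpose_def by (auto simp: idx_less intro!: prod.cong)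

lemma left_kron_adjoint:
  assumes "finite W"
  shows "(\<Sum>z\<in>positions n W. left_kron n g x z * cnj (v z)) = (\<Sum>z\<in>positions n W. x z * cnj (left_kron n (conj_transpose n g) v z))"
proof -
  let ?I = "\<lambda>w. idx n (length (w :: gvar list))"
  have "(\<Sum>z\<in>positions n W. left_kron n g x z * cnj (v z)) =
     (\<Sum>w\<in>W. \<Sum>p\<in>?I w. \<Sum>q\<in>?I w. \<Sum>k\<in>?I w. kron (length w) g k p * x (w, k, q) * cnj (v (w, p, q)))"
    by (simp add: sum_positions[OF assms] left_kron_def sum_distrib_right)
  also have "\<dots> = (\<Sum>w\<in>W. \<Sum>k\<in>?I w. \<Sum>q\<in>?I w. \<Sum>p\<in>?I w. kron (length w) g k p * x (w, k, q) * cnj (v (w, p, q)))"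
    by (rule sum.cong[OF HOL.refl], rule HOL.trans[OF sum.cong[OF HOL.refl sum.swap]],
        rule HOL.trans[OF sum.swap], rule sum.cong[OF HOL.refl], rule sum.swap)
  also have "\<dots> = (\<Sum>w\<in>W. \<Sum>k\<in>?I w. \<Sum>q\<in>?I w. \<Sum>p\<in>?I w. x (w, k, q) * cnj (kron (length w) (conj_transpose n g) p k * v (w, p, q)))"
    by (intro sum.cong HOL.refl) (simp add: kron_conj_transpose)
  also have "\<dots> = (\<Sum>z\<in>positions n W. x z * cnj (left_kron n (conj_transpose n g) v z))"
    by (simp add: sum_positions[OF assms] left_kron_def sum_distrib_left)
  finally show ?thesis .
qed

lemma right_kron_adjoint:
  assumes "finite W"
  shows "(\<Sum>z\<in>positions n W. right_kron n g x z * cnj (v z)) = (\<Sum>z\<in>positions n W. x z * cnj (right_kron n (conj_transpose n g) v z))"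
proof -
  let ?I = "\<lambda>w. idx n (length (w :: gvar list))"
  have "(\<Sum>z\<in>positions n W. right_kron n g x z * cnj (v z)) =
     (\<Sum>w\<in>W. \<Sum>p\<in>?I w. \<Sum>q\<in>?I w. \<Sum>k\<in>?I w. x (w, p, k) * kron (length w) g q k * cnj (v (w, p, q)))"
    by (simp add: sum_positions[OF assms] right_kron_def sum_distrib_right)
  also have "\<dots> = (\<Sum>w\<in>W. \<Sum>p\<in>?I w. \<Sum>k\<in>?I w. \<Sum>q\<in>?I w. x (w, p, k) * kron (length w) g q k * cnj (v (w, p, q)))"
    by (rule sum.cong[OF HOL.refl], rule sum.cong[OF HOL.refl], rule sum.swap)
  also have "\<dots> = (\<Sum>w\<in>W. \<Sum>p\<in>?I w. \<Sum>k\<in>?I w. \<Sum>q\<in>?I w. x (w, p, k) * cnj (v (w, p, q) * kron (length w) (conj_transpose n g) k q))"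
    by (intro sum.cong HOL.refl) (simp add: kron_conj_transpose)
  also have "\<dots> = (\<Sum>z\<in>positions n W. x z * cnj (right_kron n (conj_transpose n g) v z))"
    by (simp add: sum_positions[OF assms] right_kron_def sum_distrib_left)
  finally show ?thesis .
qed

text \<open>Equivariance of a contraction is commutation of the coefficients with the tensor powers of \<open>g\<close>, modulo relations.\<close>

lemma invariant_contraction_relation:
  assumes g: "g \<in> carrier (GL n)" and W: "\<And>w. w \<in> W \<Longrightarrow> set w \<subseteq> gvars e f"
    and inv: "mat n n (\<lambda>(i, j). contract n W (family r) i j) \<in> M_inv e f n"
  shows "(\<lambda>z. left_kron n g r z - right_kron n g r z) \<in> contract_relations n W"
  unfolding contract_relations_def
proof (intro CollectI allI impI)
  fix i l assume il: "i < n" "l < n"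
  note gc = GL_inv_carrier[OF g]
  let ?R = "mat n n (\<lambda>(i, j). contract n W (family r) i j)"
  have "contract n W (family (left_kron n g r)) i l = (\<Sum>j<n. msub n g (1\<^sub>m n) (contract n W (family r) i j) * sconst (g $$ (j, l)))"
    by (simp add: contract_left_mult[OF gc(1) W il] left_kron_def)
  also have "\<dots> = (map_mat (msub n g (1\<^sub>m n)) ?R * cmat g) $$ (i, l)"
    using il gc(1) by (subst mat_mult_entry[of _ n]) auto
  also have "map_mat (msub n g (1\<^sub>m n)) ?R * cmat g = cmat g * map_mat (msub n (1\<^sub>m n) g) ?R"
    by (rule equivariant_left_right[OF inv gc])
  also have "\<dots> $$ (i, l) = (\<Sum>j<n. sconst (g $$ (i, j)) * msub n (1\<^sub>m n) g (contract n W (family r) j l))"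
    using il gc(1) by (subst mat_mult_entry[of _ n]) auto
  also have "\<dots> = contract n W (family (right_kron n g r)) i l"
    by (simp add: contract_right_mult[OF gc(1) W il] right_kron_def)
  finally have "contract n W (family (left_kron n g r)) i l = contract n W (family (right_kron n g r)) i l" .
  then show "contract n W (family (\<lambda>z. left_kron n g r z - right_kron n g r z)) i l = 0"
    using contract_add[of n W "family (left_kron n g r)" "\<lambda>w p q. (-1) * right_kron n g r (w, p, q)" i l]
      contract_scale[of n W "-1" "family (right_kron n g r)" i l]
    by (simp add: sconst_hom)
qed

lemma sum_cnj_zero:
  assumes "finite A" "(\<Sum>z\<in>A. D z * cnj (D z)) = 0" "z \<in> A"
  shows "D z = 0"
proof -
  have "(\<Sum>z\<in>A. D z * cnj (D z)) = complex_of_real (\<Sum>z\<in>A. (cmod (D z))\<^sup>2)"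
    by (simp add: complex_norm_square del: of_real_power)
  then have "(\<Sum>z\<in>A. (cmod (D z))\<^sup>2) = 0" using assms(2) by (metis of_real_eq_0_iff)
  then show ?thesis using assms(1,3) by (subst (asm) sum_nonneg_eq_0_iff) auto
qed

text \<open>Let \<open>r\<close> be the component of the coefficients of \<open>M\<close> orthogonal to the relations and to the permutations. Its
contraction \<open>R\<close> is again equivariant, since \<open>M - R\<close> is a combination of traces and words. Hence \<open>r\<close> commutes with
all tensor powers, first modulo relations and then exactly by orthogonality, and \<open>r\<close> is \<open>0\<close> by
\<open>commutant_orthogonal_permutations\<close>.\<close>

lemma M_inv_subset_trace_module: "M_inv e f n \<subseteq> trace_module e f n"
proof
  fix M assume M: "M \<in> M_inv e f n"
  then have Mc: "M \<in> carrier (M_alg e f n)" by (simp add: M_inv_iff)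
  then have Mm: "M \<in> carrier_mat n n" by (simp add: carrier_M_alg)
  obtain W c where fin: "finite W" and W: "\<And>w. w \<in> W \<Longrightarrow> set w \<subseteq> gvars e f"
    and c: "\<And>i j. i < n \<Longrightarrow> j < n \<Longrightarrow> M $$ (i, j) = contract n W c i j"
    using M_alg_is_contraction[OF Mc] unfolding is_contraction_def by blast
  let ?\<Omega> = "positions n W"
  \<comment> \<open>The two ways in which coefficients are accounted for: relations contract to \<open>0\<close>, permutations to
    traces and words.\<close>
  define U where "U = {\<lambda>z. y z + perm_family a z | y a. y \<in> contract_relations n W}"
  have rel0: "(\<lambda>_. 0) \<in> contract_relations n W" by (simp add: contract_relations_def contract_def sconst_hom(1))
  have rel_add: "(\<lambda>z. x z + y z) \<in> contract_relations n W" if "x \<in> contract_relations n W" "y \<in> contract_relations n W" for x y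
    using that by (simp add: contract_relations_def contract_add)
  have rel_scale: "(\<lambda>z. b * x z) \<in> contract_relations n W" if "x \<in> contract_relations n W" for x b
    using that by (simp add: contract_relations_def contract_scale)
  have perm0: "perm_family (\<lambda>_ _. 0) = (\<lambda>_. 0)" by (auto simp: perm_family_def)
  have perm_add: "perm_family a z + perm_family b z = perm_family (\<lambda>w \<pi>. a w \<pi> + b w \<pi>) z" for a b z
    by (cases z) (simp add: perm_family_def sum.distrib distrib_right)
  have perm_scale: "t * perm_family a z = perm_family (\<lambda>w \<pi>. t * a w \<pi>) z" for a t z
    by (cases z) (simp add: perm_family_def sum_distrib_left mult.assoc)
  have rel_U: "y \<in> U" if "y \<in> contract_relations n W" for y
    unfolding U_def using that perm0 by (intro CollectI exI[of _ y] exI[of _ "\<lambda>_ _. 0"]) auto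
  have perm_U: "perm_family a \<in> U" for a
    unfolding U_def using rel0 by (intro CollectI exI[of _ "\<lambda>_. 0"] exI[of _ a]) auto
  have "\<exists>u\<in>U. \<forall>v\<in>U. (\<Sum>z\<in>?\<Omega>. (case z of (w, p, q) \<Rightarrow> c w p q - u (w, p, q)) * cnj (v z)) = 0"
  proof -
    have "\<exists>u\<in>U. \<forall>v\<in>U. (\<Sum>z\<in>?\<Omega>. ((case z of (w, p, q) \<Rightarrow> c w p q) - u z) * cnj (v z)) = 0"
    proof (rule orthogonal_projection_exists[OF finite_positions[OF fin]])
      show "(\<lambda>_. 0) \<in> U" using rel_U rel0 by blast
      fix u v assume "u \<in> U" "v \<in> U"
      then obtain y a y' a' where "y \<in> contract_relations n W" "u = (\<lambda>z. y z + perm_family a z)"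
        "y' \<in> contract_relations n W" "v = (\<lambda>z. y' z + perm_family a' z)" unfolding U_def by blast
      then show "(\<lambda>z. u z + v z) \<in> U"
        unfolding U_def
        by (intro CollectI exI[of _ "\<lambda>z. y z + y' z"] exI[of _ "\<lambda>w \<pi>. a w \<pi> + a' w \<pi>"])
          (simp add: rel_add perm_add[symmetric] add_ac)
    next
      fix u t assume "u \<in> U"
      then obtain y a where "y \<in> contract_relations n W" "u = (\<lambda>z. y z + perm_family a z)" unfolding U_def by blast
      then show "(\<lambda>z. t * u z) \<in> U"
        unfolding U_def
        by (intro CollectI exI[of _ "\<lambda>z. t * y z"] exI[of _ "\<lambda>w \<pi>. t * a w \<pi>"])
          (simp add: rel_scale perm_scale[symmetric] distrib_left)
    qed
    then show ?thesis by (simp add: split_beta)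
  qed
  then obtain u where u: "u \<in> U"
    and orth: "\<And>v. v \<in> U \<Longrightarrow> (\<Sum>z\<in>?\<Omega>. (case z of (w, p, q) \<Rightarrow> c w p q - u (w, p, q)) * cnj (v z)) = 0" by blast
  obtain y a where y: "y \<in> contract_relations n W" and u_eq: "u = (\<lambda>z. y z + perm_family a z)"
    using u unfolding U_def by blast
  define r where "r z = (case z of (w, p, q) \<Rightarrow> c w p q - u (w, p, q))" for z
  have r_orth: "(\<Sum>z\<in>?\<Omega>. r z * cnj (v z)) = 0" if "v \<in> U" for v
    using orth[OF that] by (simp add: r_def)
  define P where "P = mat n n (\<lambda>(i, j). contract n W (family (perm_family a)) i j)"
  have P: "P \<in> trace_module e f n"
    using contract_permutations[OF W, where a = a] by (simp add: P_def perm_family_def)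
  have Pm: "P \<in> carrier_mat n n" by (simp add: P_def)
  define R where "R = mat n n (\<lambda>(i, j). contract n W (family r) i j)"
  have c_eq: "contract n W c i j = contract n W (family r) i j + contract n W (family (perm_family a)) i j"
    if "i < n" "j < n" for i j
  proof -
    have "c = (\<lambda>w p q. family r w p q + (family y w p q + family (perm_family a) w p q))"
      by (intro ext) (simp add: r_def u_eq)
    then have "contract n W c i j = contract n W (family r) i j + (contract n W (family y) i j + contract n W (family (perm_family a)) i j)"
      by (simp only: contract_add)
    then show ?thesis using y that by (simp add: contract_relations_def)
  qed
  have MRP: "M = R + P" using Mm c c_eq by (auto simp: R_def P_def intro!: eq_matI)
  have R_inv: "R \<in> M_inv e f n"
  proof -
    have "R = M + sconst (-1) \<cdot>\<^sub>m P"
      by (rule eq_matI) (use Mm Pm c c_eq in \<open>auto simp: R_def P_def sconst_hom\<close>)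
    moreover have "P \<in> M_inv e f n" using P trace_module_subset_M_inv by blast
    ultimately show ?thesis using M by (simp only: M_inv_add M_inv_sconst)
  qed
  have commute: "left_kron n g r z = right_kron n g r z" if g: "g \<in> carrier (GL n)" and z: "z \<in> ?\<Omega>" for g z
  proof -
    \<comment> \<open>\<open>D\<close> is a relation; moving the factors \<open>g\<close> over to the other argument shows that \<open>D\<close> is also
      orthogonal to all relations, in particular to itself.\<close>
    define D where "D z = left_kron n g r z - right_kron n g r z" for z
    have D: "D \<in> contract_relations n W"
      using invariant_contraction_relation[OF g W R_inv[unfolded R_def]] by (simp add: D_def[abs_def])
    have conj_transpose: "conj_transpose n g \<in> carrier_mat n n" by (simp add: conj_transpose_def)
    have "(\<Sum>z\<in>?\<Omega>. D z * cnj (D z)) =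
       (\<Sum>z\<in>?\<Omega>. left_kron n g r z * cnj (D z)) - (\<Sum>z\<in>?\<Omega>. right_kron n g r z * cnj (D z))"
      by (simp add: D_def left_diff_distrib sum_subtractf)
    also have "\<dots> = 0"
      unfolding left_kron_adjoint[OF fin] right_kron_adjoint[OF fin]
      using contract_relations_kron[OF conj_transpose W D] by (simp add: r_orth rel_U)
    finally have "D z = 0" by (rule sum_cnj_zero[OF finite_positions[OF fin] _ z])
    then show ?thesis by (simp add: D_def)
  qed
  have r0: "r (w, p, q) = 0" if w: "w \<in> W" and p: "p \<in> idx n (length w)" and q: "q \<in> idx n (length w)" for w p q
  proof (rule commutant_orthogonal_permutations[where r = "\<lambda>p q. r (w, p, q)", OF _ _ p q])
    fix g :: "complex mat" assume "g \<in> carrier_mat n n"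
    then show "kron_commute n (length w) (\<lambda>p q. r (w, p, q)) g"
    proof (rule kron_commute_dense[rotated])
      fix h :: "complex mat" assume h: "h \<in> carrier_mat n n" "det h \<noteq> 0"
      \<comment> \<open>The multiplications of coefficients use the transposed matrix.\<close>
      have gl: "transpose_mat h \<in> carrier (GL n)"
        by (rule det_nonzero_GL) (use h det_transpose[OF h(1)] in auto)
      have tr: "kron (length w) (transpose_mat h) p' q' = kron (length w) h q' p'"
        if "p' \<in> idx n (length w)" "q' \<in> idx n (length w)" for p' q'
        unfolding kron_def using that h by (intro prod.cong) (auto simp: idx_less)
      show "kron_commute n (length w) (\<lambda>p q. r (w, p, q)) h"
        unfolding kron_commute_def
      proof (intro ballI)
        fix p' q' assume pq: "p' \<in> idx n (length w)" "q' \<in> idx n (length w)"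
        then have "(w, p', q') \<in> ?\<Omega>" using w by (simp add: positions_def)
        from commute[OF gl this] show "(\<Sum>k\<in>idx n (length w). kron (length w) h p' k * r (w, k, q')) =
            (\<Sum>k\<in>idx n (length w). r (w, p', k) * kron (length w) h k q')"
          using pq by (simp add: left_kron_def right_kron_def tr)
      qed
    qed
  next
    fix \<pi> assume \<pi>: "\<pi> permutes {..length w}"
    \<comment> \<open>Orthogonality to the single permutation \<open>\<pi>\<close> at the single word \<open>w\<close>.\<close>
    define b where "b w' \<pi>' = (of_bool (w' = w \<and> \<pi>' = \<pi>) :: complex)" for w' \<pi>'
    have pf: "perm_family b (w', p', q') = (if w' = w then of_bool (p' = q' \<circ> \<pi>) else 0)" for w' p' q'
    proof (cases "w' = w")
      case True
      have "perm_family b (w', p', q') = (\<Sum>\<pi>' | \<pi>' permutes {..length w}. if \<pi>' = \<pi> then of_bool (p' = q' \<circ> \<pi>) else 0)"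
        unfolding perm_family_def b_def prod.case using True by (intro sum.cong) auto
      then show ?thesis using True \<pi> by (simp add: finite_permutations)
    qed (simp add: perm_family_def b_def)
    have cnj_pf: "cnj (perm_family b (w', p', q')) = (if w' = w then of_bool (p' = q' \<circ> \<pi>) else 0)" for w' p' q'
      by (simp add: pf)
    have "0 = (\<Sum>z\<in>?\<Omega>. r z * cnj (perm_family b z))" using r_orth[OF perm_U] by simp
    also have "\<dots> = (\<Sum>w'\<in>W. if w' = w then (\<Sum>p\<in>idx n (length w). \<Sum>q\<in>idx n (length w). r (w, p, q) * of_bool (p = q \<circ> \<pi>)) else 0)"
      unfolding sum_positions[OF fin] cnj_pf by (intro sum.cong HOL.refl) simp
    also have "\<dots> = (\<Sum>q\<in>idx n (length w). \<Sum>p\<in>idx n (length w). r (w, p, q) * of_bool (p = q \<circ> \<pi>))"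
      unfolding sum.delta[OF fin] if_P[OF w] by (rule sum.swap)
    also have "\<dots> = (\<Sum>q\<in>idx n (length w). \<Sum>p\<in>idx n (length w). if p = q \<circ> \<pi> then r (w, q \<circ> \<pi>, q) else 0)"
      by (intro sum.cong HOL.refl) auto
    also have "\<dots> = (\<Sum>q\<in>idx n (length w). r (w, q \<circ> \<pi>, q))"
      using \<pi> by (intro sum.cong HOL.refl) (simp add: idx_permute)
    finally show "(\<Sum>q\<in>idx n (length w). r (w, q \<circ> \<pi>, q)) = 0" ..
  qed
  have "R = 0\<^sub>m n n"
    unfolding R_def contract_def by (rule eq_matI) (auto simp: r0 sconst_hom(1) intro!: sum.neutral)
  then show "M \<in> trace_module e f n" using MRP P Pm by simp
qed

text \<open>An invariant \<open>s\<close> is recovered from the equivariant scalar matrix as its trace divided by \<open>n\<close>.\<close>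

theorem S_inv_eq_trace_algebra:
  assumes n: "n \<ge> 1"
  shows "S_inv e f n = trace_algebra e f n"
proof
  show "trace_algebra e f n \<subseteq> S_inv e f n" by (rule trace_algebra_subset_S_inv)
  show "S_inv e f n \<subseteq> trace_algebra e f n"
  proof
    fix s assume "s \<in> S_inv e f n"
    then have "mtrace (s \<cdot>\<^sub>m 1\<^sub>m n) \<in> trace_algebra e f n"
      by (intro mtrace_trace_module M_inv_subset_trace_module[THEN subsetD] scalar_invariant)
    moreover have "mtrace (s \<cdot>\<^sub>m 1\<^sub>m n) = sconst (of_nat n) * s"
    proof -
      have "sconst (of_nat m) = of_nat m" for m by (induction m) (auto simp: sconst_hom)
      moreover have "mtrace (s \<cdot>\<^sub>m 1\<^sub>m n) = of_nat n * s" by (simp add: mtrace_def)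
      ultimately show ?thesis by simp
    qed
    ultimately have "sconst (1 / of_nat n) * (sconst (of_nat n) * s) \<in> trace_algebra e f n"
      by (simp add: trace_algebra_closed)
    moreover have "sconst (1 / of_nat n) * (sconst (of_nat n) * s) = s"
      using n by (simp flip: mult.assoc sconst_hom(4) add: sconst_hom(2))
    ultimately show "s \<in> trace_algebra e f n" by simp
  qed
qed

section \<open>The image of the evaluation map\<close>

abbreviation (input) equivariant_generators :: "nat \<Rightarrow> nat \<Rightarrow> nat \<Rightarrow> spoly mat set" where
  "equivariant_generators e f n \<equiv>
     {mtrace (word_mat n w) \<cdot>\<^sub>m 1\<^sub>m n | w. set w \<subseteq> gvars e f} \<union> gen_mat n ` gvars e f"

text \<open>The remaining step of the cycle: the equivariant matrices lie in the trace module, this lies in the generated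
algebra, which lies in the image of the evaluation map, whose elements are equivariant.\<close>

lemma trace_module_subset_generated:
  "trace_module e f n \<subseteq> subalgebra_generated (M_alg e f n) (equivariant_generators e f n)"
proof
  let ?V = "equivariant_generators e f n"
  let ?G = "subalgebra_generated (M_alg e f n) ?V"
  note gen = subalgebra_generated.intros[where A = "M_alg e f n" and V = ?V, unfolded M_alg_simps]
  have scalar: "s \<cdot>\<^sub>m 1\<^sub>m n \<in> ?G" if "s \<in> trace_algebra e f n" for s
    using that unfolding trace_algebra_def
  proof (induction rule: subalgebra_generated.induct)
    case 1
    have "(1 :: spoly) \<cdot>\<^sub>m 1\<^sub>m n = 1\<^sub>m n" by (auto intro!: eq_matI)
    then show ?case using gen(1) by simp
  next
    case (2 x)
    then show ?case by (intro gen(2)) auto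
  next
    case (3 x y)
    have "(x + y) \<cdot>\<^sub>m 1\<^sub>m n = x \<cdot>\<^sub>m 1\<^sub>m n + y \<cdot>\<^sub>m (1\<^sub>m n :: spoly mat)" by (auto intro!: eq_matI)
    then show ?case using gen(3)[OF 3(3,4)] by simp
  next
    case (4 x y)
    have "(x * y) \<cdot>\<^sub>m 1\<^sub>m n = (x \<cdot>\<^sub>m 1\<^sub>m n) * (y \<cdot>\<^sub>m (1\<^sub>m n :: spoly mat))"
      by (subst scalar_mat_mult(1)[of _ n]) (auto intro!: eq_matI simp: mult.assoc)
    then show ?case using gen(4)[OF 4(3,4)] by simp
  next
    case (5 x c)
    have "(sconst c * x) \<cdot>\<^sub>m 1\<^sub>m n = sconst c \<cdot>\<^sub>m (x \<cdot>\<^sub>m (1\<^sub>m n :: spoly mat))"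
      by (auto intro!: eq_matI simp: mult.assoc)
    then show ?case using gen(5)[OF 5(2), of c] by simp
  qed
  have word: "word_mat n w \<in> ?G" if "set w \<subseteq> gvars e f" for w
    using that by (induction w) (auto intro: gen)
  fix A assume "A \<in> trace_module e f n"
  then show "A \<in> ?G"
  proof (induction rule: trace_module.induct)
    case (word s w)
    then have "(s \<cdot>\<^sub>m 1\<^sub>m n) * word_mat n w \<in> ?G" by (intro gen(4) scalar \<open>\<And>w. set w \<subseteq> gvars e f \<Longrightarrow> word_mat n w \<in> ?G\<close>)
    then show ?case by (simp add: scalar_mat_mult[OF word_mat_carrier])
  qed (rule gen(3))
qed

lemma abs_ftr_carrier: "tvars t \<subseteq> gvars e f \<Longrightarrow> abs_ftr t \<in> carrier (FT e f)"
  by (auto simp: carrier_FT)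

lemma ev_simps:
  assumes "x \<in> carrier (FT e f)" "y \<in> carrier (FT e f)"
  shows "ev e f n (x + y) = ev e f n x + ev e f n y" "ev e f n (x * y) = ev e f n x * ev e f n y"
    "ev e f n (ftr_smult c x) = sconst c \<cdot>\<^sub>m ev e f n x" "ev e f n (ftr_trc x) = mtrace (ev e f n x) \<cdot>\<^sub>m 1\<^sub>m n"
  using ev_hom(1)[of e f n] assms
  by (auto simp: trace_superalgebra_hom_def dest: ring_hom_add ring_hom_mult)

lemma ev_one: "ev e f n 1 = 1\<^sub>m n"
  using ev_hom(1)[of e f n] by (auto simp: trace_superalgebra_hom_def dest: ring_hom_one)

lemma ev_image_subset_M_inv: "ev e f n ` carrier (FT e f) \<subseteq> M_inv e f n"
proof (rule image_subsetI)
  fix x assume "x \<in> carrier (FT e f)"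
  then obtain t where t: "x = abs_ftr t" "tvars t \<subseteq> gvars e f" by (auto simp: carrier_FT)
  have "ev e f n (abs_ftr t) \<in> M_inv e f n" using t(2)
  proof (induction t)
    case (TVar v)
    then show ?case by (simp add: ev_hom(2) gen_mat_invariant)
  next
    case TOne
    then show ?case by (simp add: abs_ftr_simps ev_one one_invariant)
  next
    case TZero
    have "ev e f n (ftr_smult 0 1) = sconst 0 \<cdot>\<^sub>m 1\<^sub>m n"
      by (simp only: ev_simps(3)[OF carrier_FT_closed(1) carrier_FT_closed(1)] ev_one)
    then show ?case using M_inv_sconst[OF one_invariant, of 0 n e f] by (simp add: abs_ftr_simps)
  next
    case (TAdd s t)
    then show ?case by (simp add: abs_ftr_simps ev_simps abs_ftr_carrier M_inv_add)
  next
    case (TScal c t)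
    then show ?case by (simp add: abs_ftr_simps ev_simps[where y = 1] abs_ftr_carrier carrier_FT_closed M_inv_sconst)
  next
    case (TMul s t)
    then show ?case by (simp add: abs_ftr_simps ev_simps abs_ftr_carrier M_inv_mult)
  next
    case (TTr t)
    then show ?case by (simp add: abs_ftr_simps ev_simps[where y = 1] abs_ftr_carrier carrier_FT_closed scalar_invariant mtrace_invariant)
  qed
  then show "ev e f n x \<in> M_inv e f n" by (simp add: t)
qed

lemma generated_subset_ev_image:
  "subalgebra_generated (M_alg e f n) (equivariant_generators e f n) \<subseteq> ev e f n ` carrier (FT e f)"
proof
  have gen: "gen_mat n v \<in> ev e f n ` carrier (FT e f)" if "v \<in> gvars e f" for v
    using that ev_hom(2)[OF that, of n] abs_ftr_carrier[of "TVar v" e f] by (intro image_eqI[of _ _ "abs_ftr (TVar v)"]) auto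
  have mult: "A * B \<in> ev e f n ` carrier (FT e f)"
    if "A \<in> ev e f n ` carrier (FT e f)" "B \<in> ev e f n ` carrier (FT e f)" for A B
    using that by (auto simp flip: ev_simps(2) simp: carrier_FT_closed)
  have word: "word_mat n w \<in> ev e f n ` carrier (FT e f)" if "set w \<subseteq> gvars e f" for w
    using that
  proof (induction w)
    case Nil
    show ?case using carrier_FT_closed(1) by (auto simp: ev_one[of e f n, symmetric])
  qed (auto intro: mult gen)
  fix A assume "A \<in> subalgebra_generated (M_alg e f n) (equivariant_generators e f n)"
  then show "A \<in> ev e f n ` carrier (FT e f)"
  proof (induction rule: subalgebra_generated.induct)
    case 1
    show ?case using carrier_FT_closed(1) by (auto simp: ev_one[of e f n, symmetric])
  next
    case (2 x)
    then consider w where "set w \<subseteq> gvars e f" "x = mtrace (word_mat n w) \<cdot>\<^sub>m 1\<^sub>m n" | v where "v \<in> gvars e f" "x = gen_mat n v" by blast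
    then show ?case
    proof cases
      case 1
      from word[OF 1(1)] obtain z where z: "z \<in> carrier (FT e f)" "word_mat n w = ev e f n z" by blast
      then have "x = ev e f n (ftr_trc z)" using 1 ev_simps(4)[OF z(1) z(1)] by simp
      then show ?thesis using z by (simp add: carrier_FT_closed)
    qed (use gen in simp)
  next
    case (3 x y)
    then show ?case by (auto simp flip: ev_simps(1) simp: carrier_FT_closed)
  next
    case (4 x y)
    then show ?case using mult by simp
  next
    case (5 x c)
    then obtain z where z: "z \<in> carrier (FT e f)" "x = ev e f n z" by blast
    then have "c \<odot>\<^bsub>M_alg e f n\<^esub> x = ev e f n (ftr_smult c z)" using ev_simps(3)[OF z(1) z(1)] by simp
    then show ?case using z by (simp add: carrier_FT_closed)
  qed
qed

theorem theorem4p1p1: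
  fixes n e f :: nat
  assumes "n \<ge> 1"
  shows "ev e f n ` carrier (FT e f) = M_inv e f n \<and>
    S_inv e f n = subalgebra_generated (S_alg e f n)
      {mtrace (word_mat n w) | w. set w \<subseteq> gvars e f} \<and>
    M_inv e f n = subalgebra_generated (M_alg e f n)
      ({mtrace (word_mat n w) \<cdot>\<^sub>m 1\<^sub>m n | w. set w \<subseteq> gvars e f} \<union> gen_mat n ` gvars e f)"
  using S_inv_eq_trace_algebra[OF assms, of e f] ev_image_subset_M_inv[of e f n]
    M_inv_subset_trace_module[of e f n] trace_module_subset_generated[of e f n]
    generated_subset_ev_image[of e f n]
  unfolding trace_algebra_def by blast

end
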